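(* Let $e(k)$ denote the number of distinct combinatorial types of $k$-equiprojective polytopes. Then $$e(k)\ \geq\ k^{k\left(\frac{3}{2}+O\left(\frac{1}{\log k}\right)\right)}$$ as $k\to\infty$; that is, there is a function $g$ with $g(k)=O(1/\log k)$ such that $e(k)\geq k^{k(3/2+g(k))}$ for all sufficiently large integers $k$.
   Context: A $3$-dimensional polytope $P\subset\mathbb{R}^3$ is $k$-equiprojective when its orthogonal projection onto any plane that is not orthogonal to a facet of $P$ is a polygon with exactly $k$ vertices. Two polytopes have the same combinatorial type when their face lattices (sets of faces ordered by inclusion) are isomorphic, i.e. there is a bijection between their faces preserving inclusion in both directions. *)

theory Defs
  imports "HOL-Analysis.Analysis" "HOL-Library.Landau_Symbols" "HOL-Library.Extended_Nat"
begin

definition polytope3 :: "(real^3) set \<Rightarrow> bool" where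
  "polytope3 P \<longleftrightarrow> polytope P \<and> aff_dim P = 3"

definition proj_plane :: "real^3 \<Rightarrow> real^3 \<Rightarrow> real^3" where
  "proj_plane u x = x - ((x \<bullet> u) / (u \<bullet> u)) *\<^sub>R u"

text \<open>The plane with normal u is orthogonal to the facet F iff u lies in the
  direction space (linear span of differences) of F.\<close>
definition plane_orth_facet :: "real^3 \<Rightarrow> (real^3) set \<Rightarrow> bool" where
  "plane_orth_facet u F \<longleftrightarrow> u \<in> span {x - y | x y. x \<in> F \<and> y \<in> F}"

definition equiprojective :: "nat \<Rightarrow> (real^3) set \<Rightarrow> bool" where
  "equiprojective k P \<longleftrightarrow> polytope3 P \<and>
     (\<forall>u. u \<noteq> 0 \<and> (\<forall>F. F facet_of P \<longrightarrow> \<not> plane_orth_facet u F) \<longrightarrow>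
        card {v. v extreme_point_of (proj_plane u ` P)} = k)"

text \<open>Same combinatorial type: isomorphic face lattices (faces including the empty face
  and the polytope itself, ordered by inclusion).\<close>
definition same_comb_type :: "(real^3) set \<Rightarrow> (real^3) set \<Rightarrow> bool" where
  "same_comb_type P Q \<longleftrightarrow> (\<exists>f. bij_betw f {F. F face_of P} {G. G face_of Q} \<and>
     (\<forall>F\<in>{F. F face_of P}. \<forall>F'\<in>{F. F face_of P}. F \<subseteq> F' \<longleftrightarrow> f F \<subseteq> f F'))"

definition e :: "nat \<Rightarrow> enat" where
  "e k = (let C = {P. equiprojective k P} // {(P, Q). same_comb_type P Q}
          in if finite C then enat (card C) else \<infinity>)"

end

theory Submission
  imports Defs
begin

text \<open>
  The polytopes are \<open>P = Z + conv V\<close>, where \<open>Z\<close> is the zonotope spanned by \<open>n\<close> generic vectors and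
  \<open>V\<close> is a point (\<open>k = 2 n\<close>) or the vertex set of a triangle (\<open>k = 2 n + 3\<close>). A vertex of \<open>P\<close> is coded
  by a pair \<open>(S, t)\<close>, standing for \<open>\<Sum>i\<in>S. v i + t\<close>, and a face by the set of pairs maximizing a functional
  \<open>w\<close>.

  Along a generic direction every edge direction of \<open>Z\<close> contributes two edges to the projected polygon
  and every edge of the triangle contributes one, so \<open>P\<close> is equiprojective.

  An isomorphism of face lattices carries parallel edges to parallel edges, because opposite edges of
  quadrilateral facets correspond and the edges in direction \<open>v i\<close> form a closed belt of such facets. Hence
  it transports the sign vectors of the configuration up to a map between the generators and finitely many
  sign changes, and at most \<open>(n + 1)\<^sup>n 8\<^sup>n\<close> sets of sign vectors share a combinatorial type.

  Finally, given \<open>i\<close> generic vectors, the planes spanned by pairs of them cut space into at least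
  \<open>(i div 4)\<^sup>4\<close> cells, and placing the next vector in different cells yields different sets of sign vectors.
  This gives \<open>n\<^bsup>4n\<^esup> C\<^bsup>-n\<^esup>\<close> configurations and \<open>n\<^bsup>3n\<^esup> C'\<^bsup>-n\<^esup>\<close> types.
\<close>

section \<open>Linear algebra in three dimensions\<close>

text \<open>The exponent 3/2 balances two counts. A line of the arrangement is where two planes
  meet, each spanned by two vectors, so four indices name it; this is the fourth power in the number
  of cells. From the resulting 4 n log n in the logarithm, the unknown map between the generators
  takes away n log n, and every other loss, 8^n included, is only exponential in n. The remaining 3
  n log n with n = k/2 + O(1) is (3/2) k log k + O(k), whence the error O(1/log k). The obstacle is
  that a face lattice carries no labels: it does not tell which generator an edge belongs to. Hence
  the map \<open>D\<close> between generators is not known to be injective, and it has the extra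
  value \<open>n\<close> for directions coming from the triangle. One set of sign changes is kept
  for each point of \<open>V\<close>, because edges in generator directions join only vertices with
  the same second component; three points cost (2^n)^3. The summand \<open>V\<close> is there for
  parity: the zonotope alone reaches only even \<open>k\<close>.\<close>

definition triple :: "real^3 \<Rightarrow> real^3 \<Rightarrow> real^3 \<Rightarrow> real" where
  "triple a b c = cross3 a b \<bullet> c"

text \<open>Expansion of \<open>w\<close> in the basis reciprocal to \<open>a, b, c\<close>, cleared
  of denominators. Orthogonality to all three vectors then forces \<open>w = 0\<close>, and
  orthogonality to two leaves a multiple of their cross product.\<close>

lemma triple_expand:
  "triple a b c *\<^sub>R w = (w \<bullet> a) *\<^sub>R cross3 b c + (w \<bullet> b) *\<^sub>R cross3 c a + (w \<bullet> c) *\<^sub>R cross3 a b"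
  unfolding triple_def vec_eq_iff forall_3
  by (simp add: cross3_simps)

text \<open>Cramer's rule cleared of denominators; paired with a functional it becomes the linear
  relation among four values.\<close>

lemma triple_cramer:
  "triple a b c *\<^sub>R w = triple w b c *\<^sub>R a + triple a w c *\<^sub>R b + triple a b w *\<^sub>R c"
  unfolding triple_def vec_eq_iff forall_3
  by (simp add: cross3_simps)

lemma triple_perms:
  "triple b c a = triple a b c" "triple c a b = triple a b c"
  "triple b a c = - triple a b c" "triple a c b = - triple a b c" "triple c b a = - triple a b c"
  unfolding triple_def by (simp_all add: cross3_simps)

lemma orthogonal_basis_zero:
  assumes "triple a b c \<noteq> 0" "w \<bullet> a = 0" "w \<bullet> b = 0" "w \<bullet> c = 0"
  shows "w = 0"
  using triple_expand[of a b c w] assms by simp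

lemma orthogonal_two_parallel:
  assumes "cross3 a b \<noteq> 0" "w \<bullet> a = 0" "w \<bullet> b = 0"
  obtains l where "w = l *\<^sub>R cross3 a b"
proof -
  let ?c = "cross3 a b"
  have "(?c \<bullet> ?c) *\<^sub>R w = (w \<bullet> ?c) *\<^sub>R ?c"
    using triple_expand[of a b ?c w] assms by (simp add: triple_def)
  then have "w = ((w \<bullet> ?c) / (?c \<bullet> ?c)) *\<^sub>R ?c"
    using assms(1) by (metis divideR_right inner_eq_zero_iff real_vector.scale_scale
      divide_inverse_commute)
  then show ?thesis using that by blast
qed

lemma two_functionals_solvable:
  assumes "cross3 a b \<noteq> 0"
  obtains d :: "real^3" where "d \<bullet> a = \<alpha>" "d \<bullet> b = \<beta>"
proof -
  let ?n = "cross3 a b"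
  \<comment> \<open>Up to the factor \<open>?n \<bullet> ?n\<close>, the two cross products are dual
    to \<open>a\<close> and \<open>b\<close> within the plane they span.\<close>
  let ?d = "(\<alpha> / (?n \<bullet> ?n)) *\<^sub>R cross3 b ?n + (\<beta> / (?n \<bullet> ?n)) *\<^sub>R cross3 ?n a"
  have nz: "?n \<bullet> ?n \<noteq> 0" using assms by simp
  have 1: "cross3 b ?n \<bullet> a = ?n \<bullet> ?n" "cross3 ?n a \<bullet> b = ?n \<bullet> ?n"
    using triple_perms[of a b ?n] unfolding triple_def by auto
  have 2: "cross3 b ?n \<bullet> b = 0" "cross3 ?n a \<bullet> a = 0"
    by (auto simp: dot_cross_self inner_commute)
  have "?d \<bullet> a = \<alpha>" "?d \<bullet> b = \<beta>"
    using nz by (simp_all add: inner_add_left 1 2)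
  then show ?thesis using that by blast
qed

text \<open>Finitely many hyperplanes have measure zero, so they do not cover a nonempty open
  set.\<close>

lemma open_avoids_hyperplanes:
  fixes A :: "'a::euclidean_space set"
  assumes "finite A" "0 \<notin> A" "open U" "U \<noteq> {}"
  obtains q where "q \<in> U" "\<And>x. x \<in> A \<Longrightarrow> q \<bullet> x \<noteq> 0"
proof -
  have "negligible (\<Union>a\<in>A. {x. a \<bullet> x = 0})"
    using assms by (intro negligible_Union) (auto intro!: negligible_hyperplane)
  then have "\<not> U \<subseteq> (\<Union>a\<in>A. {x. a \<bullet> x = 0})"
    using open_not_negligible[OF assms(3,4)] negligible_subset by blast
  then obtain q where "q \<in> U" "\<forall>a\<in>A. a \<bullet> q \<noteq> 0" by auto
  then show ?thesis using that[of q] by (auto simp: inner_commute)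
qed

section \<open>Zonotopes with a summand\<close>

definition vpoint :: "(nat \<Rightarrow> real^3) \<Rightarrow> nat set \<times> (real^3) \<Rightarrow> real^3" where
  "vpoint v x = sum v (fst x) + snd x"

definition index_set :: "nat \<Rightarrow> (real^3) set \<Rightarrow> (nat set \<times> (real^3)) set" where
  "index_set n V = Pow {..<n} \<times> V"

text \<open>Faces are handled through these finite sets of codes. The functional 0 is maximized by
  every code and stands for the whole body, which is why \<open>w \<noteq> 0\<close> accompanies
  proper faces.\<close>

definition maximizers :: "(nat \<Rightarrow> real^3) \<Rightarrow> nat \<Rightarrow> (real^3) set \<Rightarrow> real^3 \<Rightarrow> (nat set \<times> (real^3)) set" where
  "maximizers v n V w =
     {x \<in> index_set n V. \<forall>y \<in> index_set n V. w \<bullet> vpoint v y \<le> w \<bullet> vpoint v x}"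

definition zeros :: "(nat \<Rightarrow> real^3) \<Rightarrow> nat \<Rightarrow> real^3 \<Rightarrow> nat set" where
  "zeros v n w = {i. i < n \<and> w \<bullet> v i = 0}"

definition positives :: "(nat \<Rightarrow> real^3) \<Rightarrow> nat \<Rightarrow> real^3 \<Rightarrow> nat set" where
  "positives v n w = {i. i < n \<and> w \<bullet> v i > 0}"

definition top_points :: "(real^3) set \<Rightarrow> real^3 \<Rightarrow> (real^3) set" where
  "top_points V w = {t \<in> V. \<forall>t'\<in>V. w \<bullet> t' \<le> w \<bullet> t}"

definition body :: "(nat \<Rightarrow> real^3) \<Rightarrow> nat \<Rightarrow> (real^3) set \<Rightarrow> (real^3) set" where
  "body v n V = convex hull (vpoint v ` index_set n V)"

definition vertices :: "(nat \<Rightarrow> real^3) \<Rightarrow> nat \<Rightarrow> (real^3) set \<Rightarrow> (nat set \<times> (real^3)) set" where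
  "vertices v n V = {x. \<exists>w. maximizers v n V w = {x}}"

lemma inner_vpoint: "w \<bullet> vpoint v x = (\<Sum>i\<in>fst x. w \<bullet> v i) + w \<bullet> snd x"
  by (simp add: vpoint_def inner_add_right inner_sum_right)

text \<open>Compared with the set of positive terms, \<open>S\<close> loses the positive terms it
  omits and pays for the negative ones it contains. Both losses are nonnegative, so equality means
  that both vanish.\<close>

lemma sum_le_sum_positives:
  assumes "S \<subseteq> {..<n}"
  shows "(\<Sum>i\<in>S. w \<bullet> v i) \<le> (\<Sum>i\<in>positives v n w. w \<bullet> v i)"
    and "(\<Sum>i\<in>S. w \<bullet> v i) = (\<Sum>i\<in>positives v n w. w \<bullet> v i) \<longleftrightarrow>
         positives v n w \<subseteq> S \<and> S \<subseteq> positives v n w \<union> zeros v n w"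
proof -
  let ?P = "positives v n w"
  have fin: "finite S" "finite ?P"
    using assms finite_subset by (auto simp: positives_def)
  have S: "(\<Sum>i\<in>S. w \<bullet> v i) = (\<Sum>i\<in>S\<inter>?P. w \<bullet> v i) + (\<Sum>i\<in>S-?P. w \<bullet> v i)"
    using fin by (simp add: sum.Int_Diff[of S _ ?P])
  have P: "(\<Sum>i\<in>?P. w \<bullet> v i) = (\<Sum>i\<in>S\<inter>?P. w \<bullet> v i) + (\<Sum>i\<in>?P-S. w \<bullet> v i)"
    using fin by (simp add: sum.Int_Diff[of ?P _ S] Int_commute)
  have 1: "(\<Sum>i\<in>?P-S. w \<bullet> v i) \<ge> 0"
    by (intro sum_nonneg) (auto simp: positives_def)
  have "(\<Sum>i\<in>?P-S. w \<bullet> v i) = 0 \<longleftrightarrow> (\<forall>i\<in>?P-S. w \<bullet> v i = 0)"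
    using fin by (intro sum_nonneg_eq_0_iff) (auto simp: positives_def)
  then have p1: "(\<Sum>i\<in>?P-S. w \<bullet> v i) = 0 \<longleftrightarrow> ?P \<subseteq> S"
    by (auto simp: positives_def)
  have np: "- (w \<bullet> v i) \<ge> 0" if "i \<in> S - ?P" for i
    using that assms by (auto simp: positives_def)
  have 2: "(\<Sum>i\<in>S-?P. - (w \<bullet> v i)) \<ge> 0"
    using np by (intro sum_nonneg) auto
  have "(\<Sum>i\<in>S-?P. - (w \<bullet> v i)) = 0 \<longleftrightarrow> (\<forall>i\<in>S-?P. - (w \<bullet> v i) = 0)"
    using fin np by (intro sum_nonneg_eq_0_iff) auto
  also have "\<dots> \<longleftrightarrow> S \<subseteq> ?P \<union> zeros v n w"
    using assms by (auto simp: zeros_def positives_def)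
  finally have p2: "(\<Sum>i\<in>S-?P. - (w \<bullet> v i)) = 0 \<longleftrightarrow> S \<subseteq> ?P \<union> zeros v n w" .
  have neg: "(\<Sum>i\<in>S-?P. w \<bullet> v i) = - (\<Sum>i\<in>S-?P. - (w \<bullet> v i))"
    by (simp add: sum_negf)
  show "(\<Sum>i\<in>S. w \<bullet> v i) \<le> (\<Sum>i\<in>?P. w \<bullet> v i)"
    using S P 1 2 neg by linarith
  have "(\<Sum>i\<in>S. w \<bullet> v i) = (\<Sum>i\<in>?P. w \<bullet> v i) \<longleftrightarrow>
      (\<Sum>i\<in>?P-S. w \<bullet> v i) = 0 \<and> (\<Sum>i\<in>S-?P. - (w \<bullet> v i)) = 0"
    using S P 1 2 neg by linarith
  then show "(\<Sum>i\<in>S. w \<bullet> v i) = (\<Sum>i\<in>?P. w \<bullet> v i) \<longleftrightarrow> ?P \<subseteq> S \<and> S \<subseteq> ?P \<union> zeros v n w"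
    unfolding p1 p2 .
qed

lemma finite_index_set: "finite V \<Longrightarrow> finite (index_set n V)"
  by (simp add: index_set_def)

lemma finite_maximizers: "finite V \<Longrightarrow> finite (maximizers v n V w)"
  unfolding maximizers_def using finite_index_set by simp

lemma maximizers_subset: "maximizers v n V w \<subseteq> index_set n V"
  by (auto simp: maximizers_def)

lemma top_points_nonempty:
  assumes "finite V" "V \<noteq> {}"
  shows "top_points V w \<noteq> {}"
proof -
  have "Max ((\<bullet>) w ` V) \<in> (\<bullet>) w ` V" using assms by simp
  then obtain t where "t \<in> V" "w \<bullet> t = Max ((\<bullet>) w ` V)" by auto
  then have "t \<in> top_points V w" using assms by (auto simp: top_points_def)
  then show ?thesis by auto
qed

text \<open>A functional on a Minkowski sum is maximized summand by summand. A generator with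
  positive value is taken, one with negative value is left out, one with value zero is free; a face
  is thus a cube on the zero set times a face of \<open>conv V\<close>.\<close>

lemma maximizers_eq:
  assumes "finite V" "V \<noteq> {}"
  shows "maximizers v n V w =
    {S. positives v n w \<subseteq> S \<and> S \<subseteq> positives v n w \<union> zeros v n w} \<times> top_points V w"
proof -
  let ?P = "positives v n w"
  have sub: "?P \<subseteq> {..<n}" "zeros v n w \<subseteq> {..<n}" by (auto simp: positives_def zeros_def)
  obtain t0 where t0: "t0 \<in> top_points V w" using top_points_nonempty[OF assms] by blast
  then have t0V: "t0 \<in> V" and t0max: "\<And>t. t \<in> V \<Longrightarrow> w \<bullet> t \<le> w \<bullet> t0"
    by (auto simp: top_points_def)
  have "(S, t) \<in> maximizers v n V w \<longleftrightarrow> ?P \<subseteq> S \<and> S \<subseteq> ?P \<union> zeros v n w \<and> t \<in> top_points V w" for S t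
  proof
    assume L: "(S, t) \<in> maximizers v n V w"
    then have St: "S \<subseteq> {..<n}" "t \<in> V" by (auto simp: maximizers_def index_set_def)
    have "(?P, t0) \<in> index_set n V" using t0V sub by (auto simp: index_set_def)
    then have "w \<bullet> vpoint v (?P, t0) \<le> w \<bullet> vpoint v (S, t)"
      using L by (auto simp: maximizers_def)
    then have "(\<Sum>i\<in>S. w \<bullet> v i) = (\<Sum>i\<in>?P. w \<bullet> v i)" "w \<bullet> t = w \<bullet> t0"
      using sum_le_sum_positives(1)[OF St(1), of w v] t0max[OF St(2)] by (auto simp: inner_vpoint)
    then show "?P \<subseteq> S \<and> S \<subseteq> ?P \<union> zeros v n w \<and> t \<in> top_points V w"
      using sum_le_sum_positives(2)[OF St(1), of w v] t0max St(2) by (auto simp: top_points_def)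
  next
    assume R: "?P \<subseteq> S \<and> S \<subseteq> ?P \<union> zeros v n w \<and> t \<in> top_points V w"
    then have S: "S \<subseteq> {..<n}" using sub by blast
    have "w \<bullet> vpoint v y \<le> w \<bullet> vpoint v (S, t)" if "y \<in> index_set n V" for y
    proof -
      have "fst y \<subseteq> {..<n}" "snd y \<in> V" using that by (auto simp: index_set_def)
      then have "(\<Sum>i\<in>fst y. w \<bullet> v i) \<le> (\<Sum>i\<in>?P. w \<bullet> v i)" "w \<bullet> snd y \<le> w \<bullet> t"
        using sum_le_sum_positives(1) R by (auto simp: top_points_def)
      moreover have "(\<Sum>i\<in>S. w \<bullet> v i) = (\<Sum>i\<in>?P. w \<bullet> v i)"
        using sum_le_sum_positives(2)[OF S, of w v] R by blast
      ultimately show ?thesis by (simp add: inner_vpoint)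
    qed
    then show "(S, t) \<in> maximizers v n V w"
      using S R by (auto simp: maximizers_def index_set_def top_points_def)
  qed
  then show ?thesis by auto
qed

lemma card_interval_sets:
  assumes "finite Z" "P \<inter> Z = {}"
  shows "card {S. P \<subseteq> S \<and> S \<subseteq> P \<union> Z} = 2 ^ card Z"
proof -
  have "bij_betw (\<lambda>T. P \<union> T) (Pow Z) {S. P \<subseteq> S \<and> S \<subseteq> P \<union> Z}"
    by (rule bij_betwI[where g = "\<lambda>S. S - P"]) (use assms in auto)
  then show ?thesis using bij_betw_same_card card_Pow[OF assms(1)] by metis
qed

lemma card_maximizers:
  assumes "finite V" "V \<noteq> {}"
  shows "card (maximizers v n V w) = 2 ^ card (zeros v n w) * card (top_points V w)"
proof -
  have "finite (zeros v n w)" "positives v n w \<inter> zeros v n w = {}"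
    by (auto simp: positives_def zeros_def)
  then show ?thesis
    unfolding maximizers_eq[OF assms] card_cartesian_product by (simp add: card_interval_sets)
qed

lemma maximizers_nonempty:
  assumes "finite V" "V \<noteq> {}"
  shows "maximizers v n V w \<noteq> {}"
  unfolding maximizers_eq[OF assms] using top_points_nonempty[OF assms] by blast

text \<open>Strict inequalities between the finitely many values at the codes survive a small change
  of \<open>w\<close>, so no new maximizer can appear.\<close>

lemma eventually_maximizers_subset:
  assumes "finite V"
  shows "\<forall>\<^sub>F w' in nhds w. maximizers v n V w' \<subseteq> maximizers v n V w"
proof (cases "V = {}")
  case True then show ?thesis by (simp add: maximizers_def index_set_def)
next
  case False
  note fin = finite_index_set[OF assms, of n]
  have "\<forall>\<^sub>F w' in nhds w. \<forall>x\<in>index_set n V. \<forall>y\<in>index_set n V.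
      w \<bullet> vpoint v x < w \<bullet> vpoint v y \<longrightarrow> w' \<bullet> vpoint v x < w' \<bullet> vpoint v y"
  proof (intro eventually_ball_finite[OF fin] ballI)
    fix x y
    show "\<forall>\<^sub>F w' in nhds w. w \<bullet> vpoint v x < w \<bullet> vpoint v y \<longrightarrow> w' \<bullet> vpoint v x < w' \<bullet> vpoint v y"
    proof (cases "w \<bullet> vpoint v x < w \<bullet> vpoint v y")
      case True
      have "open {w'. w' \<bullet> vpoint v x < w' \<bullet> vpoint v y}"
        by (intro open_Collect_less continuous_intros)
      from eventually_nhds_in_open[OF this, of w] show ?thesis
        using True by (auto elim: eventually_mono)
    qed auto
  qed
  then show ?thesis
  proof (rule eventually_mono)
    fix w' assume *: "\<forall>x\<in>index_set n V. \<forall>y\<in>index_set n V.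
      w \<bullet> vpoint v x < w \<bullet> vpoint v y \<longrightarrow> w' \<bullet> vpoint v x < w' \<bullet> vpoint v y"
    then show "maximizers v n V w' \<subseteq> maximizers v n V w"
      unfolding maximizers_def by (auto simp: not_le[symmetric])
  qed
qed

lemma perturbed_maximizers:
  assumes "finite V"
  obtains \<epsilon> where "\<epsilon> > 0" "w \<noteq> 0 \<longrightarrow> w + \<epsilon> *\<^sub>R d \<noteq> 0"
    "maximizers v n V (w + \<epsilon> *\<^sub>R d) \<subseteq> maximizers v n V w"
proof -
  have lim: "((\<lambda>e. w + e *\<^sub>R d) \<longlongrightarrow> w) (at_right (0::real))"
    by (auto intro!: tendsto_eq_intros)
  have "\<forall>\<^sub>F e in at_right 0. maximizers v n V (w + e *\<^sub>R d) \<subseteq> maximizers v n V w"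
    using eventually_maximizers_subset[OF assms, of v n w] lim
    by (rule eventually_compose_filterlim)
  moreover have "\<forall>\<^sub>F e in at_right 0. w \<noteq> 0 \<longrightarrow> w + e *\<^sub>R d \<noteq> 0"
    using tendsto_imp_eventually_ne[OF lim, of 0] by (cases "w = 0") auto
  ultimately have "\<forall>\<^sub>F e in at_right 0. 0 < e \<and> (w \<noteq> 0 \<longrightarrow> w + e *\<^sub>R d \<noteq> 0) \<and>
      maximizers v n V (w + e *\<^sub>R d) \<subseteq> maximizers v n V w"
    using eventually_at_right_less[of "0::real"] by eventually_elim auto
  then show ?thesis
    using that eventually_happens[of _ "at_right (0::real)"] trivial_limit_at_right_real by blast
qed

section \<open>Faces\<close>

text \<open>The section is a face of the hull, hence the hull of some points of \<open>A\<close>,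
  and these can only be points on the hyperplane.\<close>

lemma convex_hull_Int_supporting_hyperplane:
  fixes A :: "'a::euclidean_space set"
  assumes "finite A" "\<And>a. a \<in> A \<Longrightarrow> w \<bullet> a \<le> c"
  shows "convex hull A \<inter> {x. w \<bullet> x = c} = convex hull {a \<in> A. w \<bullet> a = c}"
    and "convex hull A \<subseteq> {x. w \<bullet> x \<le> c}"
proof -
  show le: "convex hull A \<subseteq> {x. w \<bullet> x \<le> c}"
    using assms(2) by (intro hull_minimal convex_halfspace_le) auto
  let ?T = "convex hull A \<inter> {x. w \<bullet> x = c}"
  have "?T face_of convex hull A"
    using le by (intro face_of_Int_supporting_hyperplane_le) auto
  then obtain S where S: "S \<subseteq> A" "?T = convex hull S"
    using face_of_convex_hull_subset finite_imp_compact[OF assms(1)] by metis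
  have "S \<subseteq> ?T" using S(2) hull_subset by metis
  then have "?T \<subseteq> convex hull {a \<in> A. w \<bullet> a = c}"
    by (subst S(2)) (use S(1) in \<open>auto intro!: hull_mono\<close>)
  moreover have "convex hull {a \<in> A. w \<bullet> a = c} \<subseteq> convex hull A"
    by (intro hull_mono) auto
  moreover have "convex hull {a \<in> A. w \<bullet> a = c} \<subseteq> {x. w \<bullet> x = c}"
    by (intro hull_minimal convex_hyperplane) auto
  ultimately show "?T = convex hull {a \<in> A. w \<bullet> a = c}" by blast
qed

text \<open>Extreme points are the atoms of the face lattice, so an isomorphism carries them to
  extreme points, and the incidence \<open>x \<in> F\<close> is the order relation
  \<open>{x} \<subseteq> F\<close>.\<close>

lemma face_isomorphism_extreme_points:
  fixes P Q :: "(real^3) set"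
  assumes P: "compact P" "convex P" and Q: "compact Q" "convex Q" and "same_comb_type P Q"
  obtains f h where "bij_betw f {F. F face_of P} {G. G face_of Q}"
    "bij_betw h {x. x extreme_point_of P} {y. y extreme_point_of Q}"
    "\<forall>F x. F face_of P \<longrightarrow> x extreme_point_of P \<longrightarrow> (x \<in> F \<longleftrightarrow> h x \<in> f F)"
    "f {} = {}" "f P = Q"
proof -
  obtain f where bij: "bij_betw f {F. F face_of P} {G. G face_of Q}"
    and ord: "\<And>F F'. F face_of P \<Longrightarrow> F' face_of P \<Longrightarrow> F \<subseteq> F' \<longleftrightarrow> f F \<subseteq> f F'"
    using assms(5) unfolding same_comb_type_def by auto
  have fin: "f F face_of Q" if "F face_of P" for F
    using bij that by (auto simp: bij_betw_def)
  have surj: "\<exists>F. F face_of P \<and> f F = G" if "G face_of Q" for G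
    using bij that by (auto simp: bij_betw_def image_iff set_eq_iff) (metis mem_Collect_eq)
  have inj: "F = F'" if "F face_of P" "F' face_of P" "f F = f F'" for F F'
    using bij that by (auto simp: bij_betw_def inj_on_def)
  have f0: "f {} = {}"
    using surj[of "{}"] ord[of "{}"] by (auto simp: empty_face_of)
  have fP: "f P = Q"
  proof -
    obtain F where F: "F face_of P" "f F = Q" using surj[of Q] Q face_of_refl by blast
    then have "F \<subseteq> P" using face_of_imp_subset by blast
    then have "Q \<subseteq> f P" using ord[OF F(1), of P] F(2) P face_of_refl by blast
    moreover have "f P \<subseteq> Q" using fin[of P] P face_of_refl face_of_imp_subset by blast
    ultimately show ?thesis by blast
  qed
  have ext: "\<exists>x. x extreme_point_of P \<and> x \<in> F" if "F face_of P" "F \<noteq> {}" for F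
    using extreme_point_exists_convex[of F] that P extreme_point_of_face
    by (metis face_of_imp_compact face_of_imp_convex)
  have extQ: "\<exists>x. x extreme_point_of Q \<and> x \<in> F" if "F face_of Q" "F \<noteq> {}" for F
    using extreme_point_exists_convex[of F] that Q extreme_point_of_face
    by (metis face_of_imp_compact face_of_imp_convex)
  have a: "\<exists>y. y extreme_point_of Q \<and> f {x} = {y}" if x: "x extreme_point_of P" for x
  proof -
    have xf: "{x} face_of P" using x by (simp add: face_of_singleton)
    then have "f {x} \<noteq> {}" using inj[of "{x}" "{}"] f0 by (auto simp: empty_face_of)
    then obtain y where y: "y extreme_point_of Q" "y \<in> f {x}" using extQ fin[OF xf] by blast
    \<comment> \<open>The preimage of \<open>{y}\<close> lies below \<open>{x}\<close> and is
      nonempty, so it is \<open>{x}\<close> itself.\<close>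
    obtain G where G: "G face_of P" "f G = {y}"
      using surj[of "{y}"] y(1) by (auto simp: face_of_singleton)
    then have "G \<subseteq> {x}" using ord[OF G(1) xf] y(2) by simp
    moreover have "G \<noteq> {}" using G f0 by auto
    ultimately have "G = {x}" by auto
    then show ?thesis using G y by auto
  qed
  have b: "\<exists>x. x extreme_point_of P \<and> f {x} = {y}" if y: "y extreme_point_of Q" for y
  proof -
    obtain G where G: "G face_of P" "f G = {y}"
      using surj[of "{y}"] y(1) by (auto simp: face_of_singleton)
    then have "G \<noteq> {}" using f0 by auto
    then obtain x where x: "x extreme_point_of P" "x \<in> G" using ext G by blast
    have "f {x} \<subseteq> {y}" using ord[of "{x}" G] x G by (auto simp: face_of_singleton)
    then show ?thesis using a[OF x(1)] x(1) by auto
  qed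
  define h where "h = (\<lambda>x. the_elem (f {x}))"
  have h: "f {x} = {h x}" "h x extreme_point_of Q" if x: "x extreme_point_of P" for x
  proof -
    obtain y where "y extreme_point_of Q" "f {x} = {y}" using a[OF x] by blast
    then show "f {x} = {h x}" "h x extreme_point_of Q" by (simp_all add: h_def)
  qed
  have "bij_betw h {x. x extreme_point_of P} {y. y extreme_point_of Q}"
    unfolding bij_betw_def
  proof
    show "inj_on h {x. x extreme_point_of P}"
    proof (rule inj_onI, clarsimp)
      fix x y assume *: "x extreme_point_of P" "y extreme_point_of P" "h x = h y"
      then have "f {x} = f {y}" using h by simp
      then show "x = y" using inj[of "{x}" "{y}"] * by (simp add: face_of_singleton)
    qed
    show "h ` {x. x extreme_point_of P} = {y. y extreme_point_of Q}"
    proof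
      show "h ` {x. x extreme_point_of P} \<subseteq> {y. y extreme_point_of Q}" using h(2) by auto
      show "{y. y extreme_point_of Q} \<subseteq> h ` {x. x extreme_point_of P}"
      proof clarify
        fix y assume "y extreme_point_of Q"
        then obtain x where "x extreme_point_of P" "f {x} = {y}" using b by blast
        then show "y \<in> h ` {x. x extreme_point_of P}" using h(1)[of x] by auto
      qed
    qed
  qed
  moreover have "x \<in> F \<longleftrightarrow> h x \<in> f F" if "F face_of P" "x extreme_point_of P" for F x
    using ord[of "{x}" F] that h(1)[of x] by (simp add: face_of_singleton)
  ultimately show ?thesis using that bij f0 fP by blast
qed

section \<open>Faces and vertices of a generic body\<close>

locale generic_config =
  fixes v :: "nat \<Rightarrow> real^3" and n :: nat and V :: "(real^3) set"
  assumes n_ge_3: "3 \<le> n"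
    and finite_V: "finite V" and V_nonempty: "V \<noteq> {}" and card_V: "card V \<le> 3"
    and generic_vvv: "\<lbrakk>i < n; j < n; k < n; i \<noteq> j; i \<noteq> k; j \<noteq> k\<rbrakk> \<Longrightarrow> triple (v i) (v j) (v k) \<noteq> 0"
    and generic_vvt: "\<lbrakk>i < n; j < n; i \<noteq> j; t \<in> V; t' \<in> V; t \<noteq> t'\<rbrakk> \<Longrightarrow> triple (v i) (v j) (t - t') \<noteq> 0"
    and generic_vtt: "\<lbrakk>i < n; t \<in> V; t' \<in> V; t'' \<in> V; t \<noteq> t'; t \<noteq> t''; t' \<noteq> t''\<rbrakk>
      \<Longrightarrow> triple (v i) (t' - t) (t'' - t) \<noteq> 0"
begin

abbreviation "X \<equiv> maximizers v n V"
abbreviation "Z \<equiv> zeros v n"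
abbreviation "Pos \<equiv> positives v n"
abbreviation "M \<equiv> top_points V"
abbreviation "pt \<equiv> vpoint v"
abbreviation "body' \<equiv> body v n V"
abbreviation "face w \<equiv> convex hull (pt ` X w)"

lemmas X_eq = maximizers_eq[OF finite_V V_nonempty]
lemmas card_X = card_maximizers[OF finite_V V_nonempty]
lemmas X_nonempty = maximizers_nonempty[OF finite_V V_nonempty]
lemmas M_nonempty = top_points_nonempty[OF finite_V V_nonempty]

lemma finite_Z [simp]: "finite (Z w)" by (simp add: zeros_def)
lemma finite_M [simp]: "finite (M w)" using finite_V by (simp add: top_points_def)
lemma M_subset: "M w \<subseteq> V" by (auto simp: top_points_def)
lemma card_M_pos: "card (M w) \<ge> 1" using M_nonempty[of w] by (simp add: Suc_le_eq card_gt_0_iff)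
lemma M_eq_inner: "t \<in> M w \<Longrightarrow> t' \<in> M w \<Longrightarrow> w \<bullet> t = w \<bullet> t'"
  by (auto simp: top_points_def intro: antisym)

lemma cross_vv: "\<lbrakk>i < n; j < n; i \<noteq> j\<rbrakk> \<Longrightarrow> cross3 (v i) (v j) \<noteq> 0"
proof -
  assume a: "i < n" "j < n" "i \<noteq> j"
  \<comment> \<open>Two indices cannot exhaust 0, 1, 2; the nonzero determinant with a third
    generator rules out a vanishing cross product.\<close>
  have "\<not> {0,1,2} \<subseteq> {i,j}" by auto
  then obtain k where "k < n" "k \<noteq> i" "k \<noteq> j" using n_ge_3 by fastforce
  then show ?thesis using generic_vvv[of i j k] a by (auto simp: triple_def)
qed

lemma cross_vt: "\<lbrakk>i < n; t \<in> V; t' \<in> V; t \<noteq> t'\<rbrakk> \<Longrightarrow> cross3 (v i) (t - t') \<noteq> 0"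
proof -
  assume a: "i < n" "t \<in> V" "t' \<in> V" "t \<noteq> t'"
  have "\<not> {0,1,2} \<subseteq> {i}" by auto
  then obtain k where "k < n" "k \<noteq> i" using n_ge_3 by fastforce
  then show ?thesis using generic_vvt[of i k t t'] a triple_perms(4)[of "v i" "t - t'" "v k"]
    by (auto simp: triple_def)
qed

lemma cross_tt: "\<lbrakk>t \<in> V; t' \<in> V; t'' \<in> V; t \<noteq> t'; t \<noteq> t''; t' \<noteq> t''\<rbrakk>
   \<Longrightarrow> cross3 (t' - t) (t'' - t) \<noteq> 0"
  using generic_vtt[of 0 t t' t''] n_ge_3 triple_perms(2)[of "t' - t" "t'' - t" "v 0"] triple_perms(1)[of "t' - t" "t'' - t" "v 0"]
  by (auto simp: triple_def)

text \<open>Every index in \<open>Z w\<close> and every top point beyond the first is a linear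
  condition on \<open>w\<close>, and by genericity three such conditions leave only
  \<open>w = 0\<close>. Facets can therefore only be parallelograms or triangles.\<close>

lemma small_face:
  assumes "w \<noteq> 0"
  shows "card (Z w) + card (M w) \<le> 3"
proof (rule ccontr)
  assume "\<not> ?thesis"
  then consider "card (Z w) \<ge> 3" | "card (Z w) \<ge> 2" "card (M w) \<ge> 2" | "card (Z w) \<ge> 1" "card (M w) \<ge> 3"
    using card_M_pos[of w] card_mono[OF finite_V M_subset, of w] card_V by linarith
  then show False
  proof cases
    case 1
    then obtain B where "B \<subseteq> Z w" "card B = 3" using obtain_subset_with_card_n by metis
    then obtain i j k where "{i,j,k} \<subseteq> Z w" "i \<noteq> j" "i \<noteq> k" "j \<noteq> k" by (auto simp: card_3_iff)
    then show False
      using orthogonal_basis_zero[OF generic_vvv[of i j k], of w] assms by (auto simp: zeros_def)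
  next
    case 2
    obtain B where "B \<subseteq> Z w" "card B = 2" using obtain_subset_with_card_n 2(1) by metis
    then obtain i j where ij: "{i,j} \<subseteq> Z w" "i \<noteq> j" by (auto simp: card_2_iff)
    obtain C where "C \<subseteq> M w" "card C = 2" using obtain_subset_with_card_n 2(2) by metis
    then obtain t t' where t: "{t,t'} \<subseteq> M w" "t \<noteq> t'" by (auto simp: card_2_iff)
    then have "w \<bullet> (t - t') = 0" using M_eq_inner[of t w t'] by (simp add: inner_diff_right)
    then show False
      using orthogonal_basis_zero[OF generic_vvt[of i j t t'], of w] ij t M_subset[of w] assms
      by (auto simp: zeros_def)
  next
    case 3
    then obtain i where i: "i \<in> Z w" by (metis card.empty ex_in_conv not_one_le_zero)
    obtain C where "C \<subseteq> M w" "card C = 3" using obtain_subset_with_card_n 3(2) by metis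
    then obtain t t' t'' where t: "{t,t',t''} \<subseteq> M w" "t \<noteq> t'" "t \<noteq> t''" "t' \<noteq> t''"
      by (auto simp: card_3_iff)
    then have "w \<bullet> (t' - t) = 0" "w \<bullet> (t'' - t) = 0"
      using M_eq_inner[of t w t'] M_eq_inner[of t w t''] by (simp_all add: inner_diff_right)
    then show False
      using orthogonal_basis_zero[OF generic_vtt[of i t t' t''], of w] i t M_subset[of w] assms
      by (auto simp: zeros_def)
  qed
qed

text \<open>By \<open>small_face\<close> there are at most two conditions on \<open>d\<close>, on
  independent vectors, so the values on \<open>Z w\<close> can be prescribed while \<open>t\<close>
  becomes the strict maximum on \<open>M w\<close>.\<close>

lemma perturbation_direction:
  assumes "w \<noteq> 0" "t \<in> M w"
  shows "\<exists>d. (\<forall>i\<in>Z w. d \<bullet> v i = \<alpha> i) \<and> (\<forall>t'\<in>M w - {t}. d \<bullet> t' < d \<bullet> t)"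
proof -
  have tV: "t \<in> V" using assms M_subset by auto
  have Zn: "\<And>i. i \<in> Z w \<Longrightarrow> i < n" by (auto simp: zeros_def)
  have cM: "card (M w - {t}) = card (M w) - 1" using assms(2) by simp
  then have "card (Z w) + card (M w - {t}) \<le> 2" using small_face[OF assms(1)] card_M_pos[of w] by linarith
  then consider "card (Z w) = 0" "card (M w - {t}) = 0"
    | "card (Z w) = 0" "card (M w - {t}) = 1"
    | "card (Z w) = 0" "card (M w - {t}) = 2"
    | "card (Z w) = 1" "card (M w - {t}) = 0"
    | "card (Z w) = 1" "card (M w - {t}) = 1"
    | "card (Z w) = 2" "card (M w - {t}) = 0" by linarith
  then show ?thesis
  proof cases
    case 1 then show ?thesis by auto
  next
    case 2
    then obtain s where s: "M w - {t} = {s}" by (auto simp: card_1_singleton_iff)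
    then have "s \<noteq> t" by auto
    then have "(t - s) \<bullet> (t - s) > 0" by simp
    then have "(t - s) \<bullet> s < (t - s) \<bullet> t" by (simp add: inner_diff_right)
    then show ?thesis using 2 s by (intro exI[of _ "t - s"]) auto
  next
    case 3
    then obtain s s' where s: "M w - {t} = {s, s'}" "s \<noteq> s'" by (auto simp: card_2_iff)
    then have sV: "s \<in> V" "s' \<in> V" "s \<noteq> t" "s' \<noteq> t" using M_subset[of w] by auto
    obtain d where "d \<bullet> (s - t) = -1" "d \<bullet> (s' - t) = -1"
      using two_functionals_solvable[OF cross_tt[of t s s']] sV s(2) tV by metis
    then show ?thesis using 3 s(1) by (intro exI[of _ d]) (auto simp: inner_diff_right)
  next
    case 4
    then obtain i where i: "Z w = {i}" by (auto simp: card_1_singleton_iff)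
    have "\<not> {0,1,2} \<subseteq> {i}" by auto
    then obtain k where "k < n" "k \<noteq> i" using n_ge_3 by fastforce
    then obtain d where "d \<bullet> v i = \<alpha> i" "d \<bullet> v k = 0"
      using two_functionals_solvable[OF cross_vv[of i k]] i Zn by (metis singletonI)
    then show ?thesis using 4 i by (intro exI[of _ d]) auto
  next
    case 5
    then obtain i s where i: "Z w = {i}" and s: "M w - {t} = {s}" by (auto simp: card_1_singleton_iff)
    then have sV: "s \<in> V" "s \<noteq> t" using M_subset[of w] by auto
    then obtain d where "d \<bullet> v i = \<alpha> i" "d \<bullet> (s - t) = -1"
      using two_functionals_solvable[OF cross_vt[of i s t]] i Zn tV by (metis singletonI)
    then show ?thesis using i s by (intro exI[of _ d]) (auto simp: inner_diff_right)
  next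
    case 6
    then obtain i j where i: "Z w = {i, j}" "i \<noteq> j" by (auto simp: card_2_iff)
    then obtain d where "d \<bullet> v i = \<alpha> i" "d \<bullet> v j = \<alpha> j"
      using two_functionals_solvable[OF cross_vv[of i j]] Zn by (metis insertI1 insertI2)
    then show ?thesis using 6 i by (intro exI[of _ d]) auto
  qed
qed

lemma maximizers_subset_sandwich:
  assumes "X w' \<subseteq> X w"
  shows "Pos w \<subseteq> Pos w'" "Pos w' \<union> Z w' \<subseteq> Pos w \<union> Z w" "M w' \<subseteq> M w"
proof -
  obtain t where t: "t \<in> M w'" using M_nonempty by blast
  have "(Pos w', t) \<in> X w'" "(Pos w' \<union> Z w', t) \<in> X w'" using t by (auto simp: X_eq)
  then have "(Pos w', t) \<in> X w" "(Pos w' \<union> Z w', t) \<in> X w" using assms by auto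
  then show "Pos w \<subseteq> Pos w'" "Pos w' \<union> Z w' \<subseteq> Pos w \<union> Z w" by (auto simp: X_eq)
  show "M w' \<subseteq> M w"
  proof
    fix s assume "s \<in> M w'"
    then have "(Pos w', s) \<in> X w'" by (auto simp: X_eq)
    then show "s \<in> M w" using assms by (auto simp: X_eq)
  qed
qed

text \<open>A small move of \<open>w\<close> settles every tie: the signs of \<alpha> decide the
  free generators, the value zero keeps a generator free, and \<open>t\<close> becomes the only top
  point. Vertices and edges inside a given face are obtained from it.\<close>

lemma refined_functional:
  assumes "w \<noteq> 0" "t \<in> M w"
  obtains w' where "w' \<noteq> 0" "X w' \<subseteq> X w" "Z w' = {i \<in> Z w. \<alpha> i = (0::real)}"
    "Pos w' = Pos w \<union> {i \<in> Z w. \<alpha> i > 0}" "M w' = {t}"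
proof -
  obtain d where d: "\<And>i. i \<in> Z w \<Longrightarrow> d \<bullet> v i = \<alpha> i" "\<And>t'. t' \<in> M w \<Longrightarrow> t' \<noteq> t \<Longrightarrow> d \<bullet> t' < d \<bullet> t"
    using perturbation_direction[OF assms, of \<alpha>] by auto
  obtain e where e: "e > 0" "w + e *\<^sub>R d \<noteq> 0" "X (w + e *\<^sub>R d) \<subseteq> X w"
    using perturbed_maximizers[OF finite_V] assms(1) by metis
  let ?w = "w + e *\<^sub>R d"
  note sw = maximizers_subset_sandwich[OF e(3)]
  have val: "?w \<bullet> v i = e * \<alpha> i" if "i \<in> Z w" for i
    using that d(1)[OF that] by (simp add: inner_add_left zeros_def)
  have disj: "Pos w \<inter> Z w = {}" "Pos ?w \<inter> Z ?w = {}" by (auto simp: positives_def zeros_def)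
  have Zs: "Z w \<subseteq> {..<n}" by (auto simp: zeros_def)
  have 1: "Z ?w = {i \<in> Z w. \<alpha> i = 0}"
  proof
    show "Z ?w \<subseteq> {i \<in> Z w. \<alpha> i = 0}"
    proof
      fix i assume i: "i \<in> Z ?w"
      then have "i \<in> Z w" using sw disj by blast
      then show "i \<in> {i \<in> Z w. \<alpha> i = 0}" using val[of i] i e(1) by (auto simp: zeros_def)
    qed
    show "{i \<in> Z w. \<alpha> i = 0} \<subseteq> Z ?w" using val Zs by (fastforce simp: zeros_def)
  qed
  have 2: "Pos ?w = Pos w \<union> {i \<in> Z w. \<alpha> i > 0}"
  proof
    show "Pos ?w \<subseteq> Pos w \<union> {i \<in> Z w. \<alpha> i > 0}"
    proof
      fix i assume i: "i \<in> Pos ?w"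
      then have "i \<in> Pos w \<or> i \<in> Z w" using sw by blast
      then show "i \<in> Pos w \<union> {i \<in> Z w. \<alpha> i > 0}"
        using val[of i] i e(1) by (auto simp: positives_def zero_less_mult_iff)
    qed
    show "Pos w \<union> {i \<in> Z w. \<alpha> i > 0} \<subseteq> Pos ?w"
      using sw(1) val Zs e(1) by (auto simp: positives_def)
  qed
  have "s = t" if "s \<in> M ?w" for s
  proof (rule ccontr)
    assume "s \<noteq> t"
    have "s \<in> M w" using that sw by auto
    then have "w \<bullet> s = w \<bullet> t" "d \<bullet> s < d \<bullet> t" 
      using M_eq_inner[OF _ assms(2)] d(2)[OF _ \<open>s \<noteq> t\<close>] by blast+
    then have "?w \<bullet> s < ?w \<bullet> t" using e(1) by (simp add: inner_add_left)
    then show False using that assms(2) M_subset[of w] by (force simp: top_points_def)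
  qed
  then have "M ?w = {t}" using M_nonempty[of ?w] by auto
  then show ?thesis using that e 1 2 by blast
qed

lemma maximizer_is_vertex:
  assumes "w \<noteq> 0" "(S, t) \<in> X w"
  obtains w' where "w' \<noteq> 0" "X w' = {(S, t)}"
proof -
  have t: "t \<in> M w" and S: "Pos w \<subseteq> S" "S \<subseteq> Pos w \<union> Z w" using assms(2) by (auto simp: X_eq)
  \<comment> \<open>Giving each free generator the sign that matches its membership in
    \<open>S\<close> leaves \<open>(S, t)\<close> as the only maximizer.\<close>
  define \<alpha> :: "nat \<Rightarrow> real" where "\<alpha> = (\<lambda>j. if j \<in> S then 1 else -1)"
  obtain w' where w': "w' \<noteq> 0" "X w' \<subseteq> X w" "Z w' = {j \<in> Z w. \<alpha> j = 0}"
    "Pos w' = Pos w \<union> {j \<in> Z w. \<alpha> j > 0}" "M w' = {t}"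
    by (rule refined_functional[OF assms(1) t, of \<alpha>])
  have Z: "Z w' = {}" using w'(3) by (auto simp: \<alpha>_def)
  have P: "Pos w' = S" using w'(4) S by (auto simp: \<alpha>_def split: if_splits)
  have "X w' = {(S, t)}" unfolding X_eq Z P w'(5) by auto
  then show ?thesis using that w'(1) by blast
qed

lemma maximizers_subset_vertices: "w \<noteq> 0 \<Longrightarrow> X w \<subseteq> vertices v n V"
proof clarify
  fix S t assume "w \<noteq> 0" "(S, t) \<in> X w"
  then show "(S, t) \<in> vertices v n V"
    using maximizer_is_vertex[of w S t] unfolding vertices_def by blast
qed

lemma maximizer_in_edge:
  assumes "w \<noteq> 0" "(S, t) \<in> X w" "i \<in> Z w" "i \<notin> S"
  obtains w' where "w' \<noteq> 0" "i \<in> Z w'" "X w' = {(S, t), (insert i S, t)}"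
proof -
  have t: "t \<in> M w" and S: "Pos w \<subseteq> S" "S \<subseteq> Pos w \<union> Z w" using assms(2) by (auto simp: X_eq)
  \<comment> \<open>The value 0 at \<open>i\<close> keeps this generator free, so both ends of the
    edge in direction \<open>v i\<close> remain.\<close>
  define \<alpha> :: "nat \<Rightarrow> real" where "\<alpha> = (\<lambda>j. if j = i then 0 else if j \<in> S then 1 else -1)"
  obtain w' where w': "w' \<noteq> 0" "X w' \<subseteq> X w" "Z w' = {j \<in> Z w. \<alpha> j = 0}"
    "Pos w' = Pos w \<union> {j \<in> Z w. \<alpha> j > 0}" "M w' = {t}"
    by (rule refined_functional[OF assms(1) t, of \<alpha>])
  have Z: "Z w' = {i}" using w'(3) assms by (auto simp: \<alpha>_def split: if_splits)
  have P: "Pos w' = S" using w'(4) S assms(4) by (auto simp: \<alpha>_def split: if_splits)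
  have "{T. S \<subseteq> T \<and> T \<subseteq> S \<union> {i}} = {S, insert i S}" by auto
  then have "X w' = {(S, t), (insert i S, t)}" unfolding X_eq Z P w'(5) by auto
  then show ?thesis using that w'(1) Z by blast
qed

lemma vertices_subset: "vertices v n V \<subseteq> index_set n V"
proof
  fix x assume "x \<in> vertices v n V"
  then obtain w where "X w = {x}" by (auto simp: vertices_def)
  then show "x \<in> index_set n V" using maximizers_subset[of v n V w] by simp
qed

text \<open>A vertex code is the only maximizer of its functional among all codes, and the value of
  the functional depends on the point alone.\<close>

lemma inj_on_vpoint: "inj_on pt (vertices v n V)"
proof (rule inj_onI)
  fix x y assume x: "x \<in> vertices v n V" and y: "y \<in> vertices v n V" and eq: "pt x = pt y"
  obtain w where w: "X w = {x}" using x by (auto simp: vertices_def)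
  then have "\<forall>z\<in>index_set n V. w \<bullet> pt z \<le> w \<bullet> pt x" unfolding maximizers_def by blast
  then have "y \<in> X w" using subsetD[OF vertices_subset y] eq by (simp add: maximizers_def)
  then show "x = y" using w by auto
qed

lemma face_eq:
  assumes "x \<in> X w"
  shows "face w = body' \<inter> {y. w \<bullet> y = w \<bullet> pt x}" "body' \<subseteq> {y. w \<bullet> y \<le> w \<bullet> pt x}"
proof -
  have fin: "finite (pt ` index_set n V)" using finite_index_set[OF finite_V] by auto
  have le: "\<And>a. a \<in> pt ` index_set n V \<Longrightarrow> w \<bullet> a \<le> w \<bullet> pt x"
    using assms by (auto simp: maximizers_def)
  have "{a \<in> pt ` index_set n V. w \<bullet> a = w \<bullet> pt x} = pt ` X w"
    using assms by (fastforce simp: maximizers_def)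
  then show "face w = body' \<inter> {y. w \<bullet> y = w \<bullet> pt x}" "body' \<subseteq> {y. w \<bullet> y \<le> w \<bullet> pt x}"
    using convex_hull_Int_supporting_hyperplane[OF fin le] unfolding body_def by auto
qed

lemma polytope_body: "polytope body'"
  unfolding body_def using finite_index_set[OF finite_V] by (intro polytope_convex_hull) auto

lemma compact_convex_body: "compact body'" "convex body'"
  using polytope_body polytope_imp_compact polytope_imp_convex by auto

lemma face_is_face: "face w face_of body'"
proof -
  obtain x where "x \<in> X w" using X_nonempty by blast
  then show ?thesis using face_eq[of x w]
    by (metis face_of_Int_supporting_hyperplane_le compact_convex_body(2) mem_Collect_eq subset_iff)
qed

text \<open>With this, incidence between points and faces is replaced by membership of
  codes.\<close>

lemma pt_in_face_iff:
  assumes "x \<in> index_set n V"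
  shows "pt x \<in> face w \<longleftrightarrow> x \<in> X w"
proof -
  obtain y where y: "y \<in> X w" using X_nonempty by blast
  have b: "pt x \<in> body'" unfolding body_def using assms by (intro hull_inc) auto
  show ?thesis
    unfolding face_eq(1)[OF y] using b y assms by (force simp: maximizers_def)
qed

text \<open>In such a hyperplane every code would maximize \<open>w\<close>, so all
  \<open>n \<ge> 3\<close> generators would lie in \<open>Z w\<close>, too many for
  \<open>small_face\<close>.\<close>

lemma body_not_in_hyperplane:
  assumes "w \<noteq> 0"
  shows "\<not> body' \<subseteq> {x. w \<bullet> x = b}"
proof
  assume sub: "body' \<subseteq> {x. w \<bullet> x = b}"
  have "pt ` index_set n V \<subseteq> {x. w \<bullet> x = b}"
    using sub hull_subset[of "pt ` index_set n V" convex] unfolding body_def by (rule subset_trans[rotated])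
  then have "w \<bullet> pt x = b" if "x \<in> index_set n V" for x using that by blast
  then have "index_set n V \<subseteq> X w" unfolding maximizers_def by auto
  moreover obtain t where "t \<in> V" using V_nonempty by blast
  ultimately have "({}, t) \<in> X w" "({..<n}, t) \<in> X w" by (auto simp: index_set_def)
  then have "{..<n} \<subseteq> Z w" unfolding X_eq by auto
  then have "n \<le> card (Z w)" using card_mono[OF finite_Z] by (metis card_lessThan)
  then show False using small_face[OF assms] n_ge_3 card_M_pos[of w] by linarith
qed

lemma aff_dim_body: "aff_dim body' = 3"
proof (rule ccontr)
  assume "aff_dim body' \<noteq> 3"
  then have "aff_dim body' < DIM(real^3)" using aff_dim_le_DIM[of body'] by simp
  then show False using aff_lowdim_subset_hyperplane body_not_in_hyperplane by metis
qed

lemma face_proper: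
  assumes "w \<noteq> 0"
  shows "face w \<noteq> body'" "face w \<noteq> {}"
proof -
  obtain x where x: "x \<in> X w" using X_nonempty by blast
  show "face w \<noteq> body'" using face_eq(1)[OF x] body_not_in_hyperplane[OF assms] by blast
  show "face w \<noteq> {}" using X_nonempty by auto
qed

text \<open>Faces of a polytope are exposed, and the bound in the exposing inequality is attained at
  the maximizing codes.\<close>

lemma proper_face_is_face:
  assumes "F face_of body'" "F \<noteq> {}" "F \<noteq> body'"
  obtains w where "w \<noteq> 0" "F = face w"
proof -
  have "F exposed_face_of body'"
    using assms(1) exposed_face_of_polyhedron polytope_imp_polyhedron[OF polytope_body] by blast
  then obtain a b where ab: "a \<noteq> 0" "body' \<subseteq> {x. a \<bullet> x \<le> b}" "F = body' \<inter> {x. a \<bullet> x = b}"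
    using assms(2,3) unfolding exposed_face_of by metis
  obtain x where x: "x \<in> X a" using X_nonempty by blast
  have "pt x \<in> body'"
    unfolding body_def using x maximizers_subset[of v n V a] by (intro hull_inc) auto
  then have "a \<bullet> pt x \<le> b" using ab by auto
  moreover obtain y where "y \<in> F" using assms by blast
  then have "b \<le> a \<bullet> pt x" using ab face_eq(2)[OF x] by blast
  ultimately have "F = face a" using face_eq(1)[OF x] ab(3) by auto
  then show ?thesis using that ab(1) by blast
qed

lemma extreme_points_body: "{x. x extreme_point_of body'} = pt ` vertices v n V"
proof
  show "pt ` vertices v n V \<subseteq> {x. x extreme_point_of body'}"
  proof clarify
    fix S t assume "(S, t) \<in> vertices v n V"
    then obtain w where "X w = {(S, t)}" by (auto simp: vertices_def)
    then show "pt (S, t) extreme_point_of body'"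
      using face_is_face[of w] by (simp add: face_of_singleton)
  qed
  show "{x. x extreme_point_of body'} \<subseteq> pt ` vertices v n V"
  proof clarify
    fix x assume "x extreme_point_of body'"
    then have "{x} face_of body'" by (simp add: face_of_singleton)
    moreover have "{x} \<noteq> body'" using aff_dim_body aff_dim_sing[of x] by force
    ultimately obtain w where w: "w \<noteq> 0" "{x} = face w" using proper_face_is_face by blast
    obtain y where y: "y \<in> X w" using X_nonempty by blast
    then have "pt y \<in> face w" by (intro hull_inc) auto
    then have "pt y = x" using w by auto
    then show "x \<in> pt ` vertices v n V" using y maximizers_subset_vertices[OF w(1)] by auto
  qed
qed

end

text \<open>It reduces an isomorphism of face lattices to a bijection of codes that respects
  maximizer sets, so that the transport of sign vectors can be argued on codes alone.\<close>

lemma same_comb_type_vertex_bijection: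
  assumes "generic_config v n V" "generic_config v' n' V'"
    and "same_comb_type (body v n V) (body v' n' V')"
  obtains H where "bij_betw H (vertices v n V) (vertices v' n' V')"
    "\<And>w. w \<noteq> 0 \<Longrightarrow> \<exists>w'. w' \<noteq> 0 \<and> H ` maximizers v n V w = maximizers v' n' V' w'"
proof -
  interpret c: generic_config v n V by fact
  interpret d: generic_config v' n' V' by fact
  obtain f h where f: "bij_betw f {F. F face_of c.body'} {G. G face_of d.body'}"
    and h: "bij_betw h {x. x extreme_point_of c.body'} {y. y extreme_point_of d.body'}"
    and fh: "\<forall>F x. F face_of c.body' \<longrightarrow> x extreme_point_of c.body' \<longrightarrow> (x \<in> F \<longleftrightarrow> h x \<in> f F)"
    and f0: "f {} = {}" and fP: "f c.body' = d.body'"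
    by (rule face_isomorphism_extreme_points[OF c.compact_convex_body d.compact_convex_body assms(3)])
  let ?g = "the_inv_into (vertices v' n' V') d.pt"
  have dbij: "bij_betw d.pt (vertices v' n' V') {y. y extreme_point_of d.body'}"
    using d.inj_on_vpoint d.extreme_points_body by (simp add: bij_betw_def)
  have cbij: "bij_betw c.pt (vertices v n V) {y. y extreme_point_of c.body'}"
    using c.inj_on_vpoint c.extreme_points_body by (simp add: bij_betw_def)
  define H where "H = ?g \<circ> h \<circ> c.pt"
  have H: "bij_betw H (vertices v n V) (vertices v' n' V')"
    unfolding H_def using bij_betw_trans[OF bij_betw_trans[OF cbij h] bij_betw_the_inv_into[OF dbij]]
    by (simp add: comp_assoc)
  have ptH: "d.pt (H x) = h (c.pt x)" if "x \<in> vertices v n V" for x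
  proof -
    have "h (c.pt x) \<in> d.pt ` vertices v' n' V'"
      using bij_betwE[OF h] bij_betwE[OF cbij] that d.extreme_points_body by blast
    then show ?thesis unfolding H_def using f_the_inv_into_f[OF d.inj_on_vpoint] by simp
  qed
  have "\<exists>w'. w' \<noteq> 0 \<and> H ` c.X w = d.X w'" if w: "w \<noteq> 0" for w
  proof -
    have inj: "inj_on f {F. F face_of c.body'}" using f by (simp add: bij_betw_def)
    have body: "c.body' face_of c.body'" using c.compact_convex_body face_of_refl by blast
    note fw = c.face_is_face[of w]
    have "f (c.face w) face_of d.body'" using f fw by (auto simp: bij_betw_def)
    moreover have "f (c.face w) \<noteq> {}" "f (c.face w) \<noteq> d.body'"
      using inj_onD[OF inj, of "c.face w" "{}"] inj_onD[OF inj, of "c.face w" c.body'] f0 fP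
        c.face_proper[OF w] fw body by (auto simp: empty_face_of)
    ultimately obtain w' where w': "w' \<noteq> 0" "f (c.face w) = d.face w'"
      using d.proper_face_is_face by blast
    have iff: "x \<in> c.X w \<longleftrightarrow> H x \<in> d.X w'" if x: "x \<in> vertices v n V" for x
    proof -
      have ex: "c.pt x extreme_point_of c.body'" using x c.extreme_points_body by blast
      have Hx: "H x \<in> vertices v' n' V'" using H x by (auto simp: bij_betw_def)
      have "x \<in> c.X w \<longleftrightarrow> c.pt x \<in> c.face w" using c.pt_in_face_iff x c.vertices_subset by blast
      also have "\<dots> \<longleftrightarrow> d.pt (H x) \<in> d.face w'" using fh[rule_format, OF fw ex] w'(2) ptH[OF x] by simp
      also have "\<dots> \<longleftrightarrow> H x \<in> d.X w'" using d.pt_in_face_iff Hx d.vertices_subset by blast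
      finally show ?thesis .
    qed
    have "H ` c.X w = d.X w'"
    proof
      show "H ` c.X w \<subseteq> d.X w'" using iff c.maximizers_subset_vertices[OF w] by auto
      show "d.X w' \<subseteq> H ` c.X w"
      proof
        fix y assume y: "y \<in> d.X w'"
        then have "y \<in> vertices v' n' V'" using d.maximizers_subset_vertices[OF w'(1)] by auto
        then obtain x where "x \<in> vertices v n V" "y = H x" using bij_betw_imp_surj_on[OF H] by blast
        then show "y \<in> H ` c.X w" using iff y by auto
      qed
    qed
    then show ?thesis using w'(1) by blast
  qed
  then show ?thesis using that H by blast
qed

section \<open>Edges, quadrilaterals and connected sets of functionals\<close>

context generic_config
begin

lemma card_X_le_4: "w \<noteq> 0 \<Longrightarrow> card (X w) \<le> 4"
proof -
  assume "w \<noteq> 0"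
  then have "card (Z w) + card (M w) \<le> 3" "card (M w) \<ge> 1" using small_face card_M_pos by auto
  then consider "card (Z w) = 0" "card (M w) \<le> 3" | "card (Z w) = 1" "card (M w) \<le> 2"
    | "card (Z w) = 2" "card (M w) \<le> 1" by linarith
  then show ?thesis unfolding card_X by cases auto
qed

text \<open>On a quadrilateral an index belongs to all codes, to none, or is free, and in the last
  case toggling it pairs the codes off two against two. This parity is how
  \<open>flips_uniform\<close> uses that opposite edges are parallel.\<close>

lemma even_card_membership_quadrilateral:
  assumes "card (X w) = 4" "w \<noteq> 0"
  shows "even (card {x \<in> X w. j \<in> fst x})"
proof -
  consider "j \<in> Pos w" | "j \<in> Z w" | "j \<notin> Pos w \<union> Z w" by blast
  then show ?thesis
  proof cases
    case 1
    then have "{x \<in> X w. j \<in> fst x} = X w" by (auto simp: X_eq)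
    then show ?thesis using assms by simp
  next
    case 2
    then have jP: "j \<notin> Pos w" by (auto simp: positives_def zeros_def)
    let ?A = "{x \<in> X w. j \<in> fst x}" and ?B = "{x \<in> X w. j \<notin> fst x}"
    have "bij_betw (\<lambda>x. (fst x - {j}, snd x)) ?A ?B"
      by (rule bij_betwI[where g = "\<lambda>x. (insert j (fst x), snd x)"]) (use 2 jP in \<open>auto simp: X_eq\<close>)
    then have "card ?A = card ?B" by (rule bij_betw_same_card)
    moreover have "card ?A + card ?B = card (X w)"
      using finite_maximizers[OF finite_V, of v n w]
      by (subst card_Un_disjoint[symmetric]) (auto intro: arg_cong[where f = card])
    ultimately have "card ?A = 2" using assms by linarith
    then show ?thesis by simp
  next
    case 3
    then have eq: "{x \<in> X w. j \<in> fst x} = {}" by (auto simp: X_eq)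
    show ?thesis unfolding eq by simp
  qed
qed

text \<open>An edge frees either one generator, whose index is \<delta>, or none; in the second case
  the first components agree and \<delta> = n serves as a label outside the range
  \<open>j < n\<close>.\<close>

lemma edge_difference:
  assumes "X w = {y, y'}" "y \<noteq> y'" "w \<noteq> 0"
  shows "\<exists>\<delta>\<le>n. \<forall>j<n. ((j \<in> fst y) \<noteq> (j \<in> fst y')) \<longleftrightarrow> j = \<delta>"
proof -
  \<comment> \<open>Two codes leave only a zero set of size 0 or 1, since size 2 would give at least
    four.\<close>
  have eq: "2 ^ card (Z w) * card (M w) = 2" using card_X[of v n w] assms by simp
  have "card (Z w) + card (M w) \<le> 3" using small_face assms by auto
  then consider "card (Z w) = 0" | "card (Z w) = 1" | "card (Z w) = 2"
    using card_M_pos[of w] by linarith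
  then consider "card (Z w) = 0" | "card (Z w) = 1" "card (M w) = 1"
    using eq by cases auto
  then show ?thesis
  proof cases
    case 1
    then have Z: "Z w = {}" by simp
    have "y \<in> X w" "y' \<in> X w" using assms(1) by auto
    then have "fst y = Pos w" "fst y' = Pos w" unfolding X_eq Z by auto
    then show ?thesis by auto
  next
    case 2
    then obtain k t where k: "Z w = {k}" and t: "M w = {t}" by (auto simp: card_1_singleton_iff)
    have "k \<in> Z w" using k by simp
    then have kn: "k < n" and kP: "k \<notin> Pos w" by (auto simp: zeros_def positives_def)
    have "{S. Pos w \<subseteq> S \<and> S \<subseteq> Pos w \<union> {k}} = {Pos w, insert k (Pos w)}" by auto
    then have "X w = {(Pos w, t), (insert k (Pos w), t)}" unfolding X_eq k t by auto
    then have "fst y = Pos w \<and> fst y' = insert k (Pos w) \<or> fst y' = Pos w \<and> fst y = insert k (Pos w)"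
      using assms(1) by (metis doubleton_eq_iff fst_conv)
    then show ?thesis using kn kP by (intro exI[of _ k]) auto
  qed
qed

text \<open>Near a functional the maximizers are among its own, where \<open>f\<close> takes one
  value on the codes with property \<open>Q\<close>. The value is thus locally constant in the
  functional, and connectedness of \<open>U\<close> makes it global. It is applied to a belt of
  faces and to the normal cone of a point of \<open>V\<close>.\<close>

lemma locally_constant_on_functionals:
  assumes conn: "connected U"
    and uniform: "\<And>w x y. w \<in> U \<Longrightarrow> x \<in> X w \<Longrightarrow> y \<in> X w \<Longrightarrow> Q x \<Longrightarrow> Q y \<Longrightarrow> f x = f y"
    and ex: "\<And>w. w \<in> U \<Longrightarrow> \<exists>x\<in>X w. Q x"
    and w: "w \<in> U" "x \<in> X w" "Q x" and w': "w' \<in> U" "x' \<in> X w'" "Q x'"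
  shows "f x = f x'"
proof -
  obtain s where s: "\<And>w. w \<in> U \<Longrightarrow> s w \<in> X w \<and> Q (s w)" using ex by metis
  have "f (s w) = f (s w')"
  proof (rule connected_local_const[OF conn w(1) w'(1), of "\<lambda>w. f (s w)"], rule ballI)
    fix a assume a: "a \<in> U"
    have "\<forall>\<^sub>F b in at a within U. X b \<subseteq> X a"
      using eventually_maximizers_subset[OF finite_V, of v n a]
      unfolding eventually_at_filter by (auto elim: eventually_mono)
    moreover have "\<forall>\<^sub>F b in at a within U. b \<in> U"
      by (simp add: eventually_at_filter)
    ultimately show "\<forall>\<^sub>F b in at a within U. f (s a) = f (s b)"
      by eventually_elim (use uniform[OF a] s[OF a] s in blast)
  qed
  then show ?thesis using uniform[OF w(1) w(2) _ w(3)] uniform[OF w'(1) w'(2) _ w'(3)] s w(1) w'(1) by metis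
qed

lemma vertex_functional_nonzero:
  assumes "X w = {x}" shows "w \<noteq> 0"
proof
  assume "w = 0"
  then have "X w = index_set n V" by (auto simp: maximizers_def)
  moreover obtain t where "t \<in> V" using V_nonempty by blast
  then have "({}, t) \<in> index_set n V" "({..<n}, t) \<in> index_set n V" by (auto simp: index_set_def)
  ultimately have "({}, t) = x" "({..<n}, t) = x" using assms by blast+
  then have "{} = {..<n}" by (metis prod.inject)
  then show False using n_ge_3 by (metis empty_iff lessThan_iff less_le_trans zero_less_numeral)
qed

text \<open>These are the normals of the faces that contain an edge in direction \<open>v i\<close>;
  a plane stays connected when the origin is removed.\<close>

lemma connected_orthogonal_punctured:
  assumes "i < n" shows "connected {w. w \<noteq> 0 \<and> w \<bullet> v i = 0}"
proof -
  have "v i \<noteq> 0" using cross_vv[of i 0] cross_vv[of i 1] assms n_ge_3 by (cases "i = 0") auto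
  then have "aff_dim {w. v i \<bullet> w = 0} \<noteq> 1" by (simp add: aff_dim_hyperplane)
  then have "connected ({w. v i \<bullet> w = 0} - {0})"
    by (intro connected_punctured_convex convex_hyperplane)
  moreover have "{w. v i \<bullet> w = 0} - {0} = {w. w \<noteq> 0 \<and> w \<bullet> v i = 0}"
    by (auto simp: inner_commute)
  ultimately show ?thesis by simp
qed

text \<open>Without the origin, this is the interior of the normal cone of \<open>t\<close> in
  \<open>conv V\<close>. That cone interior is open and convex, so its dimension is not 1 and
  removing a point keeps it connected.\<close>

lemma connected_top_region: "connected {w. w \<noteq> 0 \<and> M w = {t}}"
proof (cases "t \<in> V")
  case False
  then have "{w. w \<noteq> 0 \<and> M w = {t}} = {}" using M_subset by blast
  then show ?thesis by (metis connected_empty)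
next
  case True
  let ?C = "\<Inter>t'\<in>V - {t}. {w. (t' - t) \<bullet> w < 0}"
  have open_C: "open ?C" using finite_V by (intro open_INT) (auto intro!: open_halfspace_lt)
  have convex_C: "convex ?C" by (intro convex_INT convex_halfspace_lt)
  have "aff_dim ?C \<noteq> 1" using aff_dim_open[OF open_C] by (cases "?C = {}") auto
  then have "connected (?C - {0})" by (intro connected_punctured_convex convex_C)
  moreover have "?C - {0} = {w. w \<noteq> 0 \<and> M w = {t}}"
  proof -
    have "M w = {t} \<longleftrightarrow> (\<forall>t'\<in>V - {t}. (t' - t) \<bullet> w < 0)" for w
    proof
      assume "M w = {t}"
      then have "t \<in> M w" "\<And>t'. t' \<in> V \<Longrightarrow> t' \<noteq> t \<Longrightarrow> t' \<notin> M w" by auto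
      then have "w \<bullet> t' < w \<bullet> t" if "t' \<in> V" "t' \<noteq> t" for t'
        using that unfolding top_points_def by (smt (verit) mem_Collect_eq)
      then show "\<forall>t'\<in>V - {t}. (t' - t) \<bullet> w < 0"
        by (auto simp: inner_diff_left inner_commute[of w])
    next
      assume "\<forall>t'\<in>V - {t}. (t' - t) \<bullet> w < 0"
      then have "w \<bullet> t' < w \<bullet> t" if "t' \<in> V" "t' \<noteq> t" for t'
        using that by (auto simp: inner_diff_left inner_commute[of w])
      then show "M w = {t}" using True by (force simp: top_points_def)
    qed
    then show ?thesis by auto
  qed
  ultimately show ?thesis by simp
qed

end

section \<open>Transport of sign vectors\<close>

locale comb_isomorphism = c: generic_config v n V + d: generic_config v' n V
  for v v' n V +
  fixes H
  assumes H_bij: "bij_betw H (vertices v n V) (vertices v' n V)"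
    and H_faces: "\<And>w. w \<noteq> 0 \<Longrightarrow> \<exists>w'. w' \<noteq> 0 \<and> H ` maximizers v n V w = maximizers v' n V w'"
begin

text \<open>Meant for \<open>i \<notin> fst x\<close>, when \<open>x\<close> and
  \<open>(insert i (fst x), snd x)\<close> can be the ends of an edge in direction
  \<open>v i\<close>. For such an edge at most one index below \<open>n\<close> occurs, by
  \<open>edge_difference\<close> for the image.\<close>

definition flips :: "nat \<Rightarrow> nat set \<times> (real^3) \<Rightarrow> nat set" where
  "flips i x = {j. (j \<in> fst (H x)) \<noteq> (j \<in> fst (H (insert i (fst x), snd x)))}"

lemma H_inj_on_X: "w \<noteq> 0 \<Longrightarrow> inj_on H (c.X w)"
  using H_bij c.maximizers_subset_vertices by (meson bij_betw_imp_inj_on inj_on_subset)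

lemma insert_in_X: "x \<in> c.X w \<Longrightarrow> i \<in> c.Z w \<Longrightarrow> (insert i (fst x), snd x) \<in> c.X w"
  by (auto simp: c.X_eq)

text \<open>If \<open>x\<close> and \<open>y\<close> differ, they are corners of a quadrilateral
  whose image is again a face with four codes. For each \<open>j\<close> the four membership bits
  there have even sum, so the bit changes along one edge iff it changes along the opposite
  one.\<close>

lemma flips_uniform:
  assumes w: "w \<noteq> 0" "i \<in> c.Z w" and x: "x \<in> c.X w" "i \<notin> fst x" and y: "y \<in> c.X w" "i \<notin> fst y"
  shows "flips i x = flips i y"
proof (cases "x = y")
  case False
  let ?x = "(insert i (fst x), snd x)" and ?y = "(insert i (fst y), snd y)"
  have d: "x \<noteq> ?x" "x \<noteq> ?y" "y \<noteq> ?x" "y \<noteq> ?y" "?x \<noteq> ?y" "x \<noteq> y"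
    using x y False by (auto simp: prod_eq_iff)
  let ?A = "{x, ?x, y, ?y}"
  have sub: "?A \<subseteq> c.X w" using x y insert_in_X w by auto
  have cA: "card ?A = 4" using d by simp
  \<comment> \<open>Four distinct codes exhaust a proper face.\<close>
  then have "c.X w = ?A"
    using sub c.card_X_le_4[OF w(1)] finite_maximizers[OF c.finite_V, of v n w]
    by (metis card_seteq)
  obtain w' where w': "w' \<noteq> 0" "H ` c.X w = d.X w'" using H_faces w by blast
  have inj: "inj_on H ?A" using H_inj_on_X[OF w(1)] \<open>c.X w = ?A\<close> by simp
  have dX: "d.X w' = H ` ?A" using w' \<open>c.X w = ?A\<close> by simp
  then have c4: "card (d.X w') = 4" using card_image[OF inj] cA by simp
  have "(j \<in> fst (H x)) \<noteq> (j \<in> fst (H ?x)) \<longleftrightarrow> (j \<in> fst (H y)) \<noteq> (j \<in> fst (H ?y))" for j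
  proof -
    have "{z \<in> d.X w'. j \<in> fst z} = H ` {z \<in> ?A. j \<in> fst (H z)}" unfolding dX by auto
    then have "card {z \<in> d.X w'. j \<in> fst z} = card {z \<in> ?A. j \<in> fst (H z)}"
      using card_image[OF inj_on_subset[OF inj]] by (metis (no_types, lifting) mem_Collect_eq subsetI)
    also have "\<dots> = (\<Sum>z\<in>?A. if j \<in> fst (H z) then 1 else 0)"
      by (simp only: card_eq_sum sum.inter_filter finite.intros)
    also have "\<dots> = (if j \<in> fst (H x) then 1 else 0) + (if j \<in> fst (H ?x) then 1 else 0) +
      (if j \<in> fst (H y) then 1 else 0) + (if j \<in> fst (H ?y) then 1 else (0::nat))"
      using d by (simp add: eq_commute[of y] del: prod.inject)
    finally show ?thesis using d.even_card_membership_quadrilateral[OF c4 w'(1), of j]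
      by (simp split: if_splits)
  qed
  then show ?thesis by (auto simp: flips_def)
qed simp

text \<open>The flips are constant along the belt of faces with normals orthogonal to
  \<open>v i\<close>, so a single edge of the belt fixes the label; \<open>edge_difference\<close>
  applies to the image of that edge.\<close>

lemma flips_label:
  assumes "i < n"
  shows "\<exists>\<delta>\<le>n. \<forall>w x j. w \<noteq> 0 \<longrightarrow> i \<in> c.Z w \<longrightarrow> x \<in> c.X w \<longrightarrow> i \<notin> fst x \<longrightarrow> j < n \<longrightarrow>
    (j \<in> flips i x \<longleftrightarrow> j = \<delta>)"
proof -
  let ?U = "{w. w \<noteq> 0 \<and> w \<bullet> v i = 0}"
  have U: "w \<in> ?U \<longleftrightarrow> w \<noteq> 0 \<and> i \<in> c.Z w" for w using assms by (auto simp: zeros_def)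
  have ex: "\<exists>x\<in>c.X w. i \<notin> fst x" if "w \<in> ?U" for w
  proof -
    have "i \<notin> c.Pos w" using that by (auto simp: positives_def)
    moreover obtain t where "t \<in> c.M w" using c.M_nonempty by blast
    ultimately show ?thesis by (intro bexI[of _ "(c.Pos w, t)"]) (auto simp: c.X_eq)
  qed
  have const: "flips i x = flips i x'"
    if "w \<in> ?U" "x \<in> c.X w" "i \<notin> fst x" "w' \<in> ?U" "x' \<in> c.X w'" "i \<notin> fst x'" for w w' x x'
  proof (rule c.locally_constant_on_functionals[OF c.connected_orthogonal_punctured[OF assms],
        where Q = "\<lambda>x. i \<notin> fst x"])
    show "flips i x = flips i y"
      if "w \<in> ?U" "x \<in> c.X w" "y \<in> c.X w" "i \<notin> fst x" "i \<notin> fst y" for w x y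
      using flips_uniform[of w i x y] that U by blast
    show "\<exists>x\<in>c.X w. i \<notin> fst x" if "w \<in> ?U" for w using ex that by blast
  qed (use that in auto)
  have "\<not> {0,1,2} \<subseteq> {i}" by auto
  then obtain k where k: "k < n" "k \<noteq> i" using c.n_ge_3 by fastforce
  let ?w = "cross3 (v i) (v k)"
  have w: "?w \<in> ?U" using c.cross_vv[of i k] k assms by (auto simp: dot_cross_self inner_commute)
  then obtain x where x: "x \<in> c.X ?w" "i \<notin> fst x" using ex by blast
  then obtain w2 where w2: "w2 \<noteq> 0" "i \<in> c.Z w2" "c.X w2 = {x, (insert i (fst x), snd x)}"
    using c.maximizer_in_edge[of ?w "fst x" "snd x" i] w U by auto
  obtain w3 where w3: "w3 \<noteq> 0" "H ` c.X w2 = d.X w3" using H_faces[OF w2(1)] by blast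
  have "H x \<noteq> H (insert i (fst x), snd x)"
    using inj_onD[OF H_inj_on_X[OF w2(1)], of x "(insert i (fst x), snd x)"] w2(3) x(2)
    by (auto simp: prod_eq_iff)
  then obtain \<delta> where \<delta>: "\<delta> \<le> n" "\<forall>j<n. (j \<in> flips i x) \<longleftrightarrow> j = \<delta>"
    using d.edge_difference[of w3 "H x" "H (insert i (fst x), snd x)"] w3 w2(3)
    unfolding flips_def by auto
  show ?thesis
  proof (intro exI[of _ \<delta>] conjI allI impI)
    fix w y j assume *: "w \<noteq> 0" "i \<in> c.Z w" "y \<in> c.X w" "i \<notin> fst y" "j < n"
    have "flips i y = flips i x" by (rule const[of w y ?w x]) (use * x w U in auto)
    then show "j \<in> flips i y \<longleftrightarrow> j = \<delta>" using \<delta>(2) *(5) by simp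
  qed (use \<delta> in auto)
qed

text \<open>The prediction is that each index \<open>i\<close> in a code toggles its label
  \<open>D i\<close> in the image. The discrepancy \<open>K\<close> between image and prediction
  does not change along edges in generator directions, hence is the same for all vertices over one
  point \<open>t\<close> of \<open>V\<close>, and \<open>A t\<close> records it.\<close>

lemma sign_vectors_determined:
  "\<exists>D \<in> {..<n} \<rightarrow>\<^sub>E {..n}. \<exists>A \<in> V \<rightarrow>\<^sub>E Pow {..<n}. fst ` vertices v' n V =
    (\<lambda>x. {j. j < n \<and> (odd (card {i \<in> fst x. D i = j}) \<noteq> (j \<in> A (snd x)))}) ` vertices v n V"
proof -
  obtain D where D: "\<And>i. i < n \<Longrightarrow> D i \<le> n"
    "\<And>i w x j. \<lbrakk>i < n; w \<noteq> 0; i \<in> c.Z w; x \<in> c.X w; i \<notin> fst x; j < n\<rbrakk> \<Longrightarrow> j \<in> flips i x \<longleftrightarrow> j = D i"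
    using flips_label by metis
  \<comment> \<open>Parities, because several indices may carry the same label and each of them
    toggles it once.\<close>
  define K where "K = (\<lambda>x. {j. j < n \<and> ((j \<in> fst (H x)) \<noteq> odd (card {i \<in> fst x. D i = j}))})"
  have step: "K (insert i S, t) = K (S, t)"
    if w: "w \<noteq> 0" "i \<in> c.Z w" "(S, t) \<in> c.X w" "i \<notin> S" for w i S t
  proof -
    have i: "i < n" using w by (auto simp: zeros_def)
    have "S \<subseteq> {..<n}" using w(3) maximizers_subset[of v n V w] by (auto simp: index_set_def)
    then have fS: "finite S" using finite_subset by blast
    have "(j \<in> fst (H (insert i S, t))) \<noteq> odd (card {i' \<in> insert i S. D i' = j}) \<longleftrightarrow>
          (j \<in> fst (H (S, t))) \<noteq> odd (card {i' \<in> S. D i' = j})" if "j < n" for j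
    proof -
      have fl: "(j \<in> fst (H (S, t))) \<noteq> (j \<in> fst (H (insert i S, t))) \<longleftrightarrow> j = D i"
        using D(2)[OF i w(1,2,3) _ that] w(4) by (simp add: flips_def)
      show ?thesis
      proof (cases "D i = j")
        case True
        then have "{i' \<in> insert i S. D i' = j} = insert i {i' \<in> S. D i' = j}" by auto
        then have "card {i' \<in> insert i S. D i' = j} = Suc (card {i' \<in> S. D i' = j})"
          using fS w(4) by simp
        then show ?thesis using fl True by auto
      next
        case False
        then have "{i' \<in> insert i S. D i' = j} = {i' \<in> S. D i' = j}" by auto
        then show ?thesis using fl False by auto
      qed
    qed
    then show ?thesis by (auto simp: K_def)
  qed
  have uni0: "K (c.Pos w \<union> B, t) = K (c.Pos w, t)"
    if w: "w \<noteq> 0" "t \<in> c.M w" and B: "B \<subseteq> c.Z w" for w t B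
  proof -
    have "finite B" using B finite_subset c.finite_Z by blast
    then show ?thesis using B
    proof (induction B rule: finite_induct)
      case (insert i B)
      have "K (insert i (c.Pos w \<union> B), t) = K (c.Pos w \<union> B, t)"
      proof (rule step[OF w(1)])
        show "i \<in> c.Z w" using insert by auto
        then show "i \<notin> c.Pos w \<union> B" using insert by (auto simp: zeros_def positives_def)
        show "(c.Pos w \<union> B, t) \<in> c.X w" using insert w by (auto simp: c.X_eq)
      qed
      then show ?case using insert by simp
    qed simp
  qed
  have uniform: "K x = K (c.Pos w, t)" if "w \<noteq> 0" "c.M w = {t}" "x \<in> c.X w" for w t x
  proof -
    have "snd x = t" "c.Pos w \<subseteq> fst x" "fst x - c.Pos w \<subseteq> c.Z w" using that by (auto simp: c.X_eq)
    then have "x = (c.Pos w \<union> (fst x - c.Pos w), t)" "fst x - c.Pos w \<subseteq> c.Z w"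
      by (auto simp: prod_eq_iff)
    then show ?thesis using uni0[of w t "fst x - c.Pos w"] that by auto
  qed
  have const: "K x = K y" if vx: "x \<in> vertices v n V" and vy: "y \<in> vertices v n V" and sn: "snd x = snd y" for x y
  proof -
    obtain w where w: "c.X w = {x}" using vx unfolding vertices_def by blast
    obtain w' where w': "c.X w' = {y}" using vy unfolding vertices_def by blast
    have M: "c.M w = {snd x}" if X: "c.X w = {x}" for w x
    proof -
      have "t = snd x" if "t \<in> c.M w" for t
      proof -
        have "(c.Pos w, t) \<in> c.X w" using that by (auto simp: c.X_eq)
        then show ?thesis using X by auto
      qed
      then show ?thesis using c.M_nonempty[of w] by blast
    qed
    show ?thesis
    proof (rule c.locally_constant_on_functionals[OF c.connected_top_region, where Q = "\<lambda>_. True"])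
      show "K x' = K y'" if "u \<in> {w. w \<noteq> 0 \<and> c.M w = {snd x}}" "x' \<in> c.X u" "y' \<in> c.X u" for u x' y'
        using uniform[of u "snd x" x'] uniform[of u "snd x" y'] that by simp
      show "\<exists>x\<in>c.X u. True" for u using c.X_nonempty by blast
      show "w \<in> {w. w \<noteq> 0 \<and> c.M w = {snd x}}" using M[OF w] c.vertex_functional_nonzero[OF w] by simp
      show "w' \<in> {w. w \<noteq> 0 \<and> c.M w = {snd x}}"
        using M[OF w'] sn c.vertex_functional_nonzero[OF w'] by simp
    qed (use w w' in auto)
  qed
  have "\<exists>A. \<forall>x\<in>vertices v n V. K x = A (snd x)"
    by (rule exI[of _ "\<lambda>t. K (SOME x. x \<in> vertices v n V \<and> snd x = t)"])
      (metis (mono_tags, lifting) const someI_ex)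
  then obtain A where A: "\<And>x. x \<in> vertices v n V \<Longrightarrow> K x = A (snd x)" by blast
  \<comment> \<open>Cutting \<open>A\<close> and \<open>D\<close> down to extensional functions with
    bounded values puts the pair into a finite set that can be counted.\<close>
  define A' where "A' = (\<lambda>t\<in>V. A t \<inter> {..<n})"
  define D' where "D' = (\<lambda>i\<in>{..<n}. D i)"
  have H: "fst (H x) = {j. j < n \<and> (odd (card {i \<in> fst x. D' i = j}) \<noteq> (j \<in> A' (snd x)))}"
    if x: "x \<in> vertices v n V" for x
  proof -
    have xi: "fst x \<subseteq> {..<n}" "snd x \<in> V" using subsetD[OF c.vertices_subset x] by (auto simp: index_set_def)
    have "H x \<in> vertices v' n V" using H_bij x by (auto simp: bij_betw_def)
    then have sub: "fst (H x) \<subseteq> {..<n}"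
      using subsetD[OF d.vertices_subset, of "H x"] by (auto simp: index_set_def)
    have DD: "{i \<in> fst x. D' i = j} = {i \<in> fst x. D i = j}" for j using xi by (auto simp: D'_def)
    have "j \<in> A' (snd x) \<longleftrightarrow> (j \<in> fst (H x)) \<noteq> odd (card {i \<in> fst x. D i = j})" if "j < n" for j
      using A[OF x] xi(2) that by (auto simp: A'_def K_def)
    then show ?thesis unfolding DD using sub by blast
  qed
  have "fst ` vertices v' n V = (\<lambda>x. fst (H x)) ` vertices v n V"
    using bij_betw_imp_surj_on[OF H_bij] by (metis image_image)
  also have "\<dots> = (\<lambda>x. {j. j < n \<and> (odd (card {i \<in> fst x. D' i = j}) \<noteq> (j \<in> A' (snd x)))}) ` vertices v n V"
    using H by (intro image_cong) auto
  finally have "fst ` vertices v' n V = \<dots>" .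
  moreover have "D' \<in> {..<n} \<rightarrow>\<^sub>E {..n}" using D(1) by (auto simp: D'_def)
  moreover have "A' \<in> V \<rightarrow>\<^sub>E Pow {..<n}" by (auto simp: A'_def)
  ultimately show ?thesis by blast
qed

end

section \<open>Sign vectors tell configurations apart\<close>

context generic_config
begin

text \<open>The summand \<open>V\<close> drops out, because a functional without zeros gives a
  vertex with any of its top points. In the language of oriented matroids these sets are the topes
  of the vector configuration.\<close>

lemma sign_vectors_eq: "fst ` vertices v n V = {Pos w | w. Z w = {}}"
proof
  show "fst ` vertices v n V \<subseteq> {Pos w | w. Z w = {}}"
  proof
    fix S assume "S \<in> fst ` vertices v n V"
    then obtain x w where S: "S = fst x" and w: "X w = {x}" unfolding vertices_def by blast
    obtain t where t: "t \<in> M w" using M_nonempty by blast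
    have "(Pos w, t) \<in> X w" "(Pos w \<union> Z w, t) \<in> X w" using t by (auto simp: X_eq)
    then have "x = (Pos w, t)" "Pos w \<union> Z w = Pos w" using w by auto
    moreover have "Pos w \<inter> Z w = {}" by (auto simp: positives_def zeros_def)
    ultimately show "S \<in> {Pos w | w. Z w = {}}" using S by auto
  qed
  show "{Pos w | w. Z w = {}} \<subseteq> fst ` vertices v n V"
  proof clarify
    fix w assume Z: "Z w = {}"
    have "0 \<notin> Z w" using Z by simp
    then have "w \<noteq> 0" using n_ge_3 by (auto simp: zeros_def)
    moreover obtain t where "t \<in> M w" using M_nonempty by blast
    then have "(Pos w, t) \<in> X w" by (auto simp: X_eq)
    ultimately have "(Pos w, t) \<in> vertices v n V" using maximizers_subset_vertices by blast
    then show "Pos w \<in> fst ` vertices v n V" by force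
  qed
qed

end

text \<open>The four vectors \<open>v q, v r, v s, v p\<close> have a unique linear relation, which excludes one sign pattern;
  that pattern is realized by \<open>v'\<close> because \<open>v s\<close> and \<open>v' p\<close> lie on different sides of the plane
  spanned by \<open>v q\<close> and \<open>v r\<close>.\<close>

lemma sign_vectors_separated_aux:
  assumes c: "generic_config v n V" and d: "generic_config v' n V"
    and idx: "q < n" "r < n" "s < n" "p < n" "q \<noteq> r"
    and eq: "v q = v' q" "v r = v' r" "v s = v' s"
    and pos: "triple (v q) (v r) (v s) * triple (v q) (v r) (v p) > 0"
    and neg: "triple (v q) (v r) (v s) * triple (v q) (v r) (v' p) < 0"
  shows "fst ` vertices v n V \<noteq> fst ` vertices v' n V"
proof -
  interpret c: generic_config v n V by fact
  interpret d: generic_config v' n V by fact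
  define T A B C where "T = triple (v q) (v r) (v s)" and "A = triple (v p) (v r) (v s)"
    and "B = triple (v q) (v p) (v s)" and "C = triple (v q) (v r) (v p)"
  have cramer: "T * (w \<bullet> v p) = A * (w \<bullet> v q) + B * (w \<bullet> v r) + C * (w \<bullet> v s)" for w
    using arg_cong[OF triple_cramer[of "v q" "v r" "v s" "v p"], of "inner w"]
    by (simp add: inner_add_right T_def A_def B_def C_def)
  have TC: "T * C > 0" using pos by (simp add: T_def C_def)
  \<comment> \<open>The signs at \<open>q\<close> and \<open>r\<close> are chosen to make the terms
    with \<open>A\<close> and \<open>B\<close> in the relation, multiplied by \<open>T\<close>,
    nonnegative.\<close>
  define \<alpha> :: "nat \<Rightarrow> real" where
    "\<alpha> = (\<lambda>i. if i = q then (if T * A \<ge> 0 then 1 else -1) else (if T * B \<ge> 0 then 1 else -1))"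
  \<comment> \<open>This normal of the plane of \<open>v q\<close> and \<open>v r\<close> is
    positive at \<open>v s\<close> and, by \<open>neg\<close>, negative at \<open>v' p\<close>. The
    refinement keeps both signs and decides those of \<open>q\<close> and \<open>r\<close>.\<close>
  let ?w = "T *\<^sub>R cross3 (v q) (v r)"
  have T0: "T \<noteq> 0" using TC by auto
  have w0: "?w \<noteq> 0" using T0 c.cross_vv idx by simp
  obtain t where t: "t \<in> d.M ?w" using d.M_nonempty by blast
  obtain w where w: "w \<noteq> 0" "d.X w \<subseteq> d.X ?w" "d.Z w = {i \<in> d.Z ?w. \<alpha> i = 0}"
    "d.Pos w = d.Pos ?w \<union> {i \<in> d.Z ?w. \<alpha> i > 0}" "d.M w = {t}"
    by (rule d.refined_functional[OF w0 t, of \<alpha>])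
  have Zw: "d.Z w = {}" using w(3) by (auto simp: \<alpha>_def)
  have qZ: "q \<in> d.Z ?w" "r \<in> d.Z ?w"
    using idx eq by (auto simp: zeros_def dot_cross_self inner_commute)
  have "?w \<bullet> v' s > 0" using T0 eq(3) unfolding T_def triple_def by (auto simp: zero_less_mult_iff linorder_neq_iff)
  then have sP: "s \<in> d.Pos w" using w(4) idx by (simp add: positives_def)
  have wp: "?w \<bullet> v' p < 0" using neg unfolding T_def triple_def by simp
  then have "p \<notin> d.Pos ?w" "p \<notin> d.Z ?w" by (auto simp: positives_def zeros_def)
  then have pP: "p \<notin> d.Pos w" using w(4) by blast
  have "d.Pos ?w \<inter> d.Z ?w = {}" by (auto simp: positives_def zeros_def)
  then have "q \<in> d.Pos w \<longleftrightarrow> \<alpha> q > 0" "r \<in> d.Pos w \<longleftrightarrow> \<alpha> r > 0" using qZ w(4) by blast+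
  then have qP: "q \<in> d.Pos w \<longleftrightarrow> T * A \<ge> 0" "r \<in> d.Pos w \<longleftrightarrow> T * B \<ge> 0"
    using idx(5) by (auto simp: \<alpha>_def)
  have "d.Pos w \<notin> {c.Pos u | u. c.Z u = {}}"
  proof
    assume "d.Pos w \<in> {c.Pos u | u. c.Z u = {}}"
    then obtain u where u: "c.Pos u = d.Pos w" "c.Z u = {}" by auto
    have nz: "u \<bullet> v i \<noteq> 0" if "i < n" for i using u(2) that by (auto simp: zeros_def)
    have sg: "u \<bullet> v i > 0 \<longleftrightarrow> i \<in> d.Pos w" if "i < n" for i
      using u(1) that by (auto simp: positives_def)
    have 1: "u \<bullet> v s > 0" using sg sP idx by auto
    have 2: "u \<bullet> v p < 0" using sg[of p] pP nz[of p] idx by auto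
    have 3: "T * A * (u \<bullet> v q) \<ge> 0"
      using sg[of q] qP(1) idx by (cases "T * A \<ge> 0") (auto intro: mult_nonneg_nonneg mult_nonpos_nonpos)
    have 4: "T * B * (u \<bullet> v r) \<ge> 0"
      using sg[of r] qP(2) idx by (cases "T * B \<ge> 0") (auto intro: mult_nonneg_nonneg mult_nonpos_nonpos)
    have 5: "T * C * (u \<bullet> v s) > 0" using TC 1 by simp
    \<comment> \<open>All three terms on the right push the value at \<open>v p\<close> to be
      positive, which the pattern forbids.\<close>
    have "T * T * (u \<bullet> v p) = T * A * (u \<bullet> v q) + T * B * (u \<bullet> v r) + T * C * (u \<bullet> v s)"
      using arg_cong[OF cramer[of u], of "\<lambda>x. T * x"] by (simp add: algebra_simps)
    then have "T * T * (u \<bullet> v p) > 0" using 3 4 5 by linarith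
    moreover have "T * T > 0" using T0 by (metis not_real_square_gt_zero)
    then have "T * T * (u \<bullet> v p) < 0" using 2 by (rule mult_pos_neg)
    ultimately show False by linarith
  qed
  moreover have "d.Pos w \<in> fst ` vertices v' n V" unfolding d.sign_vectors_eq using Zw by blast
  ultimately show ?thesis unfolding c.sign_vectors_eq by metis
qed

text \<open>Whether \<open>v p\<close> or \<open>v' p\<close> is on the same side as
  \<open>v s\<close> decides which of the two configurations misses the pattern.\<close>

lemma sign_vectors_separated:
  assumes c: "generic_config v n V" and d: "generic_config v' n V"
    and idx: "q < n" "r < n" "s < n" "p < n" "q \<noteq> r" "s \<noteq> q" "s \<noteq> r"
    and eq: "v q = v' q" "v r = v' r" "v s = v' s"
    and neg: "triple (v q) (v r) (v p) * triple (v q) (v r) (v' p) < 0"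
  shows "fst ` vertices v n V \<noteq> fst ` vertices v' n V"
proof -
  interpret c: generic_config v n V by fact
  let ?T = "triple (v q) (v r) (v s)"
  have "?T \<noteq> 0" using c.generic_vvv[of q r s] idx by auto
  then consider "?T * triple (v q) (v r) (v p) > 0" "?T * triple (v q) (v r) (v' p) < 0"
    | "?T * triple (v q) (v r) (v p) < 0" "?T * triple (v q) (v r) (v' p) > 0"
    using neg by (auto simp: mult_less_0_iff zero_less_mult_iff linorder_neq_iff)
  then show ?thesis
  proof cases
    case 1 show ?thesis by (rule sign_vectors_separated_aux[OF c d idx(1-5) eq 1])
  next
    case 2
    have "fst ` vertices v' n V \<noteq> fst ` vertices v n V"
      by (rule sign_vectors_separated_aux[OF d c idx(1-5) eq[symmetric]]) (use 2 eq in auto)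
    then show ?thesis by simp
  qed
qed

section \<open>Separated configurations\<close>

lemma cross3_cross3: "cross3 (cross3 x y) z = (x \<bullet> z) *\<^sub>R y - (y \<bullet> z) *\<^sub>R x"
  unfolding vec_eq_iff forall_3 by (simp add: cross3_simps)

lemma avoid_hyperplanes:
  fixes A :: "'a::euclidean_space set"
  assumes "finite A" "0 \<notin> A"
  shows "\<exists>q. \<forall>x\<in>A. q \<bullet> x \<noteq> 0"
  by (rule open_avoids_hyperplanes[OF assms open_UNIV UNIV_not_empty]) blast

text \<open>Each intersection line \<open>N1 i\<^sup>\<bottom> \<inter> N2 i\<^sup>\<bottom>\<close> of the arrangement selects a cell: the one on which
  the functional \<open>f\<close>, in the affine chart \<open>h = 1\<close>, attains its minimum exactly on that line.\<close>

lemma separated_cells: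
  fixes N1 N2 :: "'i \<Rightarrow> real^3"
  assumes fin: "finite I" "finite \<N>" "finite A" and A: "0 \<notin> A" "\<N> \<subseteq> A"
    and N: "\<And>i. i \<in> I \<Longrightarrow> N1 i \<in> \<N>" "\<And>i. i \<in> I \<Longrightarrow> N2 i \<in> \<N>"
    and cr: "\<And>i. i \<in> I \<Longrightarrow> cross3 (N1 i) (N2 i) \<noteq> 0"
    and distinct_lines: "\<And>i j z. \<lbrakk>i \<in> I; j \<in> I; i \<noteq> j; z \<bullet> N1 i = 0; z \<bullet> N2 i = 0; z \<bullet> N1 j = 0; z \<bullet> N2 j = 0\<rbrakk>
      \<Longrightarrow> z = 0"
  obtains q where "\<And>i x. i \<in> I \<Longrightarrow> x \<in> A \<Longrightarrow> q i \<bullet> x \<noteq> 0"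
    "\<And>i j. \<lbrakk>i \<in> I; j \<in> I; i \<noteq> j\<rbrakk> \<Longrightarrow> \<exists>N\<in>\<N>. (N \<bullet> q i) * (N \<bullet> q j) < 0"
proof -
  define z where "z i = cross3 (N1 i) (N2 i)" for i
  have z0: "z i \<noteq> 0" if "i \<in> I" for i using cr that by (simp add: z_def)
  have "0 \<notin> z ` I" using z0 by force
  \<comment> \<open>The chart \<open>h = 1\<close> contains a representative \<open>y i\<close> of
    every intersection line.\<close>
  then have "\<exists>h. \<forall>x\<in>z ` I. h \<bullet> x \<noteq> 0" by (intro avoid_hyperplanes finite_imageI fin(1))
  then obtain h where h: "\<forall>x\<in>z ` I. h \<bullet> x \<noteq> 0" by blast
  define y where "y i = (1 / (h \<bullet> z i)) *\<^sub>R z i" for i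
  have hy: "h \<bullet> y i = 1" if "i \<in> I" for i using h that by (simp add: y_def)
  have y0: "y i \<noteq> 0" if "i \<in> I" for i using hy[OF that] by auto
  have yN: "y i \<bullet> N1 i = 0" "y i \<bullet> N2 i = 0" for i
    by (simp_all add: y_def z_def dot_cross_self inner_commute)
  \<comment> \<open>\<open>e1 i\<close> and \<open>e2 i\<close> lie in the planes with normals
    \<open>N1 i\<close> and \<open>N2 i\<close>, across their common line; pairing with them
    extracts the coefficients at \<open>N2 i\<close> and \<open>N1 i\<close>.\<close>
  define e1 e2 where "e1 i = cross3 (z i) (N1 i)" and "e2 i = cross3 (N2 i) (z i)" for i
  have zN: "z i \<bullet> N1 i = 0" "z i \<bullet> N2 i = 0" for i
    by (simp_all add: z_def dot_cross_self inner_commute)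
  have e: "e1 i \<noteq> 0" "e2 i \<noteq> 0" "e1 i \<bullet> y i = 0" "e2 i \<bullet> y i = 0" if "i \<in> I" for i
  proof -
    have nz: "N1 i \<noteq> 0" "N2 i \<noteq> 0" using cr[OF that] by auto
    show "e1 i \<noteq> 0"
      using norm_and_cross_eq_0[of "z i" "N1 i"] zN(1)[of i] nz z0[OF that] by (auto simp: e1_def)
    show "e2 i \<noteq> 0"
      using norm_and_cross_eq_0[of "N2 i" "z i"] zN(2)[of i] nz z0[OF that]
      by (auto simp: e2_def inner_commute)
    show "e1 i \<bullet> y i = 0" "e2 i \<bullet> y i = 0"
      by (simp_all add: e1_def e2_def y_def dot_cross_self inner_commute)
  qed
  have nz: "x - (h \<bullet> x) *\<^sub>R y i \<noteq> 0" if "x \<noteq> 0" "x \<bullet> y i = 0" for x i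
  proof
    assume "x - (h \<bullet> x) *\<^sub>R y i = 0"
    then have "x = (h \<bullet> x) *\<^sub>R y i" by simp
    then have "x \<bullet> x = (h \<bullet> x) * (x \<bullet> y i)" by (metis inner_scaleR_right)
    then show False using that by simp
  qed
  \<comment> \<open>An \<open>f\<close> that is not orthogonal to these vectors makes both
    coefficients \<alpha> i and \<beta> i of \<open>g i\<close> nonzero.\<close>
  let ?F = "(\<lambda>i. e1 i - (h \<bullet> e1 i) *\<^sub>R y i) ` I \<union> (\<lambda>i. e2 i - (h \<bullet> e2 i) *\<^sub>R y i) ` I"
  have "0 \<notin> ?F"
  proof
    assume "0 \<in> ?F"
    then obtain i where "i \<in> I" "e1 i - (h \<bullet> e1 i) *\<^sub>R y i = 0 \<or> e2 i - (h \<bullet> e2 i) *\<^sub>R y i = 0"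
      unfolding image_iff Un_iff by metis
    then show False using nz[OF e(1) e(3)] nz[OF e(2) e(4)] by blast
  qed
  then have "\<exists>f. \<forall>x\<in>?F. f \<bullet> x \<noteq> 0" by (intro avoid_hyperplanes finite_UnI finite_imageI fin(1))
  then obtain f where f: "\<forall>x\<in>?F. f \<bullet> x \<noteq> 0" by blast
  \<comment> \<open>On the chart, \<open>g i\<close> is \<open>f\<close> minus its value at
    \<open>y i\<close>. It vanishes at \<open>y i\<close> and is therefore a combination of
    \<open>N1 i\<close> and \<open>N2 i\<close>.\<close>
  define g where "g i = f - (f \<bullet> y i) *\<^sub>R h" for i
  define \<alpha> \<beta> where "\<alpha> i = g i \<bullet> e2 i" and "\<beta> i = g i \<bullet> e1 i" for i
  have ab: "\<alpha> i \<noteq> 0" "\<beta> i \<noteq> 0" if "i \<in> I" for i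
  proof -
    have "\<alpha> i = f \<bullet> (e2 i - (h \<bullet> e2 i) *\<^sub>R y i)" "\<beta> i = f \<bullet> (e1 i - (h \<bullet> e1 i) *\<^sub>R y i)"
      by (simp_all add: \<alpha>_def \<beta>_def g_def inner_diff_left inner_diff_right)
    then show "\<alpha> i \<noteq> 0" "\<beta> i \<noteq> 0" using f that by auto
  qed
  have dec: "(z i \<bullet> z i) * (g i \<bullet> x) = \<alpha> i * (N1 i \<bullet> x) + \<beta> i * (N2 i \<bullet> x)" if i: "i \<in> I" for i x
  proof -
    have "g i \<bullet> y i = 0" using hy[OF i] by (simp add: g_def inner_diff_left)
    then have "z i \<bullet> g i = 0" using h i by (simp add: y_def inner_commute)
    then have t3: "triple (N1 i) (N2 i) (g i) = 0" by (simp add: triple_def z_def)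
    have t: "triple (N1 i) (N2 i) (z i) = z i \<bullet> z i" by (simp add: triple_def z_def)
    have t1: "triple (g i) (N2 i) (z i) = \<alpha> i"
      using triple_perms(1)[of "N2 i" "z i" "g i"] by (metis \<alpha>_def e2_def triple_def inner_commute)
    have t2: "triple (N1 i) (g i) (z i) = \<beta> i"
      using triple_perms(2)[of "z i" "N1 i" "g i"] by (metis \<beta>_def e1_def triple_def inner_commute)
    have "(z i \<bullet> z i) *\<^sub>R g i = \<alpha> i *\<^sub>R N1 i + \<beta> i *\<^sub>R N2 i"
      using triple_cramer[of "N1 i" "N2 i" "z i" "g i"] t t1 t2 t3 by simp
    then have "((z i \<bullet> z i) *\<^sub>R g i) \<bullet> x = (\<alpha> i *\<^sub>R N1 i + \<beta> i *\<^sub>R N2 i) \<bullet> x" by simp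
    then show ?thesis by (simp add: inner_add_left)
  qed
  \<comment> \<open>The part of the cells around \<open>y i\<close> where both terms of
    \<open>dec\<close> are positive, so that \<open>f\<close> exceeds in the chart its value at
    \<open>y i\<close>. Planes not through \<open>y i\<close> keep the sign they have there.\<close>
  define U where "U i = {q. 0 < \<alpha> i * (N1 i \<bullet> q)} \<inter> {q. 0 < \<beta> i * (N2 i \<bullet> q)} \<inter>
     (\<Inter>N\<in>{N\<in>\<N>. N \<bullet> y i \<noteq> 0}. {q. 0 < (N \<bullet> y i) * (N \<bullet> q)})" for i
  have openU: "open (U i)" for i
    unfolding U_def using fin(2)
    by (intro open_Int open_INT open_Collect_less continuous_intros ballI) auto
  have U_ne: "U i \<noteq> {}" if i: "i \<in> I" for i
  proof -
    \<comment> \<open>Moving from \<open>y i\<close> along \<open>d\<close> enters both open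
      half-spaces at once, and a short move crosses none of the other planes.\<close>
    obtain d where d: "d \<bullet> N1 i = \<alpha> i" "d \<bullet> N2 i = \<beta> i"
      using two_functionals_solvable[OF cr[OF i]] by blast
    have lim: "((\<lambda>e. y i + e *\<^sub>R d) \<longlongrightarrow> y i) (at_right (0::real))"
      by (auto intro!: tendsto_eq_intros)
    have op: "open (\<Inter>N\<in>{N\<in>\<N>. N \<bullet> y i \<noteq> 0}. {q. 0 < (N \<bullet> y i) * (N \<bullet> q)})" (is "open ?W")
      using fin(2) by (intro open_INT open_Collect_less continuous_intros ballI) auto
    have "y i \<in> ?W" by (auto simp: zero_less_mult_iff)
    then have "\<forall>\<^sub>F e in at_right 0. y i + e *\<^sub>R d \<in> ?W" using lim op topological_tendstoD by blast
    then have "\<forall>\<^sub>F e in at_right (0::real). 0 < e \<and> y i + e *\<^sub>R d \<in> ?W"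
      using eventually_at_right_less[of "0::real"] by eventually_elim auto
    then obtain e where e: "e > 0" "y i + e *\<^sub>R d \<in> ?W"
      using eventually_happens[of _ "at_right (0::real)"] trivial_limit_at_right_real by blast
    have "\<alpha> i * (N1 i \<bullet> (y i + e *\<^sub>R d)) = e * (\<alpha> i)\<^sup>2" "\<beta> i * (N2 i \<bullet> (y i + e *\<^sub>R d)) = e * (\<beta> i)\<^sup>2"
      using yN[of i] d by (simp_all add: inner_add_right inner_commute power2_eq_square)
    then have "y i + e *\<^sub>R d \<in> U i" using ab[OF i] e by (simp add: U_def)
    then show ?thesis by blast
  qed
  have exq: "\<exists>q. q \<in> U i \<and> (\<forall>x\<in>A. q \<bullet> x \<noteq> 0)" if "i \<in> I" for i
    by (rule open_avoids_hyperplanes[OF fin(3) A(1) openU U_ne[OF that]]) blast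
  define q where "q i = (SOME p. p \<in> U i \<and> (\<forall>x\<in>A. p \<bullet> x \<noteq> 0))" for i
  have "q i \<in> U i \<and> (\<forall>x\<in>A. q i \<bullet> x \<noteq> 0)" if "i \<in> I" for i
    unfolding q_def by (rule someI_ex[OF exq[OF that]])
  then have q: "\<And>i. i \<in> I \<Longrightarrow> q i \<in> U i" "\<And>i x. i \<in> I \<Longrightarrow> x \<in> A \<Longrightarrow> q i \<bullet> x \<noteq> 0"
    by blast+
  \<comment> \<open>If \<open>q i\<close> and \<open>q j\<close> share a cell, then
    \<open>y j\<close> is in its closure, where \<open>f\<close> on the chart is smallest at
    \<open>y i\<close> and only there. By symmetry a common cell forces a common line.\<close>
  have key: "f \<bullet> y i \<le> f \<bullet> y j \<and> (f \<bullet> y i = f \<bullet> y j \<longrightarrow> y j \<bullet> N1 i = 0 \<and> y j \<bullet> N2 i = 0)"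
    if i: "i \<in> I" and j: "j \<in> I" and same: "\<And>N. N \<in> \<N> \<Longrightarrow> (N \<bullet> q i) * (N \<bullet> q j) > 0" for i j
  proof -
    have weak: "0 \<le> c * (N \<bullet> y j)" if "N \<in> \<N>" "0 < c * (N \<bullet> q i)" for c N
    proof (cases "N \<bullet> y j = 0")
      case False
      then have "0 < (N \<bullet> y j) * (N \<bullet> q j)" using q(1)[OF j] that by (auto simp: U_def)
      then show ?thesis using same[OF that(1)] that(2)
        by (smt (verit, best) mult_less_0_iff zero_less_mult_iff mult_nonneg_nonneg mult_nonpos_nonpos)
    qed simp
    have 1: "0 \<le> \<alpha> i * (N1 i \<bullet> y j)" using q(1)[OF i] N(1)[OF i] by (intro weak) (auto simp: U_def)
    have 2: "0 \<le> \<beta> i * (N2 i \<bullet> y j)" using q(1)[OF i] N(2)[OF i] by (intro weak) (auto simp: U_def)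
    have zz: "z i \<bullet> z i > 0" using z0[OF i] by simp
    have gy: "g i \<bullet> y j = f \<bullet> y j - f \<bullet> y i" using hy[OF j] by (simp add: g_def inner_diff_left)
    have D: "(z i \<bullet> z i) * (f \<bullet> y j - f \<bullet> y i) = \<alpha> i * (N1 i \<bullet> y j) + \<beta> i * (N2 i \<bullet> y j)"
      using dec[OF i, of "y j"] gy by simp
    then have "0 \<le> (z i \<bullet> z i) * (f \<bullet> y j - f \<bullet> y i)" using 1 2 by linarith
    then have "f \<bullet> y i \<le> f \<bullet> y j" using zz by (simp add: zero_le_mult_iff)
    moreover have "y j \<bullet> N1 i = 0 \<and> y j \<bullet> N2 i = 0" if "f \<bullet> y i = f \<bullet> y j"
    proof -
      have "\<alpha> i * (N1 i \<bullet> y j) = 0" "\<beta> i * (N2 i \<bullet> y j) = 0" 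
        using D 1 2 that by (simp_all add: add_nonneg_eq_0_iff)
      then show ?thesis using ab[OF i] by (simp add: inner_commute)
    qed
    ultimately show ?thesis by blast
  qed
  have sep: "\<exists>N\<in>\<N>. (N \<bullet> q i) * (N \<bullet> q j) < 0" if ij: "i \<in> I" "j \<in> I" "i \<noteq> j" for i j
  proof (rule ccontr)
    assume "\<not> ?thesis"
    moreover have "N \<bullet> q i \<noteq> 0" "N \<bullet> q j \<noteq> 0" if "N \<in> \<N>" for N
      using q(2) A(2) ij that by (auto simp: inner_commute)
    ultimately have same: "(N \<bullet> q i) * (N \<bullet> q j) > 0" if "N \<in> \<N>" for N
      using that by (metis linorder_neqE_linordered_idom mult_eq_0_iff)
    then have same': "(N \<bullet> q j) * (N \<bullet> q i) > 0" if "N \<in> \<N>" for N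
      using that by (simp add: mult.commute)
    have "y j \<bullet> N1 i = 0" "y j \<bullet> N2 i = 0"
      using key[OF ij(1,2) same] key[OF ij(2,1) same'] by auto
    then have "y j = 0" using distinct_lines[OF ij, of "y j"] yN by blast
    then show False using y0 ij by blast
  qed
  show ?thesis by (rule that[OF q(2) sep])
qed

text \<open>The last condition says that no three planes spanned by disjoint pairs of vectors share a line; it
  makes the intersection lines, and hence the cells, numerous.\<close>

definition super_generic :: "(real^3) set \<Rightarrow> (nat \<Rightarrow> real^3) \<Rightarrow> nat \<Rightarrow> bool" where
  "super_generic V v n \<longleftrightarrow>
     (\<forall>i<n. v i \<noteq> 0) \<and>
     (\<forall>i<n. \<forall>j<n. i \<noteq> j \<longrightarrow> cross3 (v i) (v j) \<noteq> 0) \<and>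
     (\<forall>i<n. \<forall>t\<in>V. \<forall>t'\<in>V. t \<noteq> t' \<longrightarrow> cross3 (v i) (t - t') \<noteq> 0) \<and>
     (\<forall>i<n. \<forall>j<n. \<forall>k<n. distinct [i, j, k] \<longrightarrow> triple (v i) (v j) (v k) \<noteq> 0) \<and>
     (\<forall>i<n. \<forall>j<n. \<forall>t\<in>V. \<forall>t'\<in>V. i \<noteq> j \<longrightarrow> t \<noteq> t' \<longrightarrow> triple (v i) (v j) (t - t') \<noteq> 0) \<and>
     (\<forall>i<n. \<forall>t\<in>V. \<forall>t'\<in>V. \<forall>t''\<in>V. distinct [t, t', t''] \<longrightarrow> triple (v i) (t' - t) (t'' - t) \<noteq> 0) \<and>
     (\<forall>a<n. \<forall>b<n. \<forall>c<n. \<forall>d<n. \<forall>e<n. \<forall>f<n. distinct [a, b, c, d, e, f] \<longrightarrow>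
        (\<forall>z. z \<bullet> cross3 (v a) (v b) = 0 \<longrightarrow> z \<bullet> cross3 (v c) (v d) = 0 \<longrightarrow>
             z \<bullet> cross3 (v e) (v f) = 0 \<longrightarrow> z = 0))"

lemma
  assumes "super_generic V v n"
  shows super_generic_nonzero: "i < n \<Longrightarrow> v i \<noteq> 0"
    and super_generic_cross: "\<lbrakk>i < n; j < n; i \<noteq> j\<rbrakk> \<Longrightarrow> cross3 (v i) (v j) \<noteq> 0"
    and super_generic_cross_t: "\<lbrakk>i < n; t \<in> V; t' \<in> V; t \<noteq> t'\<rbrakk> \<Longrightarrow> cross3 (v i) (t - t') \<noteq> 0"
    and super_generic_vvv: "\<lbrakk>i < n; j < n; k < n; distinct [i, j, k]\<rbrakk> \<Longrightarrow> triple (v i) (v j) (v k) \<noteq> 0"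
    and super_generic_vvt: "\<lbrakk>i < n; j < n; i \<noteq> j; t \<in> V; t' \<in> V; t \<noteq> t'\<rbrakk>
      \<Longrightarrow> triple (v i) (v j) (t - t') \<noteq> 0"
    and super_generic_vtt: "\<lbrakk>i < n; t \<in> V; t' \<in> V; t'' \<in> V; distinct [t, t', t'']\<rbrakk>
      \<Longrightarrow> triple (v i) (t' - t) (t'' - t) \<noteq> 0"
    and super_generic_lines: "\<lbrakk>a < n; b < n; c < n; d < n; k < n; l < n; distinct [a, b, c, d, k, l];
      z \<bullet> cross3 (v a) (v b) = 0; z \<bullet> cross3 (v c) (v d) = 0; z \<bullet> cross3 (v k) (v l) = 0\<rbrakk> \<Longrightarrow> z = 0"
proof -
  note a = assms[unfolded super_generic_def]
  note a2 = conjunct2[OF a] note a3 = conjunct2[OF a2] note a4 = conjunct2[OF a3]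
  note a5 = conjunct2[OF a4] note a6 = conjunct2[OF a5] note a7 = conjunct2[OF a6]
  show "i < n \<Longrightarrow> v i \<noteq> 0" by (rule conjunct1[OF a, rule_format])
  show "\<lbrakk>i < n; j < n; i \<noteq> j\<rbrakk> \<Longrightarrow> cross3 (v i) (v j) \<noteq> 0"
    by (rule conjunct1[OF a2, rule_format])
  show "\<lbrakk>i < n; t \<in> V; t' \<in> V; t \<noteq> t'\<rbrakk> \<Longrightarrow> cross3 (v i) (t - t') \<noteq> 0"
    by (rule conjunct1[OF a3, rule_format])
  show "\<lbrakk>i < n; j < n; k < n; distinct [i, j, k]\<rbrakk> \<Longrightarrow> triple (v i) (v j) (v k) \<noteq> 0"
    by (rule conjunct1[OF a4, rule_format])
  show "\<lbrakk>i < n; j < n; i \<noteq> j; t \<in> V; t' \<in> V; t \<noteq> t'\<rbrakk> \<Longrightarrow> triple (v i) (v j) (t - t') \<noteq> 0"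
    by (rule conjunct1[OF a5, rule_format])
  show "\<lbrakk>i < n; t \<in> V; t' \<in> V; t'' \<in> V; distinct [t, t', t'']\<rbrakk>
      \<Longrightarrow> triple (v i) (t' - t) (t'' - t) \<noteq> 0"
    by (rule conjunct1[OF a6, rule_format])
  show "\<lbrakk>a < n; b < n; c < n; d < n; k < n; l < n; distinct [a, b, c, d, k, l];
      z \<bullet> cross3 (v a) (v b) = 0; z \<bullet> cross3 (v c) (v d) = 0; z \<bullet> cross3 (v k) (v l) = 0\<rbrakk> \<Longrightarrow> z = 0"
    by (rule a7[rule_format])
qed

lemma orthogonal_nonzero_exists: "\<exists>y::real^3. y \<noteq> 0 \<and> y \<bullet> x = 0"
proof (cases "x = 0")
  case True
  have "axis 1 1 \<noteq> (0::real^3)" by (simp add: axis_eq_0_iff)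
  then show ?thesis using True by auto
next
  case False
  then obtain k where "cross3 x (axis k 1) \<noteq> 0" using cross_basis_nonzero by blast
  then show ?thesis by (intro exI[of _ "cross3 x (axis k 1)"]) (simp add: dot_cross_self inner_commute)
qed

text \<open>Crossing \<open>cross3 x q\<close> with the witness \<open>y\<close> gives
  \<open>-(q \<bullet> y) *\<^sub>R x\<close>. Being non-parallel to a fixed vector, which is not
  itself a hyperplane condition, thus follows from avoiding one hyperplane.\<close>

lemma cross_nonzero_of_witness:
  assumes "x \<noteq> 0" "y \<bullet> x = 0" "q \<bullet> y \<noteq> 0"
  shows "cross3 x q \<noteq> 0"
proof
  assume "cross3 x q = 0"
  then have "(q \<bullet> y) *\<^sub>R x = 0" using cross3_cross3[of x q y] assms(2) by (simp add: inner_commute)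
  then show False using assms by simp
qed

lemma cross_nonzero_of_inner:
  assumes "z \<noteq> 0" "z \<bullet> N = 0" "u \<bullet> N \<noteq> 0"
  shows "cross3 z u \<noteq> 0"
proof
  assume "cross3 z u = 0"
  then have "(u \<bullet> N) *\<^sub>R z = 0" using cross3_cross3[of z u N] assms(2) by simp
  then show False using assms by simp
qed

lemma super_generic_line_direction:
  assumes "super_generic V v n" "a < n" "b < n" "c < n" "d < n" "distinct [a, b, c, d]"
  shows "cross3 (cross3 (v a) (v b)) (cross3 (v c) (v d)) \<noteq> 0"
proof (rule cross_nonzero_of_inner[of _ "v a"])
  show "cross3 (v a) (v b) \<noteq> 0" using super_generic_cross[OF assms(1)] assms by auto
  show "cross3 (v a) (v b) \<bullet> v a = 0" by (simp add: dot_cross_self inner_commute)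
  show "cross3 (v c) (v d) \<bullet> v a \<noteq> 0"
    using super_generic_vvv[OF assms(1), of c d a] assms by (auto simp: triple_def)
qed

text \<open>Each condition that involves the new vector \<open>q\<close> follows when
  \<open>q\<close> avoids one suitable plane through the origin, and \<open>A\<close> collects the
  normals of these finitely many planes.\<close>

lemma super_generic_extension:
  assumes g: "super_generic V v n" and V: "finite V"
    and Vt: "\<And>t t' t''. \<lbrakk>t \<in> V; t' \<in> V; t'' \<in> V; distinct [t, t', t'']\<rbrakk> \<Longrightarrow> cross3 (t' - t) (t'' - t) \<noteq> 0"
  obtains A where "finite A" "0 \<notin> A" "\<And>i j. \<lbrakk>i < n; j < n; i \<noteq> j\<rbrakk> \<Longrightarrow> cross3 (v i) (v j) \<in> A"
    "\<And>q. (\<forall>x\<in>A. q \<bullet> x \<noteq> 0) \<Longrightarrow> super_generic V (v(n := q)) (Suc n)"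
proof -
  obtain orth :: "real^3 \<Rightarrow> real^3" where orth: "\<And>x. orth x \<noteq> 0" "\<And>x. orth x \<bullet> x = 0"
    using orthogonal_nonzero_exists by metis
  let ?I = "{..<n}"
  define A1 where "A1 = (\<lambda>(i,j). cross3 (v i) (v j)) ` {(i,j) \<in> ?I \<times> ?I. i \<noteq> j}"
  define A2 where "A2 = (\<lambda>(i,t,t'). cross3 (v i) (t - t')) ` {(i,t,t') \<in> ?I \<times> V \<times> V. t \<noteq> t'}"
  define A3 where "A3 = (\<lambda>(t,t',t''). cross3 (t' - t) (t'' - t)) ` {(t,t',t'') \<in> V \<times> V \<times> V. distinct [t,t',t'']}"
  define A4 where "A4 = (\<lambda>i. orth (v i)) ` ?I"
  define A5 where "A5 = (\<lambda>(t,t'). orth (t - t')) ` (V \<times> V)"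
  \<comment> \<open>\<open>q\<close> has to stay out of the plane spanned by \<open>v e\<close> and
    the line where two planes meet.\<close>
  define A6 where "A6 = (\<lambda>(a,b,c,d,e). cross3 (cross3 (cross3 (v a) (v b)) (cross3 (v c) (v d))) (v e)) `
    {(a,b,c,d,e) \<in> ?I \<times> ?I \<times> ?I \<times> ?I \<times> ?I. distinct [a,b,c,d,e]}"
  \<comment> \<open>The extra vector ensures \<open>q \<noteq> 0\<close> even when the other sets
    are empty.\<close>
  define A where "A = insert (axis 1 1) (A1 \<union> A2 \<union> A3 \<union> A4 \<union> A5 \<union> A6)"
  have fin: "finite A1" "finite A2" "finite A3" "finite A4" "finite A5" "finite A6"
  proof -
    show "finite A1" unfolding A1_def by (rule finite_imageI, rule rev_finite_subset[of "?I \<times> ?I"]) auto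
    show "finite A2" unfolding A2_def
      by (rule finite_imageI, rule rev_finite_subset[of "?I \<times> V \<times> V"]) (use V in auto)
    show "finite A3" unfolding A3_def
      by (rule finite_imageI, rule rev_finite_subset[of "V \<times> V \<times> V"]) (use V in auto)
    show "finite A4" "finite A5" unfolding A4_def A5_def using V by auto
    show "finite A6" unfolding A6_def
      by (rule finite_imageI, rule rev_finite_subset[of "?I \<times> ?I \<times> ?I \<times> ?I \<times> ?I"]) auto
  qed
  have 6: "cross3 (cross3 (cross3 (v a) (v b)) (cross3 (v c) (v d))) (v e) \<noteq> 0"
    if "a < n" "b < n" "c < n" "d < n" "e < n" "distinct [a,b,c,d,e]" for a b c d e
  proof (rule cross_nonzero_of_inner[of _ "cross3 (v a) (v b)"])
    show "cross3 (cross3 (v a) (v b)) (cross3 (v c) (v d)) \<noteq> 0"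
      using super_generic_line_direction[OF g] that by auto
    show "cross3 (cross3 (v a) (v b)) (cross3 (v c) (v d)) \<bullet> cross3 (v a) (v b) = 0"
      by (simp add: dot_cross_self inner_commute)
    show "v e \<bullet> cross3 (v a) (v b) \<noteq> 0"
      using super_generic_vvv[OF g, of a b e] that by (auto simp: triple_def inner_commute)
  qed
  have "0 \<notin> A1" using super_generic_cross[OF g] by (auto simp: A1_def)
  moreover have "0 \<notin> A2" using super_generic_cross_t[OF g] by (auto simp: A2_def)
  moreover have "0 \<notin> A3" using Vt by (auto simp: A3_def)
  moreover have "0 \<notin> A4" "0 \<notin> A5" unfolding A4_def A5_def using orth(1)[symmetric] by auto
  moreover have "0 \<notin> A6"
  proof
    assume "0 \<in> A6"
    then obtain a b c d e where "0 = cross3 (cross3 (cross3 (v a) (v b)) (cross3 (v c) (v d))) (v e)"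
      "a < n" "b < n" "c < n" "d < n" "e < n" "distinct [a,b,c,d,e]"
      unfolding A6_def by auto
    then show False using 6[of a b c d e] by simp
  qed
  moreover have "axis 1 1 \<noteq> (0::real^3)" by (simp add: axis_eq_0_iff)
  ultimately have A0: "0 \<notin> A" by (auto simp: A_def)
  have ext: "super_generic V (v(n := q)) (Suc n)" if q: "\<forall>x\<in>A. q \<bullet> x \<noteq> 0" for q
  proof -
    let ?v = "v(n := q)"
    have q1: "q \<bullet> cross3 (v i) (v j) \<noteq> 0" if "i < n" "j < n" "i \<noteq> j" for i j
    proof -
      have "cross3 (v i) (v j) \<in> A1"
        unfolding A1_def using that by (intro image_eqI[of _ _ "(i,j)"]) auto
      then show ?thesis using q unfolding A_def by blast
    qed
    have q2: "q \<bullet> cross3 (v i) (t - t') \<noteq> 0" if "i < n" "t \<in> V" "t' \<in> V" "t \<noteq> t'" for i t t'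
    proof -
      have "cross3 (v i) (t - t') \<in> A2"
        unfolding A2_def using that by (intro image_eqI[of _ _ "(i,t,t')"]) auto
      then show ?thesis using q unfolding A_def by blast
    qed
    have q3: "q \<bullet> cross3 (t' - t) (t'' - t) \<noteq> 0" if "t \<in> V" "t' \<in> V" "t'' \<in> V" "distinct [t,t',t'']" for t t' t''
    proof -
      have "cross3 (t' - t) (t'' - t) \<in> A3"
        unfolding A3_def using that by (intro image_eqI[of _ _ "(t,t',t'')"]) auto
      then show ?thesis using q unfolding A_def by blast
    qed
    have q4: "q \<bullet> orth (v i) \<noteq> 0" if "i < n" for i
    proof -
      have "orth (v i) \<in> A4" unfolding A4_def using that by blast
      then show ?thesis using q unfolding A_def by blast
    qed
    have q5: "q \<bullet> orth (t - t') \<noteq> 0" if "t \<in> V" "t' \<in> V" for t t'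
    proof -
      have "orth (t - t') \<in> A5" unfolding A5_def using that by (intro image_eqI[of _ _ "(t,t')"]) auto
      then show ?thesis using q unfolding A_def by blast
    qed
    have q6: "q \<bullet> cross3 (cross3 (cross3 (v a) (v b)) (cross3 (v c) (v d))) (v e) \<noteq> 0"
      if "a < n" "b < n" "c < n" "d < n" "e < n" "distinct [a,b,c,d,e]" for a b c d e
    proof -
      have "cross3 (cross3 (cross3 (v a) (v b)) (cross3 (v c) (v d))) (v e) \<in> A6"
        unfolding A6_def using that by (intro image_eqI[of _ _ "(a,b,c,d,e)"]) auto
      then show ?thesis using q unfolding A_def by blast
    qed
    have "q \<bullet> axis 1 1 \<noteq> 0" using q unfolding A_def by blast
    then have q0: "q \<noteq> 0" by auto
    have cr: "cross3 (v i) q \<noteq> 0" "cross3 q (v i) \<noteq> 0" if "i < n" for i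
    proof -
      show "cross3 (v i) q \<noteq> 0"
        by (rule cross_nonzero_of_witness[OF super_generic_nonzero[OF g that] orth(2) q4[OF that]])
      then show "cross3 q (v i) \<noteq> 0" by (metis cross_skew neg_equal_0_iff_equal)
    qed
    have crt: "cross3 q (t - t') \<noteq> 0" if "t \<in> V" "t' \<in> V" "t \<noteq> t'" for t t'
    proof -
      have "cross3 (t - t') q \<noteq> 0"
        using cross_nonzero_of_witness[OF _ orth(2) q5[OF that(1,2)]] that by simp
      then show ?thesis by (metis cross_skew neg_equal_0_iff_equal)
    qed
    have tr: "triple (v i) (v j) q \<noteq> 0" if "i < n" "j < n" "i \<noteq> j" for i j
      using q1[OF that] by (simp add: triple_def inner_commute)
    have tr': "triple (v i) q (v j) \<noteq> 0" "triple q (v i) (v j) \<noteq> 0" if "i < n" "j < n" "i \<noteq> j" for i j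
      using tr[OF that] triple_perms[of "v i" "v j" q] by (metis triple_perms neg_equal_0_iff_equal)+
    have trt: "triple (v i) q (t - t') \<noteq> 0" "triple q (v i) (t - t') \<noteq> 0"
      if "i < n" "t \<in> V" "t' \<in> V" "t \<noteq> t'" for i t t'
    proof -
      have "triple (v i) (t - t') q \<noteq> 0" using q2[OF that] by (simp add: triple_def inner_commute)
      then show "triple (v i) q (t - t') \<noteq> 0" "triple q (v i) (t - t') \<noteq> 0"
        by (metis triple_perms neg_equal_0_iff_equal)+
    qed
    have trtt: "triple q (t' - t) (t'' - t) \<noteq> 0"
      if "t \<in> V" "t' \<in> V" "t'' \<in> V" "distinct [t,t',t'']" for t t' t''
    proof -
      have "triple (t' - t) (t'' - t) q \<noteq> 0" using q3[OF that] by (simp add: triple_def inner_commute)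
      then show ?thesis by (metis triple_perms)
    qed
    have ln: "z = 0"
      if idx: "a < n" "b < n" "c < n" "d < n" "e < n" "distinct [a,b,c,d,e]"
        and z: "z \<bullet> cross3 (v a) (v b) = 0" "z \<bullet> cross3 (v c) (v d) = 0" "z \<bullet> cross3 (v e) q = 0" for a b c d e z
    proof -
      let ?z = "cross3 (cross3 (v a) (v b)) (cross3 (v c) (v d))"
      have z0: "?z \<noteq> 0" using super_generic_line_direction[OF g] idx by auto
      obtain l where l: "z = l *\<^sub>R ?z" by (rule orthogonal_two_parallel[OF z0 z(1,2)])
      have "cross3 ?z (v e) \<bullet> q = ?z \<bullet> cross3 (v e) q"
        using triple_perms(1)[of "v e" q ?z] by (simp add: triple_def inner_commute)
      then have "l * (q \<bullet> cross3 ?z (v e)) = 0" using z(3) l by (simp add: inner_commute)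
      then show ?thesis using q6[OF idx] l by simp
    qed
    have sk: "z \<bullet> cross3 x y = 0 \<longleftrightarrow> z \<bullet> cross3 y x = 0" for x y z
      using cross_skew[of x y] by simp
    have lines: "z = 0" if b: "a < Suc n" "b < Suc n" "c < Suc n" "d < Suc n" "e < Suc n" "f < Suc n"
      and dist: "distinct [a, b, c, d, e, f]" and z: "z \<bullet> cross3 (?v a) (?v b) = 0"
        "z \<bullet> cross3 (?v c) (?v d) = 0" "z \<bullet> cross3 (?v e) (?v f) = 0" for a b c d e f z
    proof -
      \<comment> \<open>The indices are distinct, so at most one of them is \<open>n\<close>; its
        pair is moved to the last place and, where necessary, reversed.\<close>
      consider "a = n" | "b = n" | "c = n" | "d = n" | "e = n" | "f = n"
        | "a < n" "b < n" "c < n" "d < n" "e < n" "f < n" using b by linarith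
      then show ?thesis
      proof cases
        case 1 then show ?thesis using b dist z sk[of z q "v b"] by (intro ln[of c d e f b z]) (auto simp: less_Suc_eq)
      next
        case 2 then show ?thesis using b dist z by (intro ln[of c d e f a z]) (auto simp: less_Suc_eq)
      next
        case 3 then show ?thesis using b dist z sk[of z q "v d"] by (intro ln[of a b e f d z]) (auto simp: less_Suc_eq)
      next
        case 4 then show ?thesis using b dist z by (intro ln[of a b e f c z]) (auto simp: less_Suc_eq)
      next
        case 5 then show ?thesis using b dist z sk[of z q "v f"] by (intro ln[of a b c d f z]) (auto simp: less_Suc_eq)
      next
        case 6 then show ?thesis using b dist z by (intro ln[of a b c d e z]) (auto simp: less_Suc_eq)
      next
        case 7 then show ?thesis using dist z by (intro super_generic_lines[OF g, of a b c d e f z]) auto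
      qed
    qed
    have g1: "?v i \<noteq> 0" if "i < Suc n" for i
      using that q0 super_generic_nonzero[OF g] by (auto simp: less_Suc_eq)
    have g2: "cross3 (?v i) (?v j) \<noteq> 0" if "i < Suc n" "j < Suc n" "i \<noteq> j" for i j
      using that cr super_generic_cross[OF g] by (auto simp: less_Suc_eq)
    have g3: "cross3 (?v i) (t - t') \<noteq> 0" if "i < Suc n" "t \<in> V" "t' \<in> V" "t \<noteq> t'" for i t t'
      using that crt super_generic_cross_t[OF g] by (auto simp: less_Suc_eq)
    have g4: "triple (?v i) (?v j) (?v k) \<noteq> 0"
      if "i < Suc n" "j < Suc n" "k < Suc n" "distinct [i, j, k]" for i j k
      using that tr tr' super_generic_vvv[OF g, of i j k] by (auto simp: less_Suc_eq)
    have g5: "triple (?v i) (?v j) (t - t') \<noteq> 0"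
      if "i < Suc n" "j < Suc n" "i \<noteq> j" "t \<in> V" "t' \<in> V" "t \<noteq> t'" for i j t t'
      using that trt super_generic_vvt[OF g, of i j t t'] by (auto simp: less_Suc_eq)
    have g6: "triple (?v i) (t' - t) (t'' - t) \<noteq> 0"
      if "i < Suc n" "t \<in> V" "t' \<in> V" "t'' \<in> V" "distinct [t, t', t'']" for i t t' t''
      using that trtt[of t t' t''] super_generic_vtt[OF g, of i t t' t''] by (auto simp: less_Suc_eq)
    show ?thesis
      unfolding super_generic_def
      apply (intro conjI allI ballI impI)
      subgoal by (rule g1)
      subgoal by (rule g2)
      subgoal by (rule g3)
      subgoal by (rule g4)
      subgoal by (rule g5)
      subgoal by (rule g6)
      subgoal for a b c d e f z by (rule lines[of a b c d e f z])
      done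
  qed
  show ?thesis
  proof (rule that[of A])
    show "finite A" using fin by (simp add: A_def)
    show "0 \<notin> A" by (rule A0)
    show "cross3 (v i) (v j) \<in> A" if "i < n" "j < n" "i \<noteq> j" for i j
      using that by (auto simp: A_def A1_def)
    show "super_generic V (v(n := q)) (Suc n)" if "\<forall>x\<in>A. q \<bullet> x \<noteq> 0" for q by (rule ext[OF that])
  qed
qed

section \<open>Projections\<close>

text \<open>A nonzero vector orthogonal to \<open>a\<close> and \<open>b\<close> is a normal of
  their plane, so \<open>w \<bullet> u = 0\<close> puts \<open>u\<close> into that plane.\<close>

lemma in_span_orthogonal_pair:
  fixes a b u w :: "real^3"
  assumes "cross3 a b \<noteq> 0" "w \<noteq> 0" "w \<bullet> a = 0" "w \<bullet> b = 0" "w \<bullet> u = 0" "a \<in> S" "b \<in> S"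
  shows "u \<in> span S"
proof -
  obtain l where l: "w = l *\<^sub>R cross3 a b" by (rule orthogonal_two_parallel[OF assms(1,3,4)])
  have l0: "l \<noteq> 0" using l assms(2) by auto
  have T: "triple a b w \<noteq> 0" using l l0 assms(1) by (simp add: triple_def)
  have "l * triple a b u = 0" using assms(5) unfolding l by (simp add: triple_def)
  then have "triple a b u = 0" using l0 by simp
  then have "triple a b w *\<^sub>R u = triple u b w *\<^sub>R a + triple a u w *\<^sub>R b"
    using triple_cramer[of a b w u] by simp
  moreover have "\<dots> \<in> span S" using assms(6,7) by (intro span_add span_mul span_base)
  ultimately have "triple a b w *\<^sub>R u \<in> span S" by simp
  then have "(1 / triple a b w) *\<^sub>R (triple a b w *\<^sub>R u) \<in> span S" by (rule span_mul)
  then show ?thesis using T by simp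
qed

lemma plane_coordinates:
  fixes u w w' :: "real^3"
  assumes "u \<noteq> 0" "w \<noteq> 0" "w \<bullet> u = 0" "w' \<bullet> u = 0"
  shows "w' = ((w' \<bullet> w) / (w \<bullet> w)) *\<^sub>R w +
    ((w' \<bullet> cross3 u w) / (cross3 u w \<bullet> cross3 u w)) *\<^sub>R cross3 u w" (is "w' = ?r")
proof -
  have c0: "cross3 u w \<noteq> 0" using norm_and_cross_eq_0[of u w] assms by (auto simp: inner_commute)
  have o: "cross3 u w \<bullet> u = 0" "cross3 u w \<bullet> w = 0" "w \<bullet> cross3 u w = 0"
    by (auto simp: dot_cross_self inner_commute)
  have "(w' - ?r) \<bullet> u = 0" using assms o by (simp add: inner_diff_left inner_add_left)
  moreover have "(w' - ?r) \<bullet> w = 0" using assms o by (simp add: inner_diff_left inner_add_left)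
  moreover have "(w' - ?r) \<bullet> cross3 u w = 0" using c0 o by (simp add: inner_diff_left inner_add_left)
  moreover have "triple u w (cross3 u w) \<noteq> 0" using c0 by (simp add: triple_def)
  ultimately have "w' - ?r = 0" using orthogonal_basis_zero by blast
  then show ?thesis by simp
qed

lemma unit_vectors_on_line:
  fixes c :: "real^3"
  assumes "c \<noteq> 0"
  shows "{w. norm w = 1 \<and> (\<exists>l. w = l *\<^sub>R c)} = {(1 / norm c) *\<^sub>R c, - ((1 / norm c) *\<^sub>R c)}"
proof -
  have "w = (1 / norm c) *\<^sub>R c \<or> w = - ((1 / norm c) *\<^sub>R c)" if w: "norm w = 1" "w = l *\<^sub>R c" for w l
  proof -
    have "\<bar>l\<bar> * norm c = 1" using w by simp
    then have "\<bar>l\<bar> = 1 / norm c" using assms by (simp add: field_simps)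
    then have "l = 1 / norm c \<or> l = - (1 / norm c)" by linarith
    then show ?thesis using w(2) by (metis scaleR_minus_left)
  qed
  moreover have "norm ((1 / norm c) *\<^sub>R c) = 1" "norm (- ((1 / norm c) *\<^sub>R c)) = 1" using assms by simp_all
  moreover have "- ((1 / norm c) *\<^sub>R c) = (- (1 / norm c)) *\<^sub>R c" by simp
  ultimately show ?thesis by blast
qed

context generic_config
begin

lemma maximizers_scale: "c > 0 \<Longrightarrow> X (c *\<^sub>R w) = X w"
  by (simp add: maximizers_def)

lemma pt_insert: "finite S \<Longrightarrow> i \<notin> S \<Longrightarrow> pt (insert i S, t) - pt (S, t) = v i"
  by (simp add: vpoint_def)

text \<open>Two non-parallel differences make the face two-dimensional, hence a facet, and a vector
  orthogonal to its normal lies in its direction space.\<close>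

lemma two_directions_facet:
  assumes w: "w \<noteq> 0" and x: "x \<in> X w" "x' \<in> X w" "y \<in> X w" "y' \<in> X w"
    and c: "cross3 (pt x' - pt x) (pt y' - pt y) \<noteq> 0"
    and u: "w \<bullet> u = 0"
  shows "face w facet_of body'" "plane_orth_facet u (face w)"
proof -
  have inF: "pt z \<in> face w" if "z \<in> X w" for z using that by (intro hull_inc) auto
  have "aff_dim (face w) < 3"
    using face_of_aff_dim_lt[OF compact_convex_body(2) face_is_face face_proper(1)[OF w]] aff_dim_body by simp
  moreover have "\<not> aff_dim (face w) \<le> 1"
  proof
    assume "aff_dim (face w) \<le> 1"
    then have "collinear (face w)" by (simp add: collinear_aff_dim)
    then obtain d where d: "\<And>x y. x \<in> face w \<Longrightarrow> y \<in> face w \<Longrightarrow> \<exists>k. x - y = k *\<^sub>R d"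
      unfolding collinear_def by blast
    obtain k where k: "pt x' - pt x = k *\<^sub>R d" using d inF x by blast
    obtain k' where k': "pt y' - pt y = k' *\<^sub>R d" using d inF x by blast
    show False using c unfolding k k' by (simp add: cross_mult_left cross_mult_right)
  qed
  ultimately have "aff_dim (face w) = 2" by linarith
  then show "face w facet_of body'"
    unfolding facet_of_def using face_is_face face_proper(2)[OF w] aff_dim_body by simp
  have o: "w \<bullet> (pt z - pt z') = 0" if "z \<in> X w" "z' \<in> X w" for z z'
    using that unfolding maximizers_def by (force simp: inner_diff_right intro: antisym)
  show "plane_orth_facet u (face w)"
    unfolding plane_orth_facet_def
    by (rule in_span_orthogonal_pair[OF c w o[OF x(2,1)] o[OF x(4,3)] u]) (use inF x in blast)+
qed

end

locale generic_projection = generic_config +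
  fixes u :: "real^3"
  assumes u_nonzero: "u \<noteq> 0"
    and not_orthogonal: "\<And>F. F facet_of body v n V \<Longrightarrow> \<not> plane_orth_facet u F"
begin

text \<open>With equality in \<open>small_face\<close> the face would contain two non-parallel edges
  and be a facet whose directions include \<open>u\<close>, which the choice of \<open>u\<close>
  excludes.\<close>

lemma tiny_face:
  assumes w: "w \<noteq> 0" "w \<bullet> u = 0"
  shows "card (Z w) + card (M w) \<le> 2"
proof (rule ccontr)
  assume "\<not> ?thesis"
  then have "card (Z w) + card (M w) = 3" using small_face[OF w(1)] by linarith
  then consider "card (Z w) = 0" "card (M w) = 3" | "card (Z w) = 1" "card (M w) = 2"
    | "card (Z w) = 2" "card (M w) = 1" using card_M_pos[of w] by linarith
  then have "\<exists>x\<in>X w. \<exists>x'\<in>X w. \<exists>y\<in>X w. \<exists>y'\<in>X w. cross3 (pt x' - pt x) (pt y' - pt y) \<noteq> 0"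
  proof cases
    case 1
    then obtain t t' t'' where t: "M w = {t, t', t''}" "t \<noteq> t'" "t \<noteq> t''" "t' \<noteq> t''"
      by (auto simp: card_3_iff)
    have inX: "(Pos w, t) \<in> X w" "(Pos w, t') \<in> X w" "(Pos w, t'') \<in> X w" using t by (auto simp: X_eq)
    have "t \<in> V" "t' \<in> V" "t'' \<in> V" using t M_subset[of w] by auto
    then have "cross3 (pt (Pos w, t') - pt (Pos w, t)) (pt (Pos w, t'') - pt (Pos w, t)) \<noteq> 0"
      using cross_tt[of t t' t''] t by (simp add: vpoint_def)
    then show ?thesis using inX by blast
  next
    case 2
    then obtain i t t' where i: "Z w = {i}" and t: "M w = {t, t'}" "t \<noteq> t'"
      by (auto simp: card_2_iff card_1_singleton_iff)
    have "i \<in> Z w" using i by simp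
    then have i': "i < n" "i \<notin> Pos w" "finite (Pos w)" by (auto simp: zeros_def positives_def)
    have inX: "(Pos w, t) \<in> X w" "(Pos w, t') \<in> X w" "(insert i (Pos w), t) \<in> X w" using t i by (auto simp: X_eq)
    have "t \<in> V" "t' \<in> V" using t M_subset[of w] by auto
    then have "cross3 (v i) (t' - t) \<noteq> 0" using cross_vt[of i t' t] t i' by simp
    then have "cross3 (pt (insert i (Pos w), t) - pt (Pos w, t)) (pt (Pos w, t') - pt (Pos w, t)) \<noteq> 0"
      using pt_insert[of "Pos w" i t] i' by (simp add: vpoint_def)
    then show ?thesis using inX by blast
  next
    case 3
    then obtain i j t where i: "Z w = {i, j}" "i \<noteq> j" and t: "M w = {t}"
      by (auto simp: card_2_iff card_1_singleton_iff)
    have "i \<in> Z w" "j \<in> Z w" using i by auto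
    then have i': "i < n" "i \<notin> Pos w" "j < n" "j \<notin> Pos w" "finite (Pos w)" by (auto simp: zeros_def positives_def)
    have inX: "(Pos w, t) \<in> X w" "(insert i (Pos w), t) \<in> X w" "(insert j (Pos w), t) \<in> X w"
      using t i by (auto simp: X_eq)
    have "cross3 (pt (insert i (Pos w), t) - pt (Pos w, t)) (pt (insert j (Pos w), t) - pt (Pos w, t)) \<noteq> 0"
      using pt_insert[of "Pos w" i t] pt_insert[of "Pos w" j t] i' cross_vv[of i j] i by simp
    then show ?thesis using inX by blast
  qed
  then obtain x x' y y' where *: "x \<in> X w" "x' \<in> X w" "y \<in> X w" "y' \<in> X w"
    "cross3 (pt x' - pt x) (pt y' - pt y) \<noteq> 0" by blast
  show False using two_directions_facet[OF w(1) * w(2)] not_orthogonal by blast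
qed

lemma card_X_le_2: "w \<noteq> 0 \<Longrightarrow> w \<bullet> u = 0 \<Longrightarrow> card (X w) \<le> 2"
proof -
  assume w: "w \<noteq> 0" "w \<bullet> u = 0"
  have "card (Z w) = 0 \<and> card (M w) \<le> 2 \<or> card (Z w) = 1 \<and> card (M w) \<le> 1"
    using tiny_face[OF w] card_M_pos[of w] by linarith
  then show ?thesis unfolding card_X by auto
qed

lemma orthogonal_to_u_of_parallel:
  assumes "cross3 u d = 0" "w \<bullet> d = 0" "d \<noteq> 0"
  shows "w \<bullet> u = 0"
proof -
  have "(d \<bullet> d) *\<^sub>R u = (u \<bullet> d) *\<^sub>R d"
    using cross3_cross3[of u d d] assms(1) by simp
  then have "(d \<bullet> d) * (w \<bullet> u) = (u \<bullet> d) * (w \<bullet> d)" by (metis inner_scaleR_right)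
  then show ?thesis using assms by simp
qed

text \<open>If \<open>v i\<close> were parallel to \<open>u\<close>, the normal of
  \<open>v i\<close> and \<open>v k\<close> would be orthogonal to \<open>u\<close> and have two
  zeros, against \<open>tiny_face\<close>.\<close>

lemma cross_u_v: assumes "i < n" shows "cross3 u (v i) \<noteq> 0"
proof
  assume c: "cross3 u (v i) = 0"
  have "\<not> {0,1,2} \<subseteq> {i}" by auto
  then obtain k where k: "k < n" "k \<noteq> i" using n_ge_3 by fastforce
  let ?w = "cross3 (v i) (v k)"
  have w0: "?w \<noteq> 0" using cross_vv[of i k] k assms by auto
  have o: "?w \<bullet> v i = 0" "?w \<bullet> v k = 0" by (auto simp: dot_cross_self inner_commute)
  have "v i \<noteq> 0" using w0 by auto
  then have wu: "?w \<bullet> u = 0" using orthogonal_to_u_of_parallel[OF c o(1)] by simp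
  have "{i, k} \<subseteq> Z ?w" using o assms k by (auto simp: zeros_def)
  then have "card {i, k} \<le> card (Z ?w)" by (intro card_mono) auto
  then show False using tiny_face[OF w0 wu] card_M_pos[of ?w] k by simp
qed

lemma cross_u_t: assumes t: "t \<in> V" "t' \<in> V" "t \<noteq> t'" shows "cross3 u (t - t') \<noteq> 0"
proof
  assume c: "cross3 u (t - t') = 0"
  have i: "0 < n" using n_ge_3 by simp
  define s where "s = cross3 (v 0) (t - t')"
  have s0: "s \<noteq> 0" using cross_vt[OF i t] by (simp add: s_def)
  have o: "s \<bullet> v 0 = 0" "s \<bullet> (t - t') = 0" by (auto simp: s_def dot_cross_self inner_commute)
  have su: "s \<bullet> u = 0" using orthogonal_to_u_of_parallel[OF c o(2)] t by simp
  have "card (V - {t, t'}) \<le> 1" using card_V t finite_V by (simp add: card_Diff_subset)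
  then obtain r where r: "V - {t, t'} \<subseteq> {r}"
    by (metis card_1_singletonE card_eq_0_iff finite_Diff finite_V empty_subsetI le_antisym less_one
        not_less order_refl)
  \<comment> \<open>The sign is chosen so that the possible remaining point \<open>r\<close> of
    \<open>V\<close> is not above \<open>t\<close> and \<open>t'\<close>, which are then both top
    points.\<close>
  define w where "w = (if s \<bullet> r \<le> s \<bullet> t then s else - s)"
  have w: "w \<noteq> 0" "w \<bullet> u = 0" "w \<bullet> v 0 = 0" "w \<bullet> t = w \<bullet> t'" "w \<bullet> r \<le> w \<bullet> t"
    using s0 su o by (auto simp: w_def inner_diff_right)
  have "w \<bullet> x \<le> w \<bullet> t" if "x \<in> V" for x using that r w by (cases "x = t"; cases "x = t'") auto
  then have "{t, t'} \<subseteq> M w" using t w by (auto simp: top_points_def)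
  then have "card {t, t'} \<le> card (M w)" by (intro card_mono) auto
  moreover have "0 \<in> Z w" using w i by (simp add: zeros_def)
  then have "Z w \<noteq> {}" by auto
  then have "card (Z w) > 0" by (simp add: card_gt_0_iff)
  ultimately show False using tiny_face[OF w(1,2)] t by simp
qed

text \<open>The two points differ by a generator, up to sign, or by a difference of points of
  \<open>V\<close>, and neither is parallel to \<open>u\<close>. So the projection collapses no such
  edge.\<close>

lemma edge_not_parallel:
  assumes w: "w \<noteq> 0" "w \<bullet> u = 0" and x: "x \<in> X w" "y \<in> X w" "x \<noteq> y"
  shows "cross3 u (pt x - pt y) \<noteq> 0"
proof -
  have "card (Z w) = 0 \<and> card (M w) \<le> 2 \<or> card (Z w) = 1 \<and> card (M w) = 1"
    using tiny_face[OF w] card_M_pos[of w] by linarith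
  then consider "Z w = {}" | i t where "Z w = {i}" "M w = {t}"
    by (auto simp: card_1_singleton_iff)
  then show ?thesis
  proof cases
    case 1
    then have *: "fst x = Pos w" "fst y = Pos w" "snd x \<in> V" "snd y \<in> V"
      using x M_subset[of w] by (auto simp: X_eq)
    then have "snd x \<noteq> snd y" using x by (auto simp: prod_eq_iff)
    moreover have "pt x - pt y = snd x - snd y" using * by (simp add: vpoint_def)
    ultimately show ?thesis using cross_u_t * by simp
  next
    case 2
    have "i \<in> Z w" using 2 by simp
    then have i: "i < n" "i \<notin> Pos w" "finite (Pos w)" by (auto simp: zeros_def positives_def)
    have "{S. Pos w \<subseteq> S \<and> S \<subseteq> Pos w \<union> {i}} = {Pos w, insert i (Pos w)}" by auto
    then have "X w = {(Pos w, t), (insert i (Pos w), t)}" unfolding X_eq 2 by auto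
    then have "x = (Pos w, t) \<and> y = (insert i (Pos w), t) \<or> y = (Pos w, t) \<and> x = (insert i (Pos w), t)"
      using x by auto
    then have "pt x - pt y = v i \<or> pt x - pt y = - v i"
      using pt_insert[of "Pos w" i t] i by (metis minus_diff_eq)
    then show ?thesis using cross_u_v[OF i(1)] by auto
  qed
qed

abbreviation "pr \<equiv> proj_plane u"

text \<open>A functional orthogonal to \<open>u\<close> has the same value at a point and at its
  projection, so these codes describe the vertices of the projected polygon without leaving
  space.\<close>

definition shadow_vertices :: "(nat set \<times> (real^3)) set" where
  "shadow_vertices = {x. \<exists>w. w \<noteq> 0 \<and> w \<bullet> u = 0 \<and> X w = {x}}"

lemma linear_pr: "linear pr"
proof (rule linearI)
  fix x y :: "real^3" and c :: real
  have "((x + y) \<bullet> u) / (u \<bullet> u) = (x \<bullet> u) / (u \<bullet> u) + (y \<bullet> u) / (u \<bullet> u)"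
    by (simp add: inner_add_left add_divide_distrib)
  then show "proj_plane u (x + y) = proj_plane u x + proj_plane u y"
    unfolding proj_plane_def by (simp only: scaleR_add_left) simp
  have "((c *\<^sub>R x) \<bullet> u) / (u \<bullet> u) = c * ((x \<bullet> u) / (u \<bullet> u))" by simp
  then show "proj_plane u (c *\<^sub>R x) = c *\<^sub>R proj_plane u x"
    unfolding proj_plane_def by (simp only: scaleR_diff_right scaleR_scaleR)
qed

lemma inner_pr: "w \<bullet> u = 0 \<Longrightarrow> w \<bullet> pr x = w \<bullet> x"
  by (simp add: proj_plane_def inner_diff_right)

lemma pr_orthogonal: "pr x \<bullet> u = 0"
  using u_nonzero by (simp add: proj_plane_def inner_diff_left)

lemma pr_eq_0_imp_cross: "pr x = 0 \<Longrightarrow> cross3 u x = 0"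
proof -
  assume "pr x = 0"
  then have "x = ((x \<bullet> u) / (u \<bullet> u)) *\<^sub>R u" by (simp add: proj_plane_def)
  then show ?thesis by (metis cross_mult_right cross_refl scale_zero_right)
qed

lemma shadow_eq: "pr ` body' = convex hull (pr ` pt ` index_set n V)"
  unfolding body_def using convex_hull_linear_image[OF linear_pr] by simp

lemma shadow_vertices_subset: "shadow_vertices \<subseteq> index_set n V"
proof
  fix x assume "x \<in> shadow_vertices"
  then obtain w where "X w = {x}" unfolding shadow_vertices_def by blast
  then show "x \<in> index_set n V" using maximizers_subset[of v n V w] by simp
qed

lemma inj_on_shadow: "inj_on (\<lambda>x. pr (pt x)) shadow_vertices"
proof (rule inj_onI)
  fix x y assume x: "x \<in> shadow_vertices" and y: "y \<in> shadow_vertices" and eq: "pr (pt x) = pr (pt y)"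
  obtain w where w: "w \<bullet> u = 0" "X w = {x}" using x unfolding shadow_vertices_def by blast
  then have "w \<bullet> pt x = w \<bullet> pt y" using inner_pr[OF w(1)] eq by metis
  moreover have "x \<in> X w" using w by simp
  ultimately have "y \<in> X w" using subsetD[OF shadow_vertices_subset y] by (simp add: maximizers_def)
  then show "x = y" using w by simp
qed

lemma extreme_points_shadow:
  "{y. y extreme_point_of (pr ` body')} = (\<lambda>x. pr (pt x)) ` shadow_vertices"
proof
  let ?Q = "pr ` pt ` index_set n V"
  have fQ: "finite ?Q" using finite_index_set[OF finite_V] by auto
  show "(\<lambda>x. pr (pt x)) ` shadow_vertices \<subseteq> {y. y extreme_point_of (pr ` body')}"
  proof clarify
    fix S t assume "(S, t) \<in> shadow_vertices"
    then obtain w where w: "w \<bullet> u = 0" "X w = {(S, t)}" unfolding shadow_vertices_def by blast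
    let ?x = "(S, t)"
    have xX: "?x \<in> X w" using w by simp
    have le: "w \<bullet> a \<le> w \<bullet> pt ?x" if "a \<in> ?Q" for a
      using that xX inner_pr[OF w(1)] by (auto simp: maximizers_def)
    have "{a \<in> ?Q. w \<bullet> a = w \<bullet> pt ?x} = {pr (pt ?x)}"
    proof
      show "{a \<in> ?Q. w \<bullet> a = w \<bullet> pt ?x} \<subseteq> {pr (pt ?x)}"
      proof clarify
        fix y assume y: "y \<in> index_set n V" "w \<bullet> pr (pt y) = w \<bullet> pt ?x"
        then have "y \<in> X w" using xX inner_pr[OF w(1)] by (simp add: maximizers_def)
        then show "pr (pt y) = pr (pt ?x)" using w by simp
      qed
      show "{pr (pt ?x)} \<subseteq> {a \<in> ?Q. w \<bullet> a = w \<bullet> pt ?x}"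
        using xX inner_pr[OF w(1)] by (auto simp: maximizers_def)
    qed
    then have "convex hull ?Q \<inter> {y. w \<bullet> y = w \<bullet> pt ?x} = {pr (pt ?x)}"
      using convex_hull_Int_supporting_hyperplane(1)[OF fQ le] by simp
    moreover have "convex hull ?Q \<inter> {y. w \<bullet> y = w \<bullet> pt ?x} face_of convex hull ?Q"
      using convex_hull_Int_supporting_hyperplane(2)[OF fQ le]
      by (intro face_of_Int_supporting_hyperplane_le) auto
    ultimately show "pr (pt ?x) extreme_point_of (pr ` body')"
      unfolding shadow_eq by (simp add: face_of_singleton)
  qed
  show "{y. y extreme_point_of (pr ` body')} \<subseteq> (\<lambda>x. pr (pt x)) ` shadow_vertices"
  proof clarify
    fix y assume y: "y extreme_point_of (pr ` body')"
    then have "y \<in> ?Q" unfolding shadow_eq by (rule extreme_point_of_convex_hull)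
    then obtain x where x: "x \<in> index_set n V" "y = pr (pt x)" by blast
    have "{y} face_of convex hull ?Q" using y unfolding shadow_eq by (simp add: face_of_singleton)
    moreover have "polyhedron (convex hull ?Q)"
      using polytope_imp_polyhedron[OF polytope_convex_hull[OF fQ]] .
    ultimately have "{y} exposed_face_of convex hull ?Q" using exposed_face_of_polyhedron by blast
    then obtain a b where ab: "convex hull ?Q \<subseteq> {x. a \<bullet> x \<le> b}" "{y} = convex hull ?Q \<inter> {x. a \<bullet> x = b}"
      unfolding exposed_face_of_def by blast
    \<comment> \<open>Projecting the exposing functional keeps its values on the projected polygon
      and makes it orthogonal to \<open>u\<close>.\<close>
    define w where "w = pr a"
    have wu: "w \<bullet> u = 0" using pr_orthogonal by (simp add: w_def)
    have wa: "w \<bullet> pt z = a \<bullet> pr (pt z)" for z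
    proof -
      have "w \<bullet> pt z = w \<bullet> pr (pt z)" using inner_pr[OF wu] by simp
      also have "\<dots> = pr (pt z) \<bullet> pr a" by (simp add: w_def inner_commute)
      also have "\<dots> = a \<bullet> pr (pt z)" using inner_pr[OF pr_orthogonal[of "pt z"], of a] by (metis inner_commute)
      finally show ?thesis .
    qed
    have inQ: "pr (pt z) \<in> convex hull ?Q" if "z \<in> index_set n V" for z
      using that by (intro hull_inc) auto
    have le: "w \<bullet> pt z \<le> b" if "z \<in> index_set n V" for z
      using inQ[OF that] ab(1) unfolding wa by blast
    have eqy: "pr (pt z) = y" if "z \<in> index_set n V" "w \<bullet> pt z = b" for z
      using inQ[OF that(1)] ab(2) that(2) unfolding wa by blast
    have xb: "w \<bullet> pt x = b" using ab(2) x(2) unfolding wa by blast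
    \<comment> \<open>If \<open>w\<close> vanished, all codes would project to the single point
      \<open>y\<close>, although \<open>v 0\<close> is not parallel to \<open>u\<close>.\<close>
    have w0: "w \<noteq> 0"
    proof
      assume w: "w = 0"
      then have b0: "b = 0" using xb by simp
      obtain t where t: "t \<in> V" using V_nonempty by blast
      have "({}, t) \<in> index_set n V" "({0}, t) \<in> index_set n V" using t n_ge_3 by (auto simp: index_set_def)
      then have "pr (pt ({0}, t)) = pr (pt ({}, t))" using eqy w b0 by simp
      then have "pr (pt ({0}, t) - pt ({}, t)) = 0" using linear_diff[OF linear_pr] by simp
      then have "pr (v 0) = 0" using pt_insert[of "{}" 0 t] by simp
      then show False using pr_eq_0_imp_cross cross_u_v[of 0] n_ge_3 by auto
    qed
    have xX: "x \<in> X w" using x(1) le xb by (simp add: maximizers_def)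
    \<comment> \<open>Two maximizers would have the same projection, so their difference would be
      parallel to \<open>u\<close>.\<close>
    have "z = x" if z: "z \<in> X w" for z
    proof (rule ccontr)
      assume "z \<noteq> x"
      have zi: "z \<in> index_set n V" using z maximizers_subset by blast
      have "w \<bullet> pt x \<le> w \<bullet> pt z" using z x(1) by (simp add: maximizers_def)
      then have "w \<bullet> pt z = b" using le[OF zi] xb by simp
      then have "pr (pt z) = pr (pt x)" using eqy[OF zi] x(2) by simp
      then have "pr (pt z - pt x) = 0" using linear_diff[OF linear_pr] by simp
      then show False using pr_eq_0_imp_cross edge_not_parallel[OF w0 wu z xX \<open>z \<noteq> x\<close>] by blast
    qed
    then have "X w = {x}" using xX by blast
    then show "y \<in> (\<lambda>x. pr (pt x)) ` shadow_vertices"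
      using x(2) w0 wu unfolding shadow_vertices_def by blast
  qed
qed

end

section \<open>Counting cells and building a separated family\<close>

lemma super_generic_pencil:
  assumes g: "super_generic V v n" and idx: "a < n" "b < n" "b' < n" "c < n" "d < n"
    and dist: "distinct [a, b, b']" "distinct [a, c, d]"
    and z: "z \<bullet> cross3 (v a) (v b) = 0" "z \<bullet> cross3 (v a) (v b') = 0" "z \<bullet> cross3 (v c) (v d) = 0"
  shows "z = 0"
proof -
  let ?k = "v b \<bullet> cross3 (v a) (v b')"
  have "triple (v a) (v b') (v b) \<noteq> 0" using super_generic_vvv[OF g, of a b' b] idx dist by auto
  then have k: "?k \<noteq> 0" by (simp add: triple_def inner_commute)
  \<comment> \<open>The first two planes share \<open>v a\<close>, so they meet in its line, and
    that line is not in the plane of \<open>v c\<close> and \<open>v d\<close>.\<close>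
  have cr: "cross3 (cross3 (v a) (v b)) (cross3 (v a) (v b')) = (- ?k) *\<^sub>R v a"
    using cross3_cross3[of "v a" "v b" "cross3 (v a) (v b')"] by (simp add: dot_cross_self)
  have "cross3 (cross3 (v a) (v b)) (cross3 (v a) (v b')) \<noteq> 0"
    unfolding cr using k super_generic_nonzero[OF g idx(1)] by simp
  then obtain l where l: "z = l *\<^sub>R cross3 (cross3 (v a) (v b)) (cross3 (v a) (v b'))"
    by (rule orthogonal_two_parallel[OF _ z(1,2)])
  have "triple (v c) (v d) (v a) \<noteq> 0" using super_generic_vvv[OF g, of c d a] idx dist by auto
  then have "v a \<bullet> cross3 (v c) (v d) \<noteq> 0" by (simp add: triple_def inner_commute)
  moreover have "(l * (- ?k)) * (v a \<bullet> cross3 (v c) (v d)) = 0" using z(3) unfolding l cr by simp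
  ultimately have "l = 0" using k by simp
  then show ?thesis using l by simp
qed

text \<open>The first two pairs may share an index in one position, and then their planes form a
  pencil through a generator, or in none, and then \<open>super_generic_lines\<close>
  applies.\<close>

lemma super_generic_three_lines:
  assumes g: "super_generic V v n" and idx: "a < n" "b < n" "a' < n" "b' < n" "c < n" "d < n"
    and ne: "(a, b) \<noteq> (a', b')" and disj: "{a, a'} \<inter> {b, b'} = {}" "{a, a', b, b'} \<inter> {c, d} = {}" "c \<noteq> d"
    and z: "z \<bullet> cross3 (v a) (v b) = 0" "z \<bullet> cross3 (v a') (v b') = 0" "z \<bullet> cross3 (v c) (v d) = 0"
  shows "z = 0"
proof -
  have sk: "z \<bullet> cross3 y x = 0" if "z \<bullet> cross3 x y = 0" for x y
    using cross_skew[of x y] that by simp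
  consider "a = a'" "b \<noteq> b'" | "a \<noteq> a'" "b = b'" | "a \<noteq> a'" "b \<noteq> b'" using ne by auto
  then show ?thesis
  proof cases
    case 1
    show ?thesis
      by (rule super_generic_pencil[OF g idx(1,2,4,5,6)]) (use 1 disj z in auto)
  next
    case 2
    show ?thesis
      by (rule super_generic_pencil[OF g idx(2,1,3,5,6)]) (use 2 disj z sk in auto)
  next
    case 3
    show ?thesis
      by (rule super_generic_lines[OF g idx(1,2,3,4,5,6) _ z]) (use 3 disj in auto)
  qed
qed

text \<open>A quadruple of indices names the line in which the planes of its two pairs meet, and
  different quadruples name different lines, so \<open>separated_cells\<close> provides one vector
  for each. The \<open>max 1\<close> covers \<open>n < 4\<close>, where a single generic vector is
  chosen.\<close>

lemma super_generic_cells: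
  assumes g: "super_generic V v n" and V: "finite V"
    and Vt: "\<And>t t' t''. \<lbrakk>t \<in> V; t' \<in> V; t'' \<in> V; distinct [t, t', t'']\<rbrakk> \<Longrightarrow> cross3 (t' - t) (t'' - t) \<noteq> 0"
  shows "\<exists>Q. finite Q \<and> card Q = max 1 ((n div 4) ^ 4) \<and>
    (\<forall>q\<in>Q. super_generic V (v(n := q)) (Suc n)) \<and>
    (\<forall>q\<in>Q. \<forall>q'\<in>Q. q \<noteq> q' \<longrightarrow> (\<exists>i<n. \<exists>j<n. i \<noteq> j \<and> triple (v i) (v j) q * triple (v i) (v j) q' < 0))"
proof -
  obtain A where A: "finite A" "0 \<notin> A" "\<And>i j. \<lbrakk>i < n; j < n; i \<noteq> j\<rbrakk> \<Longrightarrow> cross3 (v i) (v j) \<in> A"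
    "\<And>q. (\<forall>x\<in>A. q \<bullet> x \<noteq> 0) \<Longrightarrow> super_generic V (v(n := q)) (Suc n)"
    by (rule super_generic_extension[OF g V Vt]) blast+
  define m where "m = n div 4"
  show ?thesis
  proof (cases "m = 0")
    case True
    obtain q where "\<forall>x\<in>A. q \<bullet> x \<noteq> 0" using avoid_hyperplanes[OF A(1,2)] by blast
    then show ?thesis using A(4)[of q] True by (intro exI[of _ "{q}"]) (auto simp: m_def)
  next
    case False
    define \<N> where "\<N> = (\<lambda>(i,j). cross3 (v i) (v j)) ` {(i,j) \<in> {..<n} \<times> {..<n}. i \<noteq> j}"
    have fN: "finite \<N>" unfolding \<N>_def
      by (rule finite_imageI, rule rev_finite_subset[of "{..<n} \<times> {..<n}"]) auto
    have inN: "cross3 (v i) (v j) \<in> \<N>" if "i < n" "j < n" "i \<noteq> j" for i j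
      unfolding \<N>_def using that by (intro image_eqI[of _ _ "(i,j)"]) auto
    have NA: "\<N> \<subseteq> A" unfolding \<N>_def using A(3) by auto
    \<comment> \<open>Each of the four positions has its own block of \<open>m\<close> indices. So
      the indices of a line are distinct, and different quadruples share indices only in the same
      position.\<close>
    define I where "I = {..<m} \<times> {..<m} \<times> {..<m} \<times> {..<m}"
    define N1 where "N1 = (\<lambda>x::nat\<times>nat\<times>nat\<times>nat. cross3 (v (fst x)) (v (m + fst (snd x))))"
    define N2 where "N2 = (\<lambda>x::nat\<times>nat\<times>nat\<times>nat. cross3 (v (2 * m + fst (snd (snd x)))) (v (3 * m + snd (snd (snd x)))))"
    have m4: "4 * m \<le> n" by (simp add: m_def)
    have b: "a < n" "m + b < n" "2 * m + c < n" "3 * m + d < n" "a < m" "b < m" "c < m" "d < m"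
      if "(a,b,c,d) \<in> I" for a b c d
      using that m4 by (auto simp: I_def)
    have 1: "N1 x \<in> \<N>" "N2 x \<in> \<N>" if "x \<in> I" for x
    proof -
      obtain a b c d where x: "x = (a,b,c,d)" by (metis surj_pair)
      show "N1 x \<in> \<N>" "N2 x \<in> \<N>" using b[of a b c d] that unfolding x N1_def N2_def
        by (auto intro!: inN)
    qed
    have 2: "cross3 (N1 x) (N2 x) \<noteq> 0" if "x \<in> I" for x
    proof -
      obtain a b c d where x: "x = (a,b,c,d)" by (metis surj_pair)
      show ?thesis unfolding x N1_def N2_def fst_conv snd_conv
        by (rule super_generic_line_direction[OF g]) (use b[of a b c d] that x in auto)
    qed
    have 3: "z = 0" if xI: "x \<in> I" and yI: "y \<in> I" and ne: "x \<noteq> y"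
      and z: "z \<bullet> N1 x = 0" "z \<bullet> N2 x = 0" "z \<bullet> N1 y = 0" "z \<bullet> N2 y = 0" for x y z
    proof -
      obtain a b c d where x: "x = (a,b,c,d)" by (metis surj_pair)
      obtain a' b' c' d' where y: "y = (a',b',c',d')" by (metis surj_pair)
      note bx = b[OF xI[unfolded x]] and by' = b[OF yI[unfolded y]]
      have z': "z \<bullet> cross3 (v a) (v (m + b)) = 0" "z \<bullet> cross3 (v (2*m + c)) (v (3*m + d)) = 0"
        "z \<bullet> cross3 (v a') (v (m + b')) = 0" "z \<bullet> cross3 (v (2*m + c')) (v (3*m + d')) = 0"
        using z unfolding x y N1_def N2_def by auto
      consider "(a, b) \<noteq> (a', b')" | "(c, d) \<noteq> (c', d')" using ne x y by auto
      then show ?thesis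
      proof cases
        case 1
        show ?thesis
          by (rule super_generic_three_lines[OF g bx(1,2) by'(1,2) bx(3,4) _ _ _ _ z'(1,3,2)])
            (use 1 bx by' in auto)
      next
        case 2
        show ?thesis
          by (rule super_generic_three_lines[OF g bx(3,4) by'(3,4) bx(1,2) _ _ _ _ z'(2,4,1)])
            (use 2 bx by' in auto)
      qed
    qed
    have fI: "finite I" by (simp add: I_def)
    obtain q where q: "\<And>i x. i \<in> I \<Longrightarrow> x \<in> A \<Longrightarrow> q i \<bullet> x \<noteq> 0"
      "\<And>i j. \<lbrakk>i \<in> I; j \<in> I; i \<noteq> j\<rbrakk> \<Longrightarrow> \<exists>N\<in>\<N>. (N \<bullet> q i) * (N \<bullet> q j) < 0"
      by (rule separated_cells[OF fI fN A(1,2) NA 1 2 3]) blast+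
    have "inj_on q I"
    proof (rule inj_onI, rule ccontr)
      fix x y assume *: "x \<in> I" "y \<in> I" "q x = q y" "x \<noteq> y"
      obtain N where "N \<in> \<N>" "(N \<bullet> q x) * (N \<bullet> q y) < 0" using q(2)[OF *(1,2,4)] by blast
      then show False using *(3) by (simp add: mult_less_0_iff)
    qed
    then have "card (q ` I) = m ^ 4" by (simp add: card_image I_def card_cartesian_product power4_eq_xxxx)
    moreover have "max 1 ((n div 4) ^ 4) = m ^ 4" using False by (simp add: m_def max_def)
    moreover have "\<exists>i<n. \<exists>j<n. i \<noteq> j \<and> triple (v i) (v j) u * triple (v i) (v j) u' < 0"
      if uu: "u \<in> q ` I" "u' \<in> q ` I" "u \<noteq> u'" for u u'
    proof -
      obtain x y where xy: "x \<in> I" "y \<in> I" "u = q x" "u' = q y" "x \<noteq> y" using uu by blast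
      then obtain N where "N \<in> \<N>" "(N \<bullet> u) * (N \<bullet> u') < 0" using q(2)[OF xy(1,2,5)] by blast
      then show ?thesis unfolding \<N>_def triple_def by auto
    qed
    moreover have "super_generic V (v(n := u)) (Suc n)" if "u \<in> q ` I" for u
      using that q(1) by (intro A(4)) auto
    ultimately show ?thesis using fI by (intro exI[of _ "q ` I"]) auto
  qed
qed

text \<open>The witness refers only to indices below \<open>n\<close>, so it survives later
  extensions; the three common vectors are what \<open>sign_vectors_separated\<close> asks
  for.\<close>

definition separated :: "nat \<Rightarrow> (nat \<Rightarrow> real^3) \<Rightarrow> (nat \<Rightarrow> real^3) \<Rightarrow> bool" where
  "separated n v v' \<longleftrightarrow> (\<exists>q<n. \<exists>r<n. \<exists>s<n. \<exists>p<n. q \<noteq> r \<and> s \<noteq> q \<and> s \<noteq> r \<and>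
     v q = v' q \<and> v r = v' r \<and> v s = v' s \<and>
     triple (v q) (v r) (v p) * triple (v q) (v r) (v' p) < 0)"

lemma separated_update:
  assumes "separated n v v'"
  shows "separated (Suc n) (v(n := x)) (v'(n := x'))"
proof -
  obtain q r s p where *: "q < n" "r < n" "s < n" "p < n" "q \<noteq> r" "s \<noteq> q" "s \<noteq> r"
     "v q = v' q" "v r = v' r" "v s = v' s" "triple (v q) (v r) (v p) * triple (v q) (v r) (v' p) < 0"
    using assms unfolding separated_def by blast
  show ?thesis unfolding separated_def
    by (rule exI[of _ q], rule conjI, use * in simp, rule exI[of _ r], rule conjI, use * in simp,
        rule exI[of _ s], rule conjI, use * in simp, rule exI[of _ p]) (use * in auto)
qed

lemma separated_imp_neq: "separated n v v' \<Longrightarrow> v \<noteq> v'"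
  unfolding separated_def by (auto simp: mult_less_0_iff)

text \<open>Each member for \<open>n\<close> is extended by the vectors of its own cells. Extensions
  of different members stay separated, and different extensions of one member are separated at index
  \<open>n\<close>.\<close>

lemma separated_family:
  assumes V: "finite V"
    and Vt: "\<And>t t' t''. \<lbrakk>t \<in> V; t' \<in> V; t'' \<in> V; distinct [t, t', t'']\<rbrakk> \<Longrightarrow> cross3 (t' - t) (t'' - t) \<noteq> 0"
  shows "\<exists>F. finite F \<and> card F = (\<Prod>i<n. max 1 ((i div 4) ^ 4)) \<and> (\<forall>v\<in>F. super_generic V v n) \<and>
    (\<forall>v\<in>F. \<forall>v'\<in>F. v \<noteq> v' \<longrightarrow> separated n v v')"
proof (induction n)
  case 0
  show ?case by (rule exI[of _ "{\<lambda>_. 0}"]) (simp add: super_generic_def)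
next
  case (Suc n)
  obtain F where F0: "finite F \<and> card F = (\<Prod>i<n. max 1 ((i div 4) ^ 4)) \<and> (\<forall>v\<in>F. super_generic V v n) \<and>
    (\<forall>v\<in>F. \<forall>v'\<in>F. v \<noteq> v' \<longrightarrow> separated n v v')"
    using Suc.IH by (rule exE)
  then have F: "finite F" "card F = (\<Prod>i<n. max 1 ((i div 4) ^ 4))"
    "\<And>v. v \<in> F \<Longrightarrow> super_generic V v n" "\<And>v v'. \<lbrakk>v \<in> F; v' \<in> F; v \<noteq> v'\<rbrakk> \<Longrightarrow> separated n v v'"
    by blast+
  define P where "P = (\<lambda>v Q. finite Q \<and> card Q = max 1 ((n div 4) ^ 4) \<and>
    (\<forall>q\<in>Q. super_generic V (v(n := q)) (Suc n)) \<and>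
    (\<forall>q\<in>Q. \<forall>q'\<in>Q. q \<noteq> q' \<longrightarrow> (\<exists>i<n. \<exists>j<n. i \<noteq> j \<and> triple (v i) (v j) q * triple (v i) (v j) q' < 0)))"
  define Q where "Q v = (SOME Q. P v Q)" for v
  have PQ: "P v (Q v)" if "v \<in> F" for v
  proof -
    have "\<exists>Q. P v Q" unfolding P_def by (rule super_generic_cells[OF F(3)[OF that] V Vt])
    then show ?thesis unfolding Q_def by (rule someI_ex)
  qed
  let ?u = "\<lambda>(v, q). v(n := q)"
  let ?S = "Sigma F Q"
  have sep: "separated (Suc n) (v(n := q)) (v'(n := q'))"
    if a: "v \<in> F" "q \<in> Q v" "v' \<in> F" "q' \<in> Q v'" "(v, q) \<noteq> (v', q')" for v q v' q'
  proof (cases "v = v'")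
    case False
    then show ?thesis using separated_update F(4) a by blast
  next
    case True
    then have qq: "q \<noteq> q'" "q' \<in> Q v" using a by auto
    have P: "P v (Q v)" using PQ a by blast
    then obtain i j where ij: "i < n" "j < n" "i \<noteq> j" "triple (v i) (v j) q * triple (v i) (v j) q' < 0"
      using qq a(2) unfolding P_def by blast
    \<comment> \<open>Two different choices exist only if \<open>n div 4 \<noteq> 0\<close>, which
      leaves room for the third common index \<open>s\<close>.\<close>
    have "card {q, q'} \<le> card (Q v)" using P a(2) qq(2) unfolding P_def by (intro card_mono) auto
    then have "2 \<le> max 1 ((n div 4) ^ 4)" using qq P unfolding P_def by simp
    then have "n div 4 \<noteq> 0" by (cases "n div 4 = 0") auto
    then have "n \<ge> 4" by (metis div_less not_le)
    moreover have "\<not> {0,1,2} \<subseteq> {i, j}" by auto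
    ultimately obtain s where s: "s < n" "s \<noteq> i" "s \<noteq> j" by fastforce
    show ?thesis unfolding separated_def True
      by (rule exI[of _ i], rule conjI, use ij in simp, rule exI[of _ j], rule conjI, use ij in simp,
        rule exI[of _ s], rule conjI, use s in simp, rule exI[of _ n]) (use ij s True in auto)
  qed
  have inj: "inj_on ?u ?S"
  proof (rule inj_onI, rule ccontr)
    fix x y assume *: "x \<in> ?S" "y \<in> ?S" "?u x = ?u y" "x \<noteq> y"
    obtain v q where x: "x = (v, q)" by (metis surj_pair)
    obtain v' q' where y: "y = (v', q')" by (metis surj_pair)
    show False using separated_imp_neq[OF sep[of v q v' q']] * unfolding x y by auto
  qed
  show ?case
  proof (intro exI[of _ "?u ` ?S"] conjI)
    have fS: "finite ?S" using F(1) PQ unfolding P_def by (intro finite_SigmaI) auto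
    then show "finite (?u ` ?S)" by simp
    have "card (?u ` ?S) = (\<Sum>v\<in>F. card (Q v))"
      using card_image[OF inj] F(1) PQ unfolding P_def by (simp add: card_SigmaI)
    also have "\<dots> = (\<Sum>v\<in>F. max 1 ((n div 4) ^ 4))" using PQ unfolding P_def by (intro sum.cong) auto
    also have "\<dots> = (\<Prod>i<Suc n. max 1 ((i div 4) ^ 4))" by (simp add: F(2))
    finally show "card (?u ` ?S) = (\<Prod>i<Suc n. max 1 ((i div 4) ^ 4))" .
    show "\<forall>v\<in>?u ` ?S. super_generic V v (Suc n)" using PQ unfolding P_def by auto
    show "\<forall>v\<in>?u ` ?S. \<forall>v'\<in>?u ` ?S. v \<noteq> v' \<longrightarrow> separated (Suc n) v v'"
    proof (intro ballI impI)
      fix w w' assume "w \<in> ?u ` ?S" "w' \<in> ?u ` ?S" "w \<noteq> w'"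
      then obtain v q v' q' where "v \<in> F" "q \<in> Q v" "v' \<in> F" "q' \<in> Q v'" "w = v(n := q)" "w' = v'(n := q')"
        by auto
      then show "separated (Suc n) w w'" using sep[of v q v' q'] \<open>w \<noteq> w'\<close> by auto
    qed
  qed
qed

lemma super_generic_imp_generic_config:
  assumes "super_generic V v n" "3 \<le> n" "finite V" "V \<noteq> {}" "card V \<le> 3"
  shows "generic_config v n V"
proof
  show "triple (v i) (v j) (v k) \<noteq> 0"
    if "i < n" "j < n" "k < n" "i \<noteq> j" "i \<noteq> k" "j \<noteq> k" for i j k
    by (rule super_generic_vvv[OF assms(1)]) (use that in auto)
  show "triple (v i) (v j) (t - t') \<noteq> 0"
    if "i < n" "j < n" "i \<noteq> j" "t \<in> V" "t' \<in> V" "t \<noteq> t'" for i j t t'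
    by (rule super_generic_vvt[OF assms(1)]) (use that in auto)
  show "triple (v i) (t' - t) (t'' - t) \<noteq> 0"
    if "i < n" "t \<in> V" "t' \<in> V" "t'' \<in> V" "t \<noteq> t'" "t \<noteq> t''" "t' \<noteq> t''" for i t t' t''
    by (rule super_generic_vtt[OF assms(1)]) (use that in auto)
qed (use assms in auto)

lemma separated_sign_vectors:
  assumes "separated n v v'" "generic_config v n V" "generic_config v' n V"
  shows "fst ` vertices v n V \<noteq> fst ` vertices v' n V"
proof -
  obtain q r s p where *: "q < n" "r < n" "s < n" "p < n" "q \<noteq> r" "s \<noteq> q" "s \<noteq> r"
     "v q = v' q" "v r = v' r" "v s = v' s" "triple (v q) (v r) (v p) * triple (v q) (v r) (v' p) < 0"
    using assms(1) unfolding separated_def by blast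
  show ?thesis by (rule sign_vectors_separated[OF assms(2,3) *])
qed

section \<open>Vertices and edges of the projected polygon\<close>

context generic_projection
begin

abbreviation "rot w \<equiv> cross3 u w"

text \<open>An edge is represented by its unit outer normal, so that edges are counted as unit
  vectors in the plane orthogonal to \<open>u\<close>. The value 2 is the largest possible by
  \<open>card_X_le_2\<close>.\<close>

definition shadow_edges :: "(real^3) set" where
  "shadow_edges = {w. norm w = 1 \<and> w \<bullet> u = 0 \<and> card (X w) = 2}"

text \<open>The endpoint at which the edge with outer normal \<open>w\<close> ends when the polygon is traversed in the
  direction of rotation.\<close>

definition head :: "real^3 \<Rightarrow> nat set \<times> (real^3) \<Rightarrow> bool" where
  "head w x \<longleftrightarrow> x \<in> X w \<and> (\<exists>y\<in>X w. rot w \<bullet> pt y < rot w \<bullet> pt x)"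

lemma X_eq_inner: "x \<in> X w \<Longrightarrow> y \<in> X w \<Longrightarrow> w \<bullet> pt x = w \<bullet> pt y"
  by (auto simp: maximizers_def intro: antisym)

lemma rot_orthogonal: "rot w \<bullet> u = 0" "rot w \<bullet> w = 0" "w \<bullet> rot w = 0"
  by (auto simp: dot_cross_self inner_commute)

lemma rot_nonzero: "w \<noteq> 0 \<Longrightarrow> w \<bullet> u = 0 \<Longrightarrow> rot w \<noteq> 0"
  using norm_and_cross_eq_0[of u w] u_nonzero by (auto simp: inner_commute)

lemma shadow_edgeD:
  assumes "w \<in> shadow_edges" shows "w \<noteq> 0" "w \<bullet> u = 0"
  using assms by (auto simp: shadow_edges_def)

text \<open>Agreement on both \<open>w\<close> and \<open>rot w\<close> would leave a difference
  parallel to \<open>u\<close>, against \<open>edge_not_parallel\<close>.\<close>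

lemma rot_separates:
  assumes w: "w \<noteq> 0" "w \<bullet> u = 0" and x: "x \<in> X w" "y \<in> X w" "x \<noteq> y"
  shows "rot w \<bullet> pt x \<noteq> rot w \<bullet> pt y"
proof
  assume eq: "rot w \<bullet> pt x = rot w \<bullet> pt y"
  let ?d = "pt x - pt y"
  have d: "?d \<bullet> rot w = 0" "?d \<bullet> w = 0"
    using eq X_eq_inner[OF x(1,2)] by (simp_all add: inner_diff_left inner_diff_right inner_commute)
  have "cross3 (rot w) w = (u \<bullet> w) *\<^sub>R w - (w \<bullet> w) *\<^sub>R u"
    unfolding vec_eq_iff forall_3 by (simp add: cross3_simps)
  then have c: "cross3 (rot w) w = (- (w \<bullet> w)) *\<^sub>R u" using w(2) by (simp add: inner_commute)
  have "cross3 (rot w) w \<noteq> 0" unfolding c using w(1) u_nonzero by simp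
  then obtain l where l: "?d = l *\<^sub>R cross3 (rot w) w" by (rule orthogonal_two_parallel[OF _ d])
  have "rot ?d = 0" unfolding l c by (simp add: cross_mult_right)
  then show False using edge_not_parallel[OF w x] by simp
qed

lemma head_exists:
  assumes "w \<in> shadow_edges"
  shows "\<exists>x\<in>shadow_vertices. head w x"
proof -
  note w = shadow_edgeD[OF assms]
  have "card (X w) = 2" using assms by (simp add: shadow_edges_def)
  then obtain a b where ab: "X w = {a, b}" "a \<noteq> b" by (auto simp: card_2_iff)
  obtain x y where xy: "X w = {x, y}" "rot w \<bullet> pt y < rot w \<bullet> pt x"
  proof (cases "rot w \<bullet> pt b < rot w \<bullet> pt a")
    case True
    then show thesis using that[of a b] ab by simp
  next
    case False
    have "rot w \<bullet> pt a \<noteq> rot w \<bullet> pt b" using rot_separates[OF w, of a b] ab by simp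
    then have "rot w \<bullet> pt a < rot w \<bullet> pt b" using False by simp
    then show thesis using that[of b a] ab by auto
  qed
  \<comment> \<open>Turning the normal slightly towards \<open>rot w\<close> breaks the tie in
    favour of the end \<open>x\<close>.\<close>
  obtain \<epsilon> where e: "\<epsilon> > 0" "w \<noteq> 0 \<longrightarrow> w + \<epsilon> *\<^sub>R rot w \<noteq> 0" "X (w + \<epsilon> *\<^sub>R rot w) \<subseteq> X w"
    by (rule perturbed_maximizers[OF finite_V])
  let ?w = "w + \<epsilon> *\<^sub>R rot w"
  have inX: "x \<in> X w" "y \<in> X w" using xy by auto
  have "w \<bullet> pt x = w \<bullet> pt y" using X_eq_inner[OF inX] .
  then have lt: "?w \<bullet> pt y < ?w \<bullet> pt x" using xy(2) e(1) by (simp add: inner_add_left)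
  have "x \<in> index_set n V" using inX(1) maximizers_subset by blast
  then have "y \<notin> X ?w" using lt by (force simp: maximizers_def)
  then have "X ?w \<subseteq> {x}" using e(3) xy(1) by auto
  then have "X ?w = {x}" using X_nonempty[of v n ?w] by (metis subset_singletonD)
  moreover have "?w \<bullet> u = 0" using w rot_orthogonal by (simp add: inner_add_left)
  ultimately have "x \<in> shadow_vertices" using e(2) w unfolding shadow_vertices_def by blast
  moreover have "head w x" unfolding head_def using inX xy(2) by blast
  ultimately show ?thesis by blast
qed

lemma head_unique:
  assumes "w \<in> shadow_edges" "head w x" "head w x'"
  shows "x = x'"
proof (rule ccontr)
  assume "x \<noteq> x'"
  have "card (X w) = 2" using assms by (simp add: shadow_edges_def)
  moreover have "x \<in> X w" "x' \<in> X w" using assms by (auto simp: head_def)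
  ultimately have X: "X w = {x, x'}" using \<open>x \<noteq> x'\<close> by (auto simp: card_2_iff)
  have "rot w \<bullet> pt x' < rot w \<bullet> pt x" "rot w \<bullet> pt x < rot w \<bullet> pt x'"
    using assms(2,3) unfolding head_def X by auto
  then show False by simp
qed

text \<open>Projected along \<open>u\<close>, the edge vector ending at \<open>x\<close> is a
  positive multiple of \<open>rot w\<close>, and \<open>w'\<close> is maximal at \<open>x\<close>,
  so it cannot decrease along that vector.\<close>

lemma head_rotation_nonneg:
  assumes w: "w \<in> shadow_edges" "w' \<in> shadow_edges" and h: "head w x" "head w' x"
  shows "w' \<bullet> rot w \<ge> 0"
proof -
  note w1 = shadow_edgeD[OF w(1)] and w2 = shadow_edgeD[OF w(2)]
  obtain y where y: "x \<in> X w" "y \<in> X w" "rot w \<bullet> pt y < rot w \<bullet> pt x" using h(1) unfolding head_def by blast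
  let ?d = "pt x - pt y"
  have "y \<in> index_set n V" using y(2) maximizers_subset by blast
  then have "w' \<bullet> ?d \<ge> 0" using h(2) by (simp add: head_def maximizers_def inner_diff_right)
  moreover have "w \<bullet> ?d = 0" using X_eq_inner[OF y(1,2)] by (simp add: inner_diff_right)
  moreover have "w' \<bullet> ?d = ((w' \<bullet> w) / (w \<bullet> w)) * (w \<bullet> ?d) +
      ((w' \<bullet> rot w) / (rot w \<bullet> rot w)) * (rot w \<bullet> ?d)"
    by (subst (1) plane_coordinates[OF u_nonzero w1 w2(2)]) (simp add: inner_add_left)
  ultimately have "((w' \<bullet> rot w) / (rot w \<bullet> rot w)) * (rot w \<bullet> ?d) \<ge> 0" by simp
  moreover have "rot w \<bullet> ?d > 0" using y(3) by (simp add: inner_diff_right)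
  ultimately have "(w' \<bullet> rot w) / (rot w \<bullet> rot w) \<ge> 0" by (metis mult_neg_pos not_less)
  moreover have "rot w \<bullet> rot w > 0" using rot_nonzero[OF w1] by simp
  ultimately show ?thesis by (simp add: zero_le_divide_iff)
qed

text \<open>\<open>w' \<bullet> rot w\<close> is antisymmetric in \<open>w\<close> and
  \<open>w'\<close>, so nonnegativity both ways makes it 0 and \<open>w' = w\<close> or
  \<open>w' = - w\<close>. Opposite normals maximal at one vertex would flatten the body into a
  plane.\<close>

lemma head_injective:
  assumes w: "w \<in> shadow_edges" "w' \<in> shadow_edges" and h: "head w x" "head w' x"
  shows "w = w'"
proof -
  note w1 = shadow_edgeD[OF w(1)] and w2 = shadow_edgeD[OF w(2)]
  have "w \<bullet> rot w' = - (w' \<bullet> rot w)" by (simp add: cross3_simps)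
  then have 0: "w' \<bullet> rot w = 0"
    using head_rotation_nonneg[OF w h] head_rotation_nonneg[OF w(2,1) h(2,1)] by linarith
  have n: "norm w = 1" "norm w' = 1" using w by (auto simp: shadow_edges_def)
  have "w' = ((w' \<bullet> w) / (w \<bullet> w)) *\<^sub>R w"
    using plane_coordinates[OF u_nonzero w1 w2(2)] 0 by simp
  then obtain l where l: "w' = l *\<^sub>R w" by blast
  then have "\<bar>l\<bar> = 1" using n by simp
  moreover have "l \<noteq> -1"
  proof
    assume "l = -1"
    then have w': "w' = - w" using l by simp
    have "x \<in> X w" "x \<in> X (- w)" using h w' by (auto simp: head_def)
    then have "body' \<subseteq> {y. w \<bullet> y \<le> w \<bullet> pt x}" "body' \<subseteq> {y. - w \<bullet> y \<le> - w \<bullet> pt x}"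
      using face_eq(2) by blast+
    then have "body' \<subseteq> {y. w \<bullet> y = w \<bullet> pt x}" by fastforce
    then show False using body_not_in_hyperplane[OF w1(1)] by blast
  qed
  ultimately have "l = 1" by linarith
  then show ?thesis using l by simp
qed

text \<open>The edge preceding a shadow vertex is found by rotating its functional \<open>w\<close> until the first tie;
  in the chart \<open>r \<mapsto> r w - rot w\<close> this is the largest slope.\<close>

lemma head_surjective:
  assumes "x \<in> shadow_vertices"
  shows "\<exists>w\<in>shadow_edges. head w x"
proof -
  obtain w where w: "w \<noteq> 0" "w \<bullet> u = 0" "X w = {x}" using assms unfolding shadow_vertices_def by blast
  have xi: "x \<in> index_set n V" using assms shadow_vertices_subset by blast
  have xX: "x \<in> X w" using w by simp
  define d where "d y = pt x - pt y" for y
  have pos: "w \<bullet> d y > 0" if y: "y \<in> index_set n V - {x}" for y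
  proof -
    have "y \<notin> X w" using y w by simp
    then obtain z where "z \<in> index_set n V" "w \<bullet> pt y < w \<bullet> pt z"
      using y unfolding maximizers_def by (auto simp: not_le)
    moreover have "w \<bullet> pt z \<le> w \<bullet> pt x" using xX calculation by (simp add: maximizers_def)
    ultimately show ?thesis by (simp add: d_def inner_diff_right)
  qed
  define slope where "slope y = (rot w \<bullet> d y) / (w \<bullet> d y)" for y
  let ?I = "index_set n V - {x}"
  obtain t where t: "t \<in> V" using V_nonempty by blast
  have "({}, t) \<in> index_set n V" "({0}, t) \<in> index_set n V" using t n_ge_3 by (auto simp: index_set_def)
  then have ne: "?I \<noteq> {}" by (metis DiffI all_not_in_conv insert_not_empty prod.inject singletonD)
  have fin: "finite ?I" using finite_index_set[OF finite_V] by simp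
  define r where "r = Max (slope ` ?I)"
  have "r \<in> slope ` ?I" unfolding r_def using fin ne by (intro Max_in) auto
  then obtain y where y: "y \<in> ?I" "slope y = r" by blast
  have le: "slope z \<le> r" if "z \<in> ?I" for z unfolding r_def using fin that by (intro Max_ge) auto
  define c where "c = r *\<^sub>R w - rot w"
  have slope_mult: "rot w \<bullet> d z = slope z * (w \<bullet> d z)" if "z \<in> ?I" for z
    using pos[OF that] by (simp add: slope_def)
  have cd: "c \<bullet> d z = (r - slope z) * (w \<bullet> d z)" if "z \<in> ?I" for z
    using slope_mult[OF that] by (simp add: c_def inner_diff_left left_diff_distrib)
  have cu: "c \<bullet> u = 0" using w rot_orthogonal by (simp add: c_def inner_diff_left)
  have "c \<bullet> rot w = - (rot w \<bullet> rot w)" using rot_orthogonal by (simp add: c_def inner_diff_left)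
  then have c0: "c \<noteq> 0" using rot_nonzero[OF w(1,2)] by auto
  have ge: "c \<bullet> d z \<ge> 0" if "z \<in> index_set n V" for z
  proof (cases "z = x")
    case False
    then have z: "z \<in> ?I" using that by simp
    show ?thesis unfolding cd[OF z] using le[OF z] pos[OF z] by simp
  qed (simp add: d_def)
  have xc: "x \<in> X c" using ge xi by (auto simp: maximizers_def d_def inner_diff_right)
  have yc: "y \<in> X c"
  proof -
    have "c \<bullet> d y = 0" using cd[OF y(1)] y(2) by simp
    then have "c \<bullet> pt y = c \<bullet> pt x" by (simp add: d_def inner_diff_right)
    then show ?thesis using xc y(1) by (simp add: maximizers_def)
  qed
  have "rot (rot w) = (u \<bullet> w) *\<^sub>R u - (u \<bullet> u) *\<^sub>R w"
    unfolding vec_eq_iff forall_3 by (simp add: cross3_simps)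
  then have "rot c = r *\<^sub>R rot w + (u \<bullet> u) *\<^sub>R w"
    using w(2) by (simp add: c_def Cross3.right_diff_distrib cross_mult_right inner_commute)
  then have "rot c \<bullet> d y = r * (rot w \<bullet> d y) + (u \<bullet> u) * (w \<bullet> d y)" by (simp add: inner_add_left)
  \<comment> \<open>The positive factor shows that \<open>x\<close>, not \<open>y\<close>, is the
    end in the direction of rotation.\<close>
  also have "\<dots> = (r * r + u \<bullet> u) * (w \<bullet> d y)"
    using slope_mult[OF y(1)] y(2) by (simp add: distrib_right)
  also have "\<dots> > 0" using pos[OF y(1)] u_nonzero
    by (intro mult_pos_pos) (auto intro!: add_nonneg_pos)
  finally have lt: "rot c \<bullet> pt y < rot c \<bullet> pt x" by (simp add: d_def inner_diff_right)
  have "card {x, y} \<le> card (X c)" using xc yc finite_maximizers[OF finite_V] by (intro card_mono) auto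
  then have c2: "card (X c) = 2" using y(1) card_X_le_2[OF c0 cu] by auto
  let ?c = "(1 / norm c) *\<^sub>R c"
  have k: "1 / norm c > 0" using c0 by simp
  have Xc: "X ?c = X c" by (rule maximizers_scale[OF k])
  have "?c \<in> shadow_edges" unfolding shadow_edges_def mem_Collect_eq Xc using c0 cu c2 by simp
  moreover have "rot ?c \<bullet> pt y < rot ?c \<bullet> pt x"
    unfolding cross_mult_right inner_scaleR_left using lt k by (rule mult_strict_left_mono)
  then have "head ?c x" unfolding head_def Xc using xc yc by blast
  ultimately show ?thesis by blast
qed

text \<open>Sending each edge to its head is a bijection; this is the elementary reason why a
  polygon has as many vertices as edges.\<close>

lemma card_shadow_vertices: "card shadow_vertices = card shadow_edges"
proof -
  define h where "h w = (SOME x. x \<in> shadow_vertices \<and> head w x)" for w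
  have h: "h w \<in> shadow_vertices \<and> head w (h w)" if "w \<in> shadow_edges" for w
  proof -
    have "\<exists>x. x \<in> shadow_vertices \<and> head w x" using head_exists[OF that] by blast
    then show ?thesis unfolding h_def by (rule someI_ex)
  qed
  have "bij_betw h shadow_edges shadow_vertices"
    unfolding bij_betw_def
  proof
    show "inj_on h shadow_edges"
    proof (rule inj_onI)
      fix w w' assume *: "w \<in> shadow_edges" "w' \<in> shadow_edges" "h w = h w'"
      then have "head w (h w)" "head w' (h w)" using h[OF *(1)] h[OF *(2)] by simp_all
      then show "w = w'" using head_injective[OF *(1,2)] by blast
    qed
    show "h ` shadow_edges = shadow_vertices"
    proof
      show "h ` shadow_edges \<subseteq> shadow_vertices" using h by blast
      show "shadow_vertices \<subseteq> h ` shadow_edges"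
      proof
        fix x assume "x \<in> shadow_vertices"
        then obtain w where w: "w \<in> shadow_edges" "head w x" using head_surjective by blast
        then have "x = h w" using head_unique[OF w] h[OF w(1)] by blast
        then show "x \<in> h ` shadow_edges" using w by blast
      qed
    qed
  qed
  then show ?thesis by (metis bij_betw_same_card)
qed

definition v_edges :: "nat \<Rightarrow> (real^3) set" where
  "v_edges i = {w. norm w = 1 \<and> w \<bullet> u = 0 \<and> w \<bullet> v i = 0}"

definition t_edges :: "(real^3) set \<Rightarrow> (real^3) set" where
  "t_edges B = {w. norm w = 1 \<and> w \<bullet> u = 0 \<and> M w = B}"

lemma unit_orthogonal_pair:
  assumes "rot x \<noteq> 0"
  shows "{w. norm w = 1 \<and> w \<bullet> u = 0 \<and> w \<bullet> x = 0} = {(1 / norm (rot x)) *\<^sub>R rot x, - ((1 / norm (rot x)) *\<^sub>R rot x)}"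
proof -
  have "w \<bullet> u = 0 \<and> w \<bullet> x = 0 \<longleftrightarrow> (\<exists>l. w = l *\<^sub>R rot x)" for w
  proof
    assume *: "w \<bullet> u = 0 \<and> w \<bullet> x = 0"
    obtain l where "w = l *\<^sub>R rot x" by (rule orthogonal_two_parallel[OF assms conjunct1[OF *] conjunct2[OF *]])
    then show "\<exists>l. w = l *\<^sub>R rot x" by blast
  next
    assume "\<exists>l. w = l *\<^sub>R rot x"
    then show "w \<bullet> u = 0 \<and> w \<bullet> x = 0" by (auto simp: rot_orthogonal)
  qed
  then show ?thesis using unit_vectors_on_line[OF assms] by simp
qed

lemma card_v_edges:
  assumes "i < n" shows "card (v_edges i) = 2"
proof -
  let ?c = "(1 / norm (rot (v i))) *\<^sub>R rot (v i)"
  have c0: "rot (v i) \<noteq> 0" by (rule cross_u_v[OF assms])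
  have "?c \<noteq> 0" using c0 by simp
  have "?c \<noteq> - ?c"
  proof
    assume "?c = - ?c"
    then have "?c + ?c = 0" by (metis add.right_inverse)
    then have "2 *\<^sub>R ?c = 0" by (simp only: scaleR_2)
    then show False using \<open>?c \<noteq> 0\<close> by simp
  qed
  then show ?thesis unfolding v_edges_def unit_orthogonal_pair[OF c0] by simp
qed

text \<open>Two opposite unit vectors are orthogonal to \<open>u\<close> and level on the pair
  \<open>B\<close>, and exactly one of them has the third point below.\<close>

lemma card_t_edges:
  assumes V3: "card V = 3" and B: "B \<subseteq> V" "card B = 2"
  shows "card (t_edges B) = 1"
proof -
  obtain t t' where t: "B = {t, t'}" "t \<noteq> t'" using B by (auto simp: card_2_iff)
  have tV: "t \<in> V" "t' \<in> V" using t B by auto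
  have "card (V - {t, t'}) = 1" using V3 t tV finite_V by (simp add: card_Diff_subset)
  then obtain r where r: "V - {t, t'} = {r}" by (auto simp: card_1_singleton_iff)
  then have V: "V = {t, t', r}" "r \<noteq> t" "r \<noteq> t'" using tV by auto
  define c where "c = (1 / norm (rot (t - t'))) *\<^sub>R rot (t - t')"
  have c0: "rot (t - t') \<noteq> 0" by (rule cross_u_t[OF tV t(2)])
  have unit: "{w. norm w = 1 \<and> w \<bullet> u = 0 \<and> w \<bullet> (t - t') = 0} = {c, - c}"
    unfolding unit_orthogonal_pair[OF c0] c_def by simp
  then have cc: "norm c = 1" "c \<bullet> u = 0" "c \<bullet> t = c \<bullet> t'" by (auto simp: inner_diff_right)
  have ne: "c \<bullet> t \<noteq> c \<bullet> r"
  proof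
    assume "c \<bullet> t = c \<bullet> r"
    then have "M c = V" using cc V by (auto simp: top_points_def)
    moreover have "c \<noteq> 0" using cc by auto
    ultimately show False using tiny_face[of c] cc V3 by simp
  qed
  have Mw: "M w = B \<longleftrightarrow> w \<bullet> t = w \<bullet> t' \<and> w \<bullet> r < w \<bullet> t" for w
  proof
    assume MB: "M w = B"
    then have "t \<in> M w" "t' \<in> M w" "r \<notin> M w" using t V by auto
    then show "w \<bullet> t = w \<bullet> t' \<and> w \<bullet> r < w \<bullet> t" using V unfolding top_points_def by fastforce
  next
    assume "w \<bullet> t = w \<bullet> t' \<and> w \<bullet> r < w \<bullet> t"
    then show "M w = B" using V t by (auto simp: top_points_def)
  qed
  have "t_edges B = {w \<in> {c, - c}. w \<bullet> r < w \<bullet> t}"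
    unfolding t_edges_def unit[symmetric] Mw by (auto simp: inner_diff_right)
  also have "\<dots> = (if c \<bullet> r < c \<bullet> t then {c} else {- c})" using ne by auto
  finally show ?thesis by simp
qed

text \<open>Two maximizers mean one free generator or two top points. The first kind occurs for two
  opposite normals per generator, the second once for each pair in \<open>V\<close>;
  \<open>card V choose 2\<close> is 0 for a point and 3 for a triangle.\<close>

lemma card_shadow_edges:
  assumes "card V = 1 \<or> card V = 3"
  shows "card shadow_edges = 2 * n + (card V choose 2)"
proof -
  let ?T = "{B. B \<subseteq> V \<and> card B = 2}"
  have eq: "shadow_edges = (\<Union>i<n. v_edges i) \<union> (\<Union>B\<in>?T. t_edges B)"
  proof
    show "shadow_edges \<subseteq> (\<Union>i<n. v_edges i) \<union> (\<Union>B\<in>?T. t_edges B)"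
    proof
      fix w assume ws: "w \<in> shadow_edges"
      then have w: "norm w = 1" "w \<bullet> u = 0" "card (X w) = 2" by (auto simp: shadow_edges_def)
      show "w \<in> (\<Union>i<n. v_edges i) \<union> (\<Union>B\<in>?T. t_edges B)"
      proof (cases "Z w = {}")
        case True
        then have "card (M w) = 2" using w(3) unfolding card_X by simp
        then show ?thesis using w M_subset[of w] by (auto simp: t_edges_def)
      next
        case False
        then show ?thesis using w by (auto simp: v_edges_def zeros_def)
      qed
    qed
    show "(\<Union>i<n. v_edges i) \<union> (\<Union>B\<in>?T. t_edges B) \<subseteq> shadow_edges"
    proof
      fix w assume "w \<in> (\<Union>i<n. v_edges i) \<union> (\<Union>B\<in>?T. t_edges B)"
      then consider i where "i < n" "w \<in> v_edges i" | B where "card B = 2" "w \<in> t_edges B" by auto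
      then show "w \<in> shadow_edges"
      proof cases
        case 1
        then have w: "norm w = 1" "w \<bullet> u = 0" "i \<in> Z w" by (auto simp: v_edges_def zeros_def)
        then have "w \<noteq> 0" by auto
        moreover have "card (Z w) \<noteq> 0" using w(3) by auto
        ultimately have "card (Z w) = 1" "card (M w) = 1"
          using tiny_face[of w] w card_M_pos[of w] by linarith+
        then show ?thesis using w unfolding shadow_edges_def card_X by simp
      next
        case 2
        then have w: "norm w = 1" "w \<bullet> u = 0" "card (M w) = 2" by (auto simp: t_edges_def)
        then have "w \<noteq> 0" by auto
        then have "card (Z w) = 0" using tiny_face[of w] w by linarith
        then show ?thesis using w unfolding shadow_edges_def card_X by simp
      qed
    qed
  qed
  have fT: "finite ?T" by (rule finite_subset[of _ "Pow V"]) (use finite_V in auto)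
  have fv: "finite (v_edges i)" if "i < n" for i
    using card_v_edges[OF that] by (intro card_ge_0_finite) simp
  have ct: "card (t_edges B) = 1" if "B \<in> ?T" for B
  proof -
    have "card B \<le> card V" using that finite_V by (intro card_mono) auto
    then have "card V = 3" using that assms by auto
    then show ?thesis using card_t_edges that by blast
  qed
  have ft: "finite (t_edges B)" if "B \<in> ?T" for B
    using ct[OF that] by (intro card_ge_0_finite) simp
  have tiny: "card (Z w) + card (M w) \<le> 2" if "norm w = 1" "w \<bullet> u = 0" for w
  proof -
    have "w \<noteq> 0" using that(1) by auto
    then show ?thesis using tiny_face that(2) by blast
  qed
  have "card (\<Union>i<n. v_edges i) = (\<Sum>i<n. card (v_edges i))"
  proof (rule card_UN_disjoint)
    show "\<forall>i\<in>{..<n}. \<forall>j\<in>{..<n}. i \<noteq> j \<longrightarrow> v_edges i \<inter> v_edges j = {}"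
    proof (intro ballI impI, rule ccontr)
      fix i j assume ij: "i \<in> {..<n}" "j \<in> {..<n}" "i \<noteq> j" "v_edges i \<inter> v_edges j \<noteq> {}"
      then obtain w where w: "norm w = 1" "w \<bullet> u = 0" "w \<bullet> v i = 0" "w \<bullet> v j = 0" by (auto simp: v_edges_def)
      then have "{i, j} \<subseteq> Z w" using ij by (auto simp: zeros_def)
      then have "card {i, j} \<le> card (Z w)" by (intro card_mono) auto
      then show False using tiny[OF w(1,2)] card_M_pos[of w] ij by simp
    qed
  qed (use fv in auto)
  also have "\<dots> = 2 * n" using card_v_edges by simp
  finally have c1: "card (\<Union>i<n. v_edges i) = 2 * n" .
  have "card (\<Union>B\<in>?T. t_edges B) = (\<Sum>B\<in>?T. card (t_edges B))"
    by (rule card_UN_disjoint) (use fT ft in \<open>auto simp: t_edges_def\<close>)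
  also have "\<dots> = card ?T" using ct by simp
  also have "\<dots> = card V choose 2" using n_subsets[OF finite_V] by simp
  finally have c2: "card (\<Union>B\<in>?T. t_edges B) = card V choose 2" .
  have disj: "(\<Union>i<n. v_edges i) \<inter> (\<Union>B\<in>?T. t_edges B) = {}"
  proof (rule ccontr)
    assume "\<not> ?thesis"
    then obtain w i B where w: "i < n" "w \<in> v_edges i" "card B = 2" "w \<in> t_edges B" by auto
    then have w': "norm w = 1" "w \<bullet> u = 0" "i \<in> Z w" "card (M w) = 2"
      by (auto simp: v_edges_def t_edges_def zeros_def)
    then have "card (Z w) \<noteq> 0" by auto
    then show False using tiny[OF w'(1,2)] w'(4) by linarith
  qed
  show ?thesis unfolding eq
    using card_Un_disjoint[OF _ _ disj] c1 c2 fT ft fv by auto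
qed

end

theorem (in generic_config) equiprojective_body:
  assumes "card V = 1 \<or> card V = 3"
  shows "equiprojective (2 * n + (card V choose 2)) body'"
  unfolding equiprojective_def
proof (intro conjI allI impI)
  show "polytope3 body'" unfolding polytope3_def using polytope_body aff_dim_body by blast
  fix u assume u: "u \<noteq> 0 \<and> (\<forall>F. F facet_of body' \<longrightarrow> \<not> plane_orth_facet u F)"
  interpret generic_projection v n V u by unfold_locales (use u in auto)
  have "card {y. y extreme_point_of (pr ` body')} = card shadow_vertices"
    unfolding extreme_points_shadow by (rule card_image[OF inj_on_shadow])
  then show "card {y. y extreme_point_of (proj_plane u ` body')} = 2 * n + (card V choose 2)"
    using card_shadow_vertices card_shadow_edges[OF assms] by simp
qed

section \<open>Counting combinatorial types\<close>

lemma same_comb_type_refl: "same_comb_type P P"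
  unfolding same_comb_type_def by (rule exI[of _ id]) auto

lemma same_comb_type_sign_vectors:
  assumes "generic_config v n V" "generic_config v' n V" "same_comb_type (body v n V) (body v' n V)"
  shows "\<exists>D \<in> {..<n} \<rightarrow>\<^sub>E {..n}. \<exists>A \<in> V \<rightarrow>\<^sub>E Pow {..<n}. fst ` vertices v' n V =
    (\<lambda>x. {j. j < n \<and> (odd (card {i \<in> fst x. D i = j}) \<noteq> (j \<in> A (snd x)))}) ` vertices v n V"
proof -
  obtain H where H: "bij_betw H (vertices v n V) (vertices v' n V)"
    "\<And>w. w \<noteq> 0 \<Longrightarrow> \<exists>w'. w' \<noteq> 0 \<and> H ` maximizers v n V w = maximizers v' n V w'"
    by (rule same_comb_type_vertex_bijection[OF assms]) blast
  interpret comb_isomorphism v v' n V H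
    by (intro comb_isomorphism.intro comb_isomorphism_axioms.intro assms H)
  show ?thesis by (rule sign_vectors_determined)
qed

definition comb_types :: "nat \<Rightarrow> (real^3) set set set" where
  "comb_types k = {P. equiprojective k P} // {(P, Q). same_comb_type P Q}"

text \<open>Within one class all sets of sign vectors arise from those of a fixed member
  \<open>v0\<close> through a pair \<open>(D, A)\<close>, and separated configurations have
  different sets. So the number of pairs bounds each fibre of \<open>cls\<close>.\<close>

lemma comb_type_count:
  assumes n: "3 \<le> n" and V: "finite V" "V \<noteq> {}" "card V = 1 \<or> card V = 3"
    and Vt: "\<And>t t' t''. \<lbrakk>t \<in> V; t' \<in> V; t'' \<in> V; distinct [t, t', t'']\<rbrakk> \<Longrightarrow> cross3 (t' - t) (t'' - t) \<noteq> 0"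
    and k: "k = 2 * n + (card V choose 2)"
    and fin: "finite (comb_types k)"
  shows "(\<Prod>i<n. max 1 ((i div 4) ^ 4)) \<le> card (comb_types k) * ((n + 1) ^ n * 8 ^ n)"
proof -
  have V3: "card V \<le> 3" using V(3) by auto
  obtain F where F0: "finite F \<and> card F = (\<Prod>i<n. max 1 ((i div 4) ^ 4)) \<and> (\<forall>v\<in>F. super_generic V v n) \<and>
    (\<forall>v\<in>F. \<forall>v'\<in>F. v \<noteq> v' \<longrightarrow> separated n v v')"
    using separated_family[OF V(1) Vt] by (rule exE)
  then have F: "finite F" "card F = (\<Prod>i<n. max 1 ((i div 4) ^ 4))"
    and gen: "\<And>v. v \<in> F \<Longrightarrow> generic_config v n V"
    and sep: "\<And>v v'. \<lbrakk>v \<in> F; v' \<in> F; v \<noteq> v'\<rbrakk> \<Longrightarrow> separated n v v'"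
    using super_generic_imp_generic_config[OF _ n V(1,2) V3] by blast+
  let ?R = "{(P, Q). same_comb_type P Q}"
  define cls where "cls v = ?R `` {body v n V}" for v
  have clsC: "cls v \<in> (comb_types k)" if "v \<in> F" for v
  proof -
    have "equiprojective k (body v n V)"
      unfolding k by (rule generic_config.equiprojective_body[OF gen[OF that] V(3)])
    then show ?thesis unfolding cls_def comb_types_def by (intro quotientI) simp
  qed
  have fibre: "card {v \<in> F. cls v = c} \<le> (n + 1) ^ n * 8 ^ n" for c
  proof (cases "{v \<in> F. cls v = c} = {}")
    case True
    then show ?thesis by (metis card.empty zero_le)
  next
    case False
    then obtain v0 where v0: "v0 \<in> F" "cls v0 = c" by blast
    let ?DA = "({..<n} \<rightarrow>\<^sub>E {..n}) \<times> (V \<rightarrow>\<^sub>E Pow {..<n})"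
    let ?G = "\<lambda>(D, A). (\<lambda>x. {j. j < n \<and> (odd (card {i \<in> fst x. D i = j}) \<noteq> (j \<in> A (snd x)))}) ` vertices v0 n V"
    let ?top = "\<lambda>v. fst ` vertices v n V"
    have fDA: "finite ?DA" using V(1) by (intro finite_cartesian_product finite_PiE) auto
    have inj: "inj_on ?top {v \<in> F. cls v = c}"
    proof (rule inj_onI, rule ccontr)
      fix v v' assume *: "v \<in> {v \<in> F. cls v = c}" "v' \<in> {v \<in> F. cls v = c}" "?top v = ?top v'" "v \<noteq> v'"
      then show False using separated_sign_vectors[OF sep gen gen, of v v'] by simp
    qed
    have sub: "?top ` {v \<in> F. cls v = c} \<subseteq> ?G ` ?DA"
    proof clarify
      fix v assume v: "v \<in> F" "c = cls v"
      \<comment> \<open>By reflexivity the body lies in its own class, which is that of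
        \<open>v0\<close>.\<close>
      have "body v n V \<in> cls v0" using v v0 same_comb_type_refl by (simp add: cls_def)
      then have "same_comb_type (body v0 n V) (body v n V)" by (simp add: cls_def)
      from same_comb_type_sign_vectors[OF gen[OF v0(1)] gen[OF v(1)] this]
      obtain D A where DA: "D \<in> {..<n} \<rightarrow>\<^sub>E {..n}" "A \<in> V \<rightarrow>\<^sub>E Pow {..<n}" "?top v = ?G (D, A)"
        unfolding case_prod_conv by blast
      then show "?top v \<in> ?G ` ?DA" by (intro image_eqI[of _ _ "(D, A)"]) auto
    qed
    have "card {v \<in> F. cls v = c} = card (?top ` {v \<in> F. cls v = c})" using card_image[OF inj] by simp
    also have "\<dots> \<le> card (?G ` ?DA)" using sub fDA by (intro card_mono) auto
    also have "\<dots> \<le> card ?DA" by (rule card_image_le[OF fDA])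
    also have "\<dots> = (n + 1) ^ n * (2 ^ n) ^ card V"
      using V(1) by (simp add: card_cartesian_product card_funcsetE card_Pow)
    \<comment> \<open>Three sets of sign changes are charged also when \<open>V\<close> is a point,
      to have one bound for both parities.\<close>
    also have "\<dots> \<le> (n + 1) ^ n * (2 ^ n) ^ 3" using V3 by (intro mult_left_mono power_increasing) auto
    also have "(2 ^ n) ^ 3 = (8 ^ n :: nat)" by (simp add: power_mult[symmetric] mult.commute[of n] power_mult)
    finally show ?thesis .
  qed
  have "F = (\<Union>c\<in>(comb_types k). {v \<in> F. cls v = c})" using clsC by blast
  then have "card F = card (\<Union>c\<in>(comb_types k). {v \<in> F. cls v = c})" by simp
  also have "\<dots> \<le> (\<Sum>c\<in>(comb_types k). card {v \<in> F. cls v = c})" by (rule card_UN_le[OF fin])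
  also have "\<dots> \<le> (\<Sum>c\<in>(comb_types k). (n + 1) ^ n * 8 ^ n)" by (intro sum_mono fibre)
  also have "\<dots> = card (comb_types k) * ((n + 1) ^ n * 8 ^ n)" by simp
  finally show ?thesis using F(2) by simp
qed

section \<open>Asymptotic estimates\<close>

lemma fact_lower_bound: "real n ^ n \<le> exp (real n) * fact n"
proof -
  \<comment> \<open>A single term of the exponential series is compared with its sum.\<close>
  have "(\<Sum>i\<in>{n}. real n ^ i /\<^sub>R fact i) \<le> (\<Sum>i. real n ^ i /\<^sub>R fact i)"
    by (rule sum_le_suminf) (auto intro: summable_exp)
  then have "real n ^ n / fact n \<le> exp (real n)" by (simp add: exp_def divide_inverse_commute)
  then show ?thesis by (simp add: field_simps)
qed

lemma family_size_lower_bound: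
  "real (fact n) ^ 4 \<le> real (\<Prod>i<n. max 1 ((i div 4) ^ 4)) * 8 ^ (4 * n)"
proof -
  have step: "real (Suc i) ^ 4 \<le> real (max 1 ((i div 4) ^ 4)) * 8 ^ 4" for i
  proof -
    \<comment> \<open>With \<open>m = i div 4 \<ge> 1\<close> one has
      \<open>i + 1 \<le> 4 * m + 4 \<le> 8 * m\<close>; for \<open>i < 4\<close> the maximum is 1
      and 8 suffices.\<close>
    have "Suc i \<le> 8 * max 1 (i div 4)" by (cases "i < 4") (auto simp: max_def)
    then have "Suc i ^ 4 \<le> (8 * max 1 (i div 4)) ^ 4" by (intro power_mono) auto
    also have "\<dots> = max 1 ((i div 4) ^ 4) * 8 ^ 4" by (cases "i div 4 = 0") (auto simp: power_mult_distrib max_def)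
    finally have "real (Suc i ^ 4) \<le> real (max 1 ((i div 4) ^ 4) * 8 ^ 4)" by (simp only: of_nat_le_iff)
    then show ?thesis by simp
  qed
  have "real (fact n) ^ 4 = (\<Prod>i<n. real (Suc i) ^ 4)"
  proof (induction n)
    case (Suc n)
    have "real (fact (Suc n)) = real (fact n) * real (Suc n)" by (simp add: algebra_simps)
    then show ?case by (simp only: prod.lessThan_Suc power_mult_distrib Suc.IH)
  qed simp
  also have "\<dots> \<le> (\<Prod>i<n. real (max 1 ((i div 4) ^ 4)) * 8 ^ 4)"
    by (intro prod_mono) (use step in auto)
  also have "\<dots> = real (\<Prod>i<n. max 1 ((i div 4) ^ 4)) * 8 ^ (4 * n)"
    by (simp add: prod.distrib power_mult del: of_nat_max)
  finally show ?thesis .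
qed

text \<open>Logarithms of \<open>n ^ n \<le> exp n * fact n\<close> raised to the fourth power and
  combined with \<open>bound\<close>. The 4 comes from the exponential; the 6 counts four powers
  \<open>8 ^ n\<close> from \<open>family_size_lower_bound\<close>, one from the sign changes, and
  one from \<open>ln (n + 1) \<le> ln 8 + ln n\<close>.\<close>

lemma comb_type_log_bound:
  assumes n: "3 \<le> n" and bound: "(\<Prod>i<n. max 1 ((i div 4) ^ 4)) \<le> c * ((n + 1) ^ n * 8 ^ n)"
  shows "c > 0" "3 * real n * ln n - (4 + 6 * ln 8) * n \<le> ln (real c)"
proof -
  let ?P = "\<Prod>i<n. max 1 ((i div 4) ^ 4)"
  have "?P > 0" by (intro prod_pos) auto
  then show c: "c > 0" using bound by (cases "c = 0") auto
  have n0: "real n > 0" using n by simp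
  have "(real n ^ n) ^ 4 \<le> (exp (real n) * fact n) ^ 4"
    by (intro power_mono fact_lower_bound) auto
  also have "\<dots> = exp (real n) ^ 4 * real (fact n) ^ 4" by (simp add: power_mult_distrib)
  also have "\<dots> \<le> exp (real n) ^ 4 * (real ?P * 8 ^ (4 * n))"
    by (intro mult_left_mono family_size_lower_bound) auto
  also have "\<dots> \<le> exp (real n) ^ 4 * (real (c * ((n + 1) ^ n * 8 ^ n)) * 8 ^ (4 * n))"
    using bound by (intro mult_left_mono mult_right_mono) (simp_all only: of_nat_le_iff, auto)
  also have "\<dots> = exp (real n) ^ 4 * (real c * real (n + 1) ^ n * 8 ^ n * 8 ^ (4 * n))"
    by simp
  finally have main: "(real n ^ n) ^ 4 \<le> exp (real n) ^ 4 * (real c * real (n + 1) ^ n * 8 ^ n * 8 ^ (4 * n))" .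
  have "ln ((real n ^ n) ^ 4) \<le> ln (exp (real n) ^ 4 * (real c * real (n + 1) ^ n * 8 ^ n * 8 ^ (4 * n)))"
    using main n0 by (intro ln_mono) auto
  moreover have "ln ((real n ^ n) ^ 4) = 4 * real n * ln n" using n0 by (simp add: ln_realpow)
  moreover have "ln (exp (real n) ^ 4 * (real c * real (n + 1) ^ n * 8 ^ n * 8 ^ (4 * n))) =
      4 * n + ln c + n * ln (n + 1) + 5 * n * ln 8"
    using c by (simp add: ln_mult ln_realpow algebra_simps)
  ultimately have 1: "4 * real n * ln n \<le> 4 * n + ln c + n * ln (n + 1) + 5 * n * ln 8" by simp
  have "ln (real n + 1) \<le> ln (8 * real n)" using n by simp
  also have "\<dots> = ln 8 + ln n" using n0 by (simp add: ln_mult)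
  finally have "real n * ln (real n + 1) \<le> real n * (ln 8 + ln n)" using n0 by (intro mult_left_mono) auto
  then have "3 * real n * ln n \<le> 4 * n + ln c + 6 * n * ln 8" using 1 by (simp add: algebra_simps)
  then show "3 * real n * ln n - (4 + 6 * ln 8) * n \<le> ln (real c)" by (simp add: algebra_simps)
qed

lemma affinely_independent_triangle:
  fixes t t' t'' :: "real^3"
  assumes "t \<in> {0, axis 1 1, axis 2 1}" "t' \<in> {0, axis 1 1, axis 2 1}" "t'' \<in> {0, axis 1 1, axis 2 1}"
    "distinct [t, t', t'']"
  shows "cross3 (t' - t) (t'' - t) \<noteq> 0"
proof
  assume "cross3 (t' - t) (t'' - t) = 0"
  then have "cross3 (t' - t) (t'' - t) $ 3 = 0" by simp
  then show False using assms by (auto simp: cross_components axis_def)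
qed

text \<open>A point and a triangle as \<open>V\<close> cover the even and the odd \<open>k\<close>;
  \<open>9 \<le> k\<close> guarantees three generators in the odd case.\<close>

lemma e_lower_bound:
  assumes "9 \<le> k" and fin: "finite (comb_types k)"
  obtains n where "3 \<le> n" "k = 2 * n \<or> k = 2 * n + 3"
    "(\<Prod>i<n. max 1 ((i div 4) ^ 4)) \<le> card (comb_types k) * ((n + 1) ^ n * 8 ^ n)"
proof (cases "even k")
  case True
  define n where "n = k div 2"
  have n: "3 \<le> n" "k = 2 * n" using True assms by (auto simp: n_def)
  have "(\<Prod>i<n. max 1 ((i div 4) ^ 4)) \<le> card (comb_types k) * ((n + 1) ^ n * 8 ^ n)"
    by (rule comb_type_count[of n "{0}"]) (use n fin in auto)
  then show ?thesis using that n by blast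
next
  case False
  define n where "n = (k - 3) div 2"
  have n: "3 \<le> n" "k = 2 * n + 3" using False assms by (auto simp: n_def elim!: oddE)
  let ?V = "{0, axis 1 1, axis 2 1} :: (real^3) set"
  have "axis 1 1 \<noteq> (axis 2 1 :: real^3)" by (simp add: axis_eq_axis)
  then have V3: "card ?V = 3" by (simp add: axis_eq_0_iff)
  have "(\<Prod>i<n. max 1 ((i div 4) ^ 4)) \<le> card (comb_types k) * ((n + 1) ^ n * 8 ^ n)"
  proof (rule comb_type_count[of n ?V])
    show "k = 2 * n + (card ?V choose 2)" using n V3 by (simp add: choose_two)
  qed (use n fin V3 affinely_independent_triangle in auto)
  then show ?thesis using that n by blast
qed

theorem theorem1p1:
  "\<exists>g :: nat \<Rightarrow> real. g \<in> O(\<lambda>k. 1 / ln (real k)) \<and>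
     (\<forall>\<^sub>F k in sequentially.
        e k = \<infinity> \<or> real k powr (real k * (3/2 + g k)) \<le> real (the_enat (e k)))"
proof -
  \<comment> \<open>\<open>4 + 6 * ln 8\<close> is the loss in \<open>comb_type_log_bound\<close>.
    The other terms are 3/2 times the loss \<open>3 * k + k * ln 4\<close> in passing from
    \<open>k * ln k\<close> to \<open>2 * n * ln n\<close>.\<close>
  define K where "K = 4 + 6 * ln 8 + 9/2 + 3/2 * ln (4::real)"
  \<comment> \<open>With this choice \<open>k powr (k * g k)\<close> is
    \<open>exp (- K * k)\<close>.\<close>
  define g where "g = (\<lambda>k. - K * (1 / ln (real k)))"
  have "g \<in> O(\<lambda>k. 1 / ln (real k))" 
    by (rule bigoI[of _ "\<bar>K\<bar>"]) (simp add: g_def abs_mult)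
  moreover have "\<forall>\<^sub>F k in sequentially.
        e k = \<infinity> \<or> real k powr (real k * (3/2 + g k)) \<le> real (the_enat (e k))"
  proof (rule eventually_sequentiallyI[of 9])
    fix k :: nat assume k: "9 \<le> k"
    show "e k = \<infinity> \<or> real k powr (real k * (3/2 + g k)) \<le> real (the_enat (e k))"
    proof (cases "finite (comb_types k)")
      case False
      then show ?thesis by (simp add: e_def comb_types_def)
    next
      case True
      obtain n where n: "3 \<le> n" "k = 2 * n \<or> k = 2 * n + 3"
        and b: "(\<Prod>i<n. max 1 ((i div 4) ^ 4)) \<le> card (comb_types k) * ((n + 1) ^ n * 8 ^ n)"
        by (rule e_lower_bound[OF k True])
      note c = comb_type_log_bound[OF n(1) b]
      have ek: "real (the_enat (e k)) = real (card (comb_types k))" using True by (simp add: e_def comb_types_def)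
      \<comment> \<open>The last bound holds in the odd case because
        \<open>n \<ge> 3\<close>.\<close>
      have n': "real k - 3 \<le> 2 * real n" "2 * real n \<le> real k" "real k \<le> 4 * real n" using n by auto
      have k0: "real k > 0" using k by simp
      have lnk: "ln (real k) > 0" using k by simp
      \<comment> \<open>This absorbs the term \<open>3 * ln k\<close>, which stems from
        \<open>k - 3 \<le> 2 * n\<close>, into a multiple of \<open>k\<close>.\<close>
      have "ln (real k) \<le> real k" by (rule less_imp_le[OF ln_less_self[OF k0]])
      note lnk = lnk this
      have "ln (real k) \<le> ln (4 * real n)" using n' k0 by (intro ln_mono) auto
      also have "\<dots> = ln 4 + ln n" using n(1) by (simp add: ln_mult)
      finally have ln_n: "ln (real k) - ln 4 \<le> ln (real n)" by simp
      have "(real k - 3) * ln k - real k * ln 4 \<le> 2 * n * ln k - 2 * n * ln 4"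
        using n' lnk by (intro diff_mono mult_right_mono) auto
      also have "\<dots> = 2 * n * (ln k - ln 4)" by (simp add: algebra_simps)
      also have "\<dots> \<le> 2 * n * ln n" using ln_n by (intro mult_left_mono) auto
      finally have 1: "real k * ln k - 3 * real k - real k * ln 4 \<le> 2 * n * ln n"
        using lnk by (simp add: algebra_simps)
      have "(4 + 6 * ln 8) * real n \<le> (4 + 6 * ln 8) * real k"
        using n' by (intro mult_left_mono) auto
      then have "3/2 * (real k * ln k) - K * k \<le> ln (card (comb_types k))"
        using 1 c(2) unfolding K_def by (simp add: algebra_simps)
      moreover have "real k * (3/2 + g k) * ln k = 3/2 * (real k * ln k) - K * k"
        using lnk k by (simp add: g_def field_simps)
      ultimately have "real k powr (real k * (3/2 + g k)) \<le> exp (ln (card (comb_types k)))"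
        using k0 by (simp add: powr_def)
      then show ?thesis using c(1) ek by simp
    qed
  qed
  ultimately show ?thesis by blast
qed

end
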